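(* Let $(P,[\cdot_\lambda\cdot],\cdot_\lambda\cdot)$ be a Poisson conformal algebra and $(P,\delta,\Delta)$ a Poisson conformal coalgebra, where $P$ is free as a $\mathbf k[\partial]$-module. Equip $P^{\ast c}$ with the Poisson conformal algebra structure obtained from $\delta$ and $\Delta$, namely $$([f_\lambda g])_\mu(a)=\sum f_\lambda(a_{[1]})\,g_{\mu-\lambda}(a_{[2]}),\qquad (f_\lambda g)_\mu(a)=\sum f_\lambda(a_{(1)})\,g_{\mu-\lambda}(a_{(2)}),$$ for $f,g\in P^{\ast c}$, $a\in P$, where $\delta(a)=\sum a_{[1]}\otimes a_{[2]}$ and $\Delta(a)=\sum a_{(1)}\otimes a_{(2)}$. Then the following conditions are equivalent. (a) $(P,[\cdot_\lambda\cdot],\cdot_\lambda\cdot,\delta,\Delta)$ is a Poisson conformal bialgebra. (b) $(P,P^{\ast c},\mathfrak{ad}_P^\ast,-\mathfrak L_P^\ast,\mathfrak{ad}_{P^{\ast c}}^\ast,-\mathfrak L_{P^{\ast c}}^\ast)$ is a matched pair of Poisson conformal algebras. (c) $(P\oplus P^{\ast c},P,P^{\ast c})$ is a Manin triple of Poisson conformal algebras with the invariant symmetric conformal bilinear form on $P\oplus P^{\ast c}$ defined by $\langle a+f,b+g\rangle_\lambda=f_\lambda(b)+g_{-\lambda}(a)$ for $a,b\in P$, $f,g\in P^{\ast c}$.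
   Context: Let $\mathbf k$ be a field of characteristic $0$. All $\mathbf k[\partial]$-modules are assumed finitely generated; $\otimes$ is over $\mathbf k$, $I$ is the identity, $\tau(u\otimes v)=v\otimes u$. Poisson conformal algebras. An associative conformal algebra is a $\mathbf k[\partial]$-module $P$ with a $\mathbf k$-bilinear map $P\times P\to P[\lambda]$, $(a,b)\mapsto a_\lambda b$, with $(\partial a)_\lambda b=-\lambda a_\lambda b$, $a_\lambda(\partial b)=(\partial+\lambda)a_\lambda b$, $(a_\lambda b)_{\lambda+\mu}c=a_\lambda(b_\mu c)$; it is commutative if $a_\lambda b=b_{-\lambda-\partial}a$. (If $b_\nu a=\sum_k\nu^kc_k$, then $b_{-\lambda-\partial}a=\sum_k(-\lambda-\partial)^kc_k$; similarly for other substitutions.) A Lie conformal algebra is a $\mathbf k[\partial]$-module $P$ with a $\mathbf k$-bilinear map $[\cdot_\lambda\cdot]:P\times P\to P[\lambda]$ with $[(\partial a)_\lambda b]=-\lambda[a_\lambda b]$, $[a_\lambda(\partial b)]=(\partial+\lambda)[a_\lambda b]$, $[a_\lambda b]=-[b_{-\lambda-\partial}a]$, $[a_\lambda[b_\mu c]]=[[a_\lambda b]_{\lambda+\mu}c]+[b_\mu[a_\lambda c]]$. A Poisson conformal algebra $(P,[\cdot_\lambda\cdot],\cdot_\lambda\cdot)$ is both a Lie conformal algebra and a commutative associative conformal algebra such that $[a_\lambda(b_\mu c)]=[a_\lambda b]_{\lambda+\mu}c+b_\mu[a_\lambda c]$. Conformal maps. A conformal linear map $f:U\to V$ of $\mathbf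 k[\partial]$-modules is a $\mathbf k$-linear map $f_\lambda:U\to V[\lambda]$ with $f_\lambda(\partial u)=(\partial+\lambda)f_\lambda u$. They form a $\mathbf k[\partial]$-module $\mathrm{Chom}(U,V)$ with $(\partial f)_\lambda=-\lambda f_\lambda$; $\mathrm{gc}(V)=\mathrm{Chom}(V,V)$; $U^{\ast c}=\mathrm{Chom}(U,\mathbf k)$ with $\mathbf k$ the trivial module (so $f_\lambda(\partial u)=\lambda f_\lambda u$). For a $\mathbf k[\partial]$-module homomorphism $\varphi:P\to\mathrm{gc}(V)$, define $\varphi^\ast:P\to\mathrm{gc}(V^{\ast c})$ by $(\varphi^\ast(a)_\lambda f)_\mu u=-f_{\mu-\lambda}(\varphi(a)_\lambda u)$. Write $\mathfrak{ad}_P(a)_\lambda b=[a_\lambda b]$, $\mathfrak L_P(a)_\lambda b=a_\lambda b$. For finite free $P$, $(P^{\ast c})^{\ast c}$ is identified with $P$ by letting $a\in P$ act as $a_\lambda(f)=f_{-\lambda}(a)$, so $\mathfrak{ad}_{P^{\ast c}}^\ast,\mathfrak L_{P^{\ast c}}^\ast:P^{\ast c}\to\mathrm{gc}(P)$. Matched pairs. Let $P,Q$ be Poisson conformal algebras and $\rho_P,l_P:P\to\mathrm{gc}(Q)$, $\rho_Q,l_Q:Q\to\mathrm{gc}(P)$ be $\mathbf k[\partial]$-module homomorphisms. $(P,Q,\rho_P,l_P,\rho_Q,l_Q)$ is a matched pair of Poisson conformal algebras if $P\oplus Q$ is a Poisson conformal algebra under $(a+x)_\lambda(b+y)=(a_\lambda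 b+l_Q(x)_\lambda b+l_Q(y)_{-\lambda-\partial}a)+(x_\lambda y+l_P(a)_\lambda y+l_P(b)_{-\lambda-\partial}x)$ and $[(a+x)_\lambda(b+y)]=([a_\lambda b]+\rho_Q(x)_\lambda b-\rho_Q(y)_{-\lambda-\partial}a)+([x_\lambda y]+\rho_P(a)_\lambda y-\rho_P(b)_{-\lambda-\partial}x)$ for $a,b\in P$, $x,y\in Q$. Manin triples. A conformal bilinear form on $V$ is a $\mathbf k$-bilinear map $\langle\cdot,\cdot\rangle_\lambda:V\times V\to\mathbf k[\lambda]$ with $\langle\partial a,b\rangle_\lambda=-\lambda\langle a,b\rangle_\lambda$, $\langle a,\partial b\rangle_\lambda=\lambda\langle a,b\rangle_\lambda$; it is symmetric if $\langle a,b\rangle_\lambda=\langle b,a\rangle_{-\lambda}$, and nondegenerate if $a\mapsto\langle a,\cdot\rangle_\lambda$ is an isomorphism $V\to V^{\ast c}$. On a Poisson conformal algebra it is invariant if $\langle[a_\lambda b],c\rangle_\mu=\langle a,[b_{\mu-\partial}c]\rangle_\lambda$ and $\langle a_\lambda b,c\rangle_\mu=\langle a,b_{\mu-\partial}c\rangle_\lambda$. A Manin triple of Poisson conformal algebras is a triple $(R,P_1,P_2)$ of Poisson conformal algebras with a nondegenerate symmetric invariant conformal bilinear form on $R$ such that $P_1,P_2$ are Poisson conformal subalgebras, $R=P_1\oplus P_2$ as $\mathbf k[\partial]$-modules, and $\langle P_i,P_i\rangle_\lambda=0$ for $i=1,2$. Condition (c) means that $P\oplus P^{\ast c}$ carries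 a Poisson conformal algebra structure extending those of $P$ and $P^{\ast c}$ making it such a triple with the given form. Coalgebras and bialgebras. Put $\partial^{\otimes^2}=\partial\otimes I+I\otimes\partial$, which gives the $\mathbf k[\partial]$-action on $P\otimes P$. For a conformal map $T$ with $T_\nu u=\sum_k\nu^kw_k$, $(T_{-\lambda-\partial^{\otimes^2}}\otimes I)(u\otimes v)=\sum_k(-\lambda-\partial^{\otimes^2})^k(w_k\otimes v)$, and similarly in the second factor. Coproducts $\delta,\Delta:P\to P\otimes P$ are $\mathbf k[\partial]$-module homomorphisms. $(P,\Delta)$ is a cocommutative associative conformal coalgebra if $(I\otimes\Delta)\Delta=(\Delta\otimes I)\Delta$ and $\Delta=\tau\Delta$. $(P,\delta)$ is a Lie conformal coalgebra if $\delta=-\tau\delta$ and $(I\otimes\delta)\delta-(\tau\otimes I)(I\otimes\delta)\delta=(\delta\otimes I)\delta$. $(P,\delta,\Delta)$ is a Poisson conformal coalgebra if both hold and $(I\otimes\Delta)\delta=(\delta\otimes I)\Delta+(\tau\otimes I)(I\otimes\delta)\Delta$. A Poisson conformal bialgebra is a 5-tuple $(P,[\cdot_\lambda\cdot],\cdot_\lambda\cdot,\delta,\Delta)$ such that $(P,[\cdot_\lambda\cdot],\cdot_\lambda\cdot)$ is a Poisson conformal algebra, $(P,\delta,\Delta)$ is a Poisson conformal coalgebra, and for all $a,b\in P$: (i) (Lie conformal bialgebra) $\delta([a_\lambda b])=(\mathfrak{ad}_P(a)_\lambda\otimes I+I\otimes\mathfrak{ad}_P(a)_\lambda)\delta(b)-(\mathfrak{ad}_P(b)_{-\lambda-\partial^{\otimes^2}}\otimes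 I+I\otimes\mathfrak{ad}_P(b)_{-\lambda-\partial^{\otimes^2}})\delta(a)$; (ii) (commutative and cocommutative antisymmetric infinitesimal conformal bialgebra) $\Delta(a_\lambda b)=(I\otimes\mathfrak L_P(a)_\lambda)\Delta(b)+(\mathfrak L_P(b)_{-\lambda-\partial^{\otimes^2}}\otimes I)\Delta(a)$; (iii) $\delta(a_\lambda b)=(\mathfrak L_P(a)_\lambda\otimes I)\delta(b)+(\mathfrak L_P(b)_{-\lambda-\partial^{\otimes^2}}\otimes I)\delta(a)+(I\otimes\mathfrak{ad}_P(a)_\lambda)\Delta(b)+(I\otimes\mathfrak{ad}_P(b)_{-\lambda-\partial^{\otimes^2}})\Delta(a)$; (iv) $\Delta([a_\lambda b])=(\mathfrak{ad}_P(a)_\lambda\otimes I+I\otimes\mathfrak{ad}_P(a)_\lambda)\Delta(b)-(I\otimes\mathfrak L_P(b)_{-\lambda-\partial^{\otimes^2}})\delta(a)+(\mathfrak L_P(b)_{-\lambda-\partial^{\otimes^2}}\otimes I)\delta(a)$. *)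

theory Defs
  imports
    "HOL-Computational_Algebra.Polynomial"
    "HOL-Library.Function_Algebras"
    "HOL-Library.Product_Plus"
begin

section \<open>Modules over \<open>k[\<partial>]\<close>\<close>

text \<open>
  A \<open>k[\<partial>]\<close>-module is a submodule \<open>V\<close> (a carrier set, needed for conformal duals) of a
  \<^const>\<open>module\<close> over the ring \<open>'k poly\<close>; the polynomial variable acts as \<open>\<partial>\<close>, and the
  constant polynomials give the \<open>k\<close>-vector space structure.
\<close>

definition kscale :: "('k::field_char_0 poly \<Rightarrow> 'v \<Rightarrow> 'v) \<Rightarrow> 'k \<Rightarrow> 'v \<Rightarrow> 'v" where
  "kscale s c v = s [:c:] v"

definition der :: "('k::field_char_0 poly \<Rightarrow> 'v \<Rightarrow> 'v) \<Rightarrow> 'v \<Rightarrow> 'v" where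
  "der s v = s [:0, 1:] v"

definition fg_module :: "('k::field_char_0 poly \<Rightarrow> 'v::ab_group_add \<Rightarrow> 'v) \<Rightarrow> 'v set \<Rightarrow> bool" where
  "fg_module s V \<longleftrightarrow> module s \<and> module.subspace s V \<and> (\<exists>S. finite S \<and> module.span s S = V)"

definition free_module :: "('k::field_char_0 poly \<Rightarrow> 'v::ab_group_add \<Rightarrow> 'v) \<Rightarrow> 'v set \<Rightarrow> bool" where
  "free_module s V \<longleftrightarrow> (\<exists>B. \<not> module.dependent s B \<and> module.span s B = V)"

definition prod_scale ::
  "('k::field_char_0 poly \<Rightarrow> 'v \<Rightarrow> 'v) \<Rightarrow> ('k poly \<Rightarrow> 'w \<Rightarrow> 'w) \<Rightarrow> 'k poly \<Rightarrow> 'v \<times> 'w \<Rightarrow> 'v \<times> 'w" where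
  "prod_scale s t r = map_prod (s r) (t r)"

text \<open>The ground field as a module on which \<open>\<partial>\<close> acts by zero.\<close>

definition triv_scale :: "'k::field_char_0 poly \<Rightarrow> 'k \<Rightarrow> 'k" where
  "triv_scale r c = poly r 0 * c"


section \<open>Polynomials with coefficients in a module\<close>

text \<open>
  \<open>V[\<lambda>]\<close> is \<open>'v poly\<close>; multiplication by \<open>\<lambda>\<close> is \<open>pCons 0\<close>, and \<open>\<partial>\<close> acts on coefficients
  by \<open>map_poly (der s)\<close>. \<open>V[\<lambda>,\<mu>]\<close> is \<open>'v poly poly\<close>, where the outer variable is \<open>\<lambda>\<close> and
  the inner one \<open>\<mu>\<close>. For \<open>p = \<Sum>k. \<nu>^k c\<^sub>k\<close>, the term \<open>subst T e p\<close> is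
  \<open>\<Sum>k. T^k (e c\<^sub>k)\<close>: it replaces \<open>\<nu>\<close> by the operator \<open>T\<close> after applying \<open>e\<close> to
  the coefficients.
\<close>

definition subst :: "('w \<Rightarrow> 'w) \<Rightarrow> ('v::zero \<Rightarrow> 'w::comm_monoid_add) \<Rightarrow> 'v poly \<Rightarrow> 'w" where
  "subst T e p = (\<Sum>k\<le>degree p. (T ^^ k) (e (coeff p k)))"

definition lam :: "'v::zero poly poly \<Rightarrow> 'v poly poly" where
  "lam = pCons 0"

definition mu :: "'v::zero poly poly \<Rightarrow> 'v poly poly" where
  "mu = map_poly (pCons 0)"

definition const2 :: "'v::zero \<Rightarrow> 'v poly poly" where
  "const2 v = [:[:v:]:]"

text \<open>\<open>p(-\<lambda>-\<partial>)\<close> for \<open>p \<in> V[\<nu>]\<close>, with \<open>\<partial>\<close> acting as \<open>D\<close>, after applying \<open>e\<close> to the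
  coefficients.\<close>

definition flip_by :: "('w \<Rightarrow> 'w) \<Rightarrow> ('v::zero \<Rightarrow> 'w::ab_group_add) \<Rightarrow> 'v poly \<Rightarrow> 'w poly" where
  "flip_by D e p = subst (\<lambda>q. - pCons 0 q - map_poly D q) (\<lambda>v. [:e v:]) p"

definition flip :: "('k::field_char_0 poly \<Rightarrow> 'v \<Rightarrow> 'v) \<Rightarrow> 'v::ab_group_add poly \<Rightarrow> 'v poly" where
  "flip s p = flip_by (der s) (\<lambda>v. v) p"

definition neg_var :: "'k::field_char_0 poly \<Rightarrow> 'k poly" where
  "neg_var p = pcompose p [:0, -1:]"


section \<open>Conformal linear maps\<close>

definition conformal_map ::
  "('k::field_char_0 poly \<Rightarrow> 'u::ab_group_add \<Rightarrow> 'u) \<Rightarrow> 'u set \<Rightarrow>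
   ('k poly \<Rightarrow> 'v::ab_group_add \<Rightarrow> 'v) \<Rightarrow> 'v set \<Rightarrow> ('u \<Rightarrow> 'v poly) \<Rightarrow> bool" where
  "conformal_map s U t V f \<longleftrightarrow>
     (\<forall>u\<in>U. \<forall>n. coeff (f u) n \<in> V) \<and>
     (\<forall>u\<in>U. \<forall>u'\<in>U. f (u + u') = f u + f u') \<and>
     (\<forall>c. \<forall>u\<in>U. f (kscale s c u) = map_poly (kscale t c) (f u)) \<and>
     (\<forall>u\<in>U. f (der s u) = map_poly (der t) (f u) + pCons 0 (f u))"

text \<open>
  \<open>k[\<partial>]\<close>-module homomorphisms \<open>\<rho> : P \<rightarrow> gc(Q)\<close>, written as \<open>\<rho> a x = \<rho>(a)\<^sub>\<lambda> x\<close>; here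
  \<open>(\<partial>f)\<^sub>\<lambda> = -\<lambda> f\<^sub>\<lambda>\<close> in \<open>gc(Q)\<close>, and two elements of \<open>gc(Q)\<close> are equal iff they agree on \<open>Q\<close>.
\<close>

definition gc_hom ::
  "('k::field_char_0 poly \<Rightarrow> 'p::ab_group_add \<Rightarrow> 'p) \<Rightarrow> 'p set \<Rightarrow>
   ('k poly \<Rightarrow> 'q::ab_group_add \<Rightarrow> 'q) \<Rightarrow> 'q set \<Rightarrow> ('p \<Rightarrow> 'q \<Rightarrow> 'q poly) \<Rightarrow> bool" where
  "gc_hom s P t Q \<rho> \<longleftrightarrow>
     (\<forall>a\<in>P. conformal_map t Q t Q (\<rho> a)) \<and>
     (\<forall>a\<in>P. \<forall>b\<in>P. \<forall>x\<in>Q. \<rho> (a + b) x = \<rho> a x + \<rho> b x) \<and>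
     (\<forall>c. \<forall>a\<in>P. \<forall>x\<in>Q. \<rho> (kscale s c a) x = map_poly (kscale t c) (\<rho> a x)) \<and>
     (\<forall>a\<in>P. \<forall>x\<in>Q. \<rho> (der s a) x = - pCons 0 (\<rho> a x))"

text \<open>
  The conformal dual \<open>Chom(V, k)\<close>. Maps are set to zero outside the carrier, so that equality
  of functions is equality of conformal maps on \<open>V\<close>. In \<open>dual_scale\<close>, \<open>\<partial>\<close> acts as \<open>-\<lambda>\<close>.
\<close>

definition conf_dual ::
  "('k::field_char_0 poly \<Rightarrow> 'v::ab_group_add \<Rightarrow> 'v) \<Rightarrow> 'v set \<Rightarrow> ('v \<Rightarrow> 'k poly) set" where
  "conf_dual s V = {f. conformal_map s V triv_scale UNIV f \<and> (\<forall>v. v \<notin> V \<longrightarrow> f v = 0)}"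

definition dual_scale :: "'k::field_char_0 poly \<Rightarrow> ('v \<Rightarrow> 'k poly) \<Rightarrow> ('v \<Rightarrow> 'k poly)" where
  "dual_scale r f = (\<lambda>v. neg_var r * f v)"

text \<open>
  The element of \<open>(Chom(V, k))[\<lambda>]\<close> whose value at \<open>v \<in> V\<close> is the polynomial
  \<open>F v \<in> k[\<lambda>,\<mu>]\<close>. The \<open>\<lambda>\<close>-degrees of the \<open>F v\<close> are bounded in every use below,
  since \<open>V\<close> is finitely generated and \<open>F (\<partial>v) = \<mu> F v\<close>.
\<close>

definition dual_poly :: "'v set \<Rightarrow> ('v \<Rightarrow> 'k::field_char_0 poly poly) \<Rightarrow> ('v \<Rightarrow> 'k poly) poly" where
  "dual_poly V F = Abs_poly (\<lambda>n v. if v \<in> V then coeff (F v) n else 0)"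

text \<open>\<open>(\<phi>\<^sup>*(a)\<^sub>\<lambda> f)\<^sub>\<mu> v = - f\<^bsub>\<mu>-\<lambda>\<^esub>(\<phi>(a)\<^sub>\<lambda> v)\<close>\<close>

definition dual_rep ::
  "'v set \<Rightarrow> ('p \<Rightarrow> 'v::ab_group_add \<Rightarrow> 'v poly) \<Rightarrow>
   'p \<Rightarrow> ('v \<Rightarrow> 'k::field_char_0 poly) \<Rightarrow> ('v \<Rightarrow> 'k poly) poly" where
  "dual_rep V \<phi> a f = dual_poly V
     (\<lambda>v. - subst lam (\<lambda>w. subst (\<lambda>q. mu q - lam q) const2 (f w)) (\<phi> a v))"

text \<open>
  The identification \<open>a\<^sub>\<lambda>(f) = f\<^bsub>-\<lambda>\<^esub>(a)\<close> of \<open>V\<close> with its double conformal dual, and the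
  transport along it of maps into \<open>gc\<close> of the double dual.
\<close>

definition bidual ::
  "('k::field_char_0 poly \<Rightarrow> 'v::ab_group_add \<Rightarrow> 'v) \<Rightarrow> 'v set \<Rightarrow> 'v \<Rightarrow> ('v \<Rightarrow> 'k poly) \<Rightarrow> 'k poly" where
  "bidual s V a = (\<lambda>f. if f \<in> conf_dual s V then neg_var (f a) else 0)"

definition codual_rep ::
  "('k::field_char_0 poly \<Rightarrow> 'v::ab_group_add \<Rightarrow> 'v) \<Rightarrow> 'v set \<Rightarrow>
   ('q \<Rightarrow> ('v \<Rightarrow> 'k poly) \<Rightarrow> ('v \<Rightarrow> 'k poly) poly) \<Rightarrow> 'q \<Rightarrow> 'v \<Rightarrow> 'v poly" where
  "codual_rep s V \<phi> x a =
     map_poly (inv_into V (bidual s V)) (dual_rep (conf_dual s V) \<phi> x (bidual s V a))"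


section \<open>Poisson conformal algebras\<close>

text \<open>\<open>nest_right m m' x y a b c\<close> is \<open>a\<^sub>x(b\<^sub>y c)\<close> with outer product \<open>m\<close> and inner product \<open>m'\<close>;
  \<open>nest_left m m' a b c\<close> is \<open>(a\<^sub>\<lambda> b)\<^bsub>\<lambda>+\<mu>\<^esub> c\<close> with outer product \<open>m\<close> and inner product \<open>m'\<close>.\<close>

definition nest_right ::
  "('v::ab_group_add \<Rightarrow> 'v \<Rightarrow> 'v poly) \<Rightarrow> ('v \<Rightarrow> 'v \<Rightarrow> 'v poly) \<Rightarrow>
   ('v poly poly \<Rightarrow> 'v poly poly) \<Rightarrow> ('v poly poly \<Rightarrow> 'v poly poly) \<Rightarrow>
   'v \<Rightarrow> 'v \<Rightarrow> 'v \<Rightarrow> 'v poly poly" where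
  "nest_right m m' x y a b c = subst y (\<lambda>v. subst x const2 (m a v)) (m' b c)"

definition nest_left ::
  "('v::ab_group_add \<Rightarrow> 'v \<Rightarrow> 'v poly) \<Rightarrow> ('v \<Rightarrow> 'v \<Rightarrow> 'v poly) \<Rightarrow>
   'v \<Rightarrow> 'v \<Rightarrow> 'v \<Rightarrow> 'v poly poly" where
  "nest_left m m' a b c =
     subst lam (\<lambda>v. subst (\<lambda>q. lam q + mu q) const2 (m v c)) (m' a b)"

text \<open>In the next two definitions, \<open>gc_hom s V s V m\<close> says literally that \<open>m\<close> is a
  \<open>k\<close>-bilinear map \<open>V \<times> V \<rightarrow> V[\<lambda>]\<close> with \<open>(\<partial>a)\<^sub>\<lambda> b = -\<lambda> a\<^sub>\<lambda> b\<close> and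
  \<open>a\<^sub>\<lambda>(\<partial>b) = (\<partial>+\<lambda>) a\<^sub>\<lambda> b\<close>.\<close>

definition comm_assoc_conformal ::
  "('k::field_char_0 poly \<Rightarrow> 'v::ab_group_add \<Rightarrow> 'v) \<Rightarrow> 'v set \<Rightarrow> ('v \<Rightarrow> 'v \<Rightarrow> 'v poly) \<Rightarrow> bool" where
  "comm_assoc_conformal s V m \<longleftrightarrow>
     fg_module s V \<and> gc_hom s V s V m \<and>
     (\<forall>a\<in>V. \<forall>b\<in>V. \<forall>c\<in>V. nest_left m m a b c = nest_right m m lam mu a b c) \<and>
     (\<forall>a\<in>V. \<forall>b\<in>V. m a b = flip s (m b a))"

definition lie_conformal ::
  "('k::field_char_0 poly \<Rightarrow> 'v::ab_group_add \<Rightarrow> 'v) \<Rightarrow> 'v set \<Rightarrow> ('v \<Rightarrow> 'v \<Rightarrow> 'v poly) \<Rightarrow> bool" where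
  "lie_conformal s V br \<longleftrightarrow>
     fg_module s V \<and> gc_hom s V s V br \<and>
     (\<forall>a\<in>V. \<forall>b\<in>V. br a b = - flip s (br b a)) \<and>
     (\<forall>a\<in>V. \<forall>b\<in>V. \<forall>c\<in>V. nest_right br br lam mu a b c =
        nest_left br br a b c + nest_right br br mu lam b a c)"

definition poisson_conformal ::
  "('k::field_char_0 poly \<Rightarrow> 'v::ab_group_add \<Rightarrow> 'v) \<Rightarrow> 'v set \<Rightarrow>
   ('v \<Rightarrow> 'v \<Rightarrow> 'v poly) \<Rightarrow> ('v \<Rightarrow> 'v \<Rightarrow> 'v poly) \<Rightarrow> bool" where
  "poisson_conformal s V br m \<longleftrightarrow>
     lie_conformal s V br \<and> comm_assoc_conformal s V m \<and>
     (\<forall>a\<in>V. \<forall>b\<in>V. \<forall>c\<in>V. nest_right br m lam mu a b c =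
        nest_left m br a b c + nest_right m br mu lam b a c)"


section \<open>Matched pairs\<close>

definition pair_poly :: "'p::zero poly \<Rightarrow> 'q::zero poly \<Rightarrow> ('p \<times> 'q) poly" where
  "pair_poly p q = Abs_poly (\<lambda>n. (coeff p n, coeff q n))"

definition matched_mult ::
  "('k::field_char_0 poly \<Rightarrow> 'p::ab_group_add \<Rightarrow> 'p) \<Rightarrow> ('p \<Rightarrow> 'p \<Rightarrow> 'p poly) \<Rightarrow>
   ('k poly \<Rightarrow> 'q::ab_group_add \<Rightarrow> 'q) \<Rightarrow> ('q \<Rightarrow> 'q \<Rightarrow> 'q poly) \<Rightarrow>
   ('p \<Rightarrow> 'q \<Rightarrow> 'q poly) \<Rightarrow> ('q \<Rightarrow> 'p \<Rightarrow> 'p poly) \<Rightarrow>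
   'p \<times> 'q \<Rightarrow> 'p \<times> 'q \<Rightarrow> ('p \<times> 'q) poly" where
  "matched_mult s mP t mQ lP lQ = (\<lambda>(a, x) (b, y). pair_poly
     (mP a b + lQ x b + flip s (lQ y a))
     (mQ x y + lP a y + flip t (lP b x)))"

definition matched_bracket ::
  "('k::field_char_0 poly \<Rightarrow> 'p::ab_group_add \<Rightarrow> 'p) \<Rightarrow> ('p \<Rightarrow> 'p \<Rightarrow> 'p poly) \<Rightarrow>
   ('k poly \<Rightarrow> 'q::ab_group_add \<Rightarrow> 'q) \<Rightarrow> ('q \<Rightarrow> 'q \<Rightarrow> 'q poly) \<Rightarrow>
   ('p \<Rightarrow> 'q \<Rightarrow> 'q poly) \<Rightarrow> ('q \<Rightarrow> 'p \<Rightarrow> 'p poly) \<Rightarrow>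
   'p \<times> 'q \<Rightarrow> 'p \<times> 'q \<Rightarrow> ('p \<times> 'q) poly" where
  "matched_bracket s brP t brQ \<rho>P \<rho>Q = (\<lambda>(a, x) (b, y). pair_poly
     (brP a b + \<rho>Q x b - flip s (\<rho>Q y a))
     (brQ x y + \<rho>P a y - flip t (\<rho>P b x)))"

definition matched_pair ::
  "('k::field_char_0 poly \<Rightarrow> 'p::ab_group_add \<Rightarrow> 'p) \<Rightarrow> 'p set \<Rightarrow>
   ('p \<Rightarrow> 'p \<Rightarrow> 'p poly) \<Rightarrow> ('p \<Rightarrow> 'p \<Rightarrow> 'p poly) \<Rightarrow>
   ('k poly \<Rightarrow> 'q::ab_group_add \<Rightarrow> 'q) \<Rightarrow> 'q set \<Rightarrow>
   ('q \<Rightarrow> 'q \<Rightarrow> 'q poly) \<Rightarrow> ('q \<Rightarrow> 'q \<Rightarrow> 'q poly) \<Rightarrow>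
   ('p \<Rightarrow> 'q \<Rightarrow> 'q poly) \<Rightarrow> ('p \<Rightarrow> 'q \<Rightarrow> 'q poly) \<Rightarrow>
   ('q \<Rightarrow> 'p \<Rightarrow> 'p poly) \<Rightarrow> ('q \<Rightarrow> 'p \<Rightarrow> 'p poly) \<Rightarrow> bool" where
  "matched_pair s P brP mP t Q brQ mQ \<rho>P lP \<rho>Q lQ \<longleftrightarrow>
     poisson_conformal s P brP mP \<and> poisson_conformal t Q brQ mQ \<and>
     gc_hom s P t Q \<rho>P \<and> gc_hom s P t Q lP \<and> gc_hom t Q s P \<rho>Q \<and> gc_hom t Q s P lQ \<and>
     poisson_conformal (prod_scale s t) (P \<times> Q)
       (matched_bracket s brP t brQ \<rho>P \<rho>Q) (matched_mult s mP t mQ lP lQ)"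


section \<open>Manin triples\<close>

definition conformal_form ::
  "('k::field_char_0 poly \<Rightarrow> 'v::ab_group_add \<Rightarrow> 'v) \<Rightarrow> 'v set \<Rightarrow> ('v \<Rightarrow> 'v \<Rightarrow> 'k poly) \<Rightarrow> bool" where
  "conformal_form s V B \<longleftrightarrow>
     (\<forall>a\<in>V. \<forall>b\<in>V. \<forall>c\<in>V. B (a + b) c = B a c + B b c \<and> B a (b + c) = B a b + B a c) \<and>
     (\<forall>r. \<forall>a\<in>V. \<forall>b\<in>V. B (kscale s r a) b = smult r (B a b) \<and> B a (kscale s r b) = smult r (B a b)) \<and>
     (\<forall>a\<in>V. \<forall>b\<in>V. B (der s a) b = - pCons 0 (B a b) \<and> B a (der s b) = pCons 0 (B a b))"

definition symmetric_form :: "'v set \<Rightarrow> ('v \<Rightarrow> 'v \<Rightarrow> 'k::field_char_0 poly) \<Rightarrow> bool" where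
  "symmetric_form V B \<longleftrightarrow> (\<forall>a\<in>V. \<forall>b\<in>V. B a b = neg_var (B b a))"

text \<open>For a conformal form the map below is a \<open>k[\<partial>]\<close>-homomorphism into the conformal dual,
  so that bijectivity means that it is an isomorphism.\<close>

definition nondegenerate_form ::
  "('k::field_char_0 poly \<Rightarrow> 'v::ab_group_add \<Rightarrow> 'v) \<Rightarrow> 'v set \<Rightarrow> ('v \<Rightarrow> 'v \<Rightarrow> 'k poly) \<Rightarrow> bool" where
  "nondegenerate_form s V B \<longleftrightarrow>
     bij_betw (\<lambda>a b. if b \<in> V then B a b else 0) V (conf_dual s V)"

text \<open>\<open>\<langle>a\<^sub>\<lambda> b, c\<rangle>\<^sub>\<mu> = \<langle>a, b\<^bsub>\<mu>-\<partial>\<^esub> c\<rangle>\<^sub>\<lambda>\<close>\<close>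

definition invariant_form ::
  "('k::field_char_0 poly \<Rightarrow> 'v::ab_group_add \<Rightarrow> 'v) \<Rightarrow> 'v set \<Rightarrow> ('v \<Rightarrow> 'v \<Rightarrow> 'v poly) \<Rightarrow>
   ('v \<Rightarrow> 'v \<Rightarrow> 'k poly) \<Rightarrow> bool" where
  "invariant_form s V m B \<longleftrightarrow>
     (\<forall>a\<in>V. \<forall>b\<in>V. \<forall>c\<in>V.
        subst lam (\<lambda>v. subst mu const2 (B v c)) (m a b) =
        subst mu (\<lambda>v. subst lam const2 (B a v))
          (subst (\<lambda>q. pCons 0 q - map_poly (der s) q) (\<lambda>v. [:v:]) (m b c)))"

definition manin_triple ::
  "('k::field_char_0 poly \<Rightarrow> 'v::ab_group_add \<Rightarrow> 'v) \<Rightarrow> 'v set \<Rightarrow>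
   ('v \<Rightarrow> 'v \<Rightarrow> 'v poly) \<Rightarrow> ('v \<Rightarrow> 'v \<Rightarrow> 'v poly) \<Rightarrow> ('v \<Rightarrow> 'v \<Rightarrow> 'k poly) \<Rightarrow>
   'v set \<Rightarrow> 'v set \<Rightarrow> bool" where
  "manin_triple s R br m B P1 P2 \<longleftrightarrow>
     poisson_conformal s R br m \<and>
     conformal_form s R B \<and> nondegenerate_form s R B \<and> symmetric_form R B \<and>
     invariant_form s R br B \<and> invariant_form s R m B \<and>
     P1 \<subseteq> R \<and> poisson_conformal s P1 br m \<and>
     P2 \<subseteq> R \<and> poisson_conformal s P2 br m \<and>
     R = {x + y |x y. x \<in> P1 \<and> y \<in> P2} \<and> P1 \<inter> P2 = {0} \<and>
     (\<forall>a\<in>P1. \<forall>b\<in>P1. B a b = 0) \<and> (\<forall>a\<in>P2. \<forall>b\<in>P2. B a b = 0)"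


section \<open>Tensor products over \<open>k\<close>\<close>

text \<open>
  \<open>U \<otimes> V\<close> is realised inside the algebraic dual of the space of bilinear forms on \<open>U \<times> V\<close>:
  \<open>u \<otimes> v\<close> is evaluation at \<open>(u, v)\<close>, and \<open>U \<otimes> V\<close> is the span of these evaluations.
  Over a field this is the usual tensor product: its universal property, for maps into an
  arbitrary vector space, is the lemma \<open>tensor_universal\<close>. In the functional \<open>tensor u v\<close>,
  arguments that are not bilinear forms are sent to zero.
\<close>

type_synonym ('u, 'v, 'k) tensor = "('u \<Rightarrow> 'v \<Rightarrow> 'k) \<Rightarrow> 'k"

definition bilinear_on ::
  "('k::field \<Rightarrow> 'u::ab_group_add \<Rightarrow> 'u) \<Rightarrow> 'u set \<Rightarrow> ('k \<Rightarrow> 'v::ab_group_add \<Rightarrow> 'v) \<Rightarrow> 'v set \<Rightarrow>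
   ('k \<Rightarrow> 'w::ab_group_add \<Rightarrow> 'w) \<Rightarrow> ('u \<Rightarrow> 'v \<Rightarrow> 'w) \<Rightarrow> bool" where
  "bilinear_on sU U sV V sW f \<longleftrightarrow>
     (\<forall>u\<in>U. \<forall>u'\<in>U. \<forall>v\<in>V. f (u + u') v = f u v + f u' v) \<and>
     (\<forall>u\<in>U. \<forall>v\<in>V. \<forall>v'\<in>V. f u (v + v') = f u v + f u v') \<and>
     (\<forall>c. \<forall>u\<in>U. \<forall>v\<in>V. f (sU c u) v = sW c (f u v) \<and> f u (sV c v) = sW c (f u v))"

definition tensor ::
  "('k::field \<Rightarrow> 'u::ab_group_add \<Rightarrow> 'u) \<Rightarrow> 'u set \<Rightarrow> ('k \<Rightarrow> 'v::ab_group_add \<Rightarrow> 'v) \<Rightarrow> 'v set \<Rightarrow>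
   'u \<Rightarrow> 'v \<Rightarrow> ('u, 'v, 'k) tensor" where
  "tensor sU U sV V u v = (\<lambda>B. if bilinear_on sU U sV V (*) B then B u v else 0)"

definition tensor_scale :: "'k::field \<Rightarrow> ('u, 'v, 'k) tensor \<Rightarrow> ('u, 'v, 'k) tensor" where
  "tensor_scale c t = (\<lambda>B. c * t B)"

definition tensor_space ::
  "('k::field \<Rightarrow> 'u::ab_group_add \<Rightarrow> 'u) \<Rightarrow> 'u set \<Rightarrow> ('k \<Rightarrow> 'v::ab_group_add \<Rightarrow> 'v) \<Rightarrow> 'v set \<Rightarrow>
   ('u, 'v, 'k) tensor set" where
  "tensor_space sU U sV V =
     module.span tensor_scale {tensor sU U sV V u v |u v. u \<in> U \<and> v \<in> V}"

text \<open>The linear extension of a bilinear map \<open>f\<close>: the value \<open>\<Sum>i. f u\<^sub>i v\<^sub>i\<close> for any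
  expression \<open>t = \<Sum>i. u\<^sub>i \<otimes> v\<^sub>i\<close>.\<close>

definition tensor_lift ::
  "('k::field \<Rightarrow> 'u::ab_group_add \<Rightarrow> 'u) \<Rightarrow> 'u set \<Rightarrow> ('k \<Rightarrow> 'v::ab_group_add \<Rightarrow> 'v) \<Rightarrow> 'v set \<Rightarrow>
   ('u \<Rightarrow> 'v \<Rightarrow> 'w::ab_group_add) \<Rightarrow> ('u, 'v, 'k) tensor \<Rightarrow> 'w" where
  "tensor_lift sU U sV V f t = (THE w. \<exists>xs. set xs \<subseteq> U \<times> V \<and>
     t = (\<Sum>(u, v)\<leftarrow>xs. tensor sU U sV V u v) \<and> w = (\<Sum>(u, v)\<leftarrow>xs. f u v))"

lemma sum_list_fun_apply: "sum_list ts B = (\<Sum>t\<leftarrow>ts. t B)"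
  for ts :: "('a \<Rightarrow> 'b::comm_monoid_add) list"
  by (induction ts) auto

lemma tensor_sums_unique:
  fixes sU :: "'k::field \<Rightarrow> 'u::ab_group_add \<Rightarrow> 'u" and sV :: "'k \<Rightarrow> 'v::ab_group_add \<Rightarrow> 'v"
    and sW :: "'k \<Rightarrow> 'w::ab_group_add \<Rightarrow> 'w"
  assumes W: "vector_space sW" and f: "bilinear_on sU U sV V sW f"
    and xs: "set xs \<subseteq> U \<times> V" and ys: "set ys \<subseteq> U \<times> V"
    and eq: "(\<Sum>(u, v)\<leftarrow>xs. tensor sU U sV V u v) = (\<Sum>(u, v)\<leftarrow>ys. tensor sU U sV V u v)"
  shows "(\<Sum>(u, v)\<leftarrow>xs. f u v) = (\<Sum>(u, v)\<leftarrow>ys. f u v)"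
proof (rule ccontr)
  assume neq: "\<not> ?thesis"
  define w where "w = (\<Sum>(u, v)\<leftarrow>xs. f u v) - (\<Sum>(u, v)\<leftarrow>ys. f u v)"
  have w: "w \<noteq> 0" using neq by (simp add: w_def)
  interpret W: vector_space sW by (rule W)
  interpret K: vector_space "(*) :: 'k \<Rightarrow> 'k \<Rightarrow> 'k" by unfold_locales (auto simp: algebra_simps)
  interpret WK: vector_space_pair sW "(*) :: 'k \<Rightarrow> 'k \<Rightarrow> 'k" ..
  have "W.independent {w}" using w by (simp add: W.dependent_single)
  then obtain g where g: "Vector_Spaces.linear sW (*) g" "g w = 1"
    using WK.linear_independent_extend[of "{w}" "\<lambda>_. 1"] by auto
  interpret g: Vector_Spaces.linear sW "(*)" g by (rule g(1))
  define B where "B = (\<lambda>u v. g (f u v))"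
  have B: "bilinear_on sU U sV V (*) B"
    using f by (simp add: bilinear_on_def B_def g.add g.scale)
  have sums: "(\<Sum>(u, v)\<leftarrow>zs. tensor sU U sV V u v) B = g (\<Sum>(u, v)\<leftarrow>zs. f u v)" for zs
    using B by (induction zs) (auto simp: tensor_def B_def g.add)
  have "g w = 0"
    unfolding w_def g.diff using sums[of xs] sums[of ys] eq by simp
  then show False using g(2) by simp
qed

lemma tensor_lift_sum_list:
  assumes "vector_space sW" "bilinear_on sU U sV V sW f" "set xs \<subseteq> U \<times> V"
  shows "tensor_lift sU U sV V f (\<Sum>(u, v)\<leftarrow>xs. tensor sU U sV V u v) = (\<Sum>(u, v)\<leftarrow>xs. f u v)"
  unfolding tensor_lift_def
proof (rule the_equality)
  show "\<exists>ys. set ys \<subseteq> U \<times> V \<and>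
      (\<Sum>(u, v)\<leftarrow>xs. tensor sU U sV V u v) = (\<Sum>(u, v)\<leftarrow>ys. tensor sU U sV V u v) \<and>
      (\<Sum>(u, v)\<leftarrow>xs. f u v) = (\<Sum>(u, v)\<leftarrow>ys. f u v)"
    by (rule exI[of _ xs]) (use assms(3) in simp)
next
  fix w
  assume "\<exists>ys. set ys \<subseteq> U \<times> V \<and>
      (\<Sum>(u, v)\<leftarrow>xs. tensor sU U sV V u v) = (\<Sum>(u, v)\<leftarrow>ys. tensor sU U sV V u v) \<and>
      w = (\<Sum>(u, v)\<leftarrow>ys. f u v)"
  then obtain ys where ys: "set ys \<subseteq> U \<times> V"
    "(\<Sum>(u, v)\<leftarrow>xs. tensor sU U sV V u v) = (\<Sum>(u, v)\<leftarrow>ys. tensor sU U sV V u v)"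
    "w = (\<Sum>(u, v)\<leftarrow>ys. f u v)" by (elim exE conjE)
  show "w = (\<Sum>(u, v)\<leftarrow>xs. f u v)"
    unfolding ys(3) by (rule tensor_sums_unique[OF assms(1,2) assms(3) ys(1,2), symmetric])
qed

lemma tensor_space_sums:
  fixes sU :: "'k::field \<Rightarrow> 'u::ab_group_add \<Rightarrow> 'u" and sV :: "'k \<Rightarrow> 'v::ab_group_add \<Rightarrow> 'v"
  assumes U: "\<And>c u. u \<in> U \<Longrightarrow> sU c u \<in> U"
    and t: "t \<in> tensor_space sU U sV V"
  obtains xs where "set xs \<subseteq> U \<times> V" "t = (\<Sum>(u, v)\<leftarrow>xs. tensor sU U sV V u v)"
proof -
  interpret T: module "tensor_scale :: 'k \<Rightarrow> ('u, 'v, 'k) tensor \<Rightarrow> _"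
    by unfold_locales (auto simp: tensor_scale_def fun_eq_iff algebra_simps)
  have "\<exists>xs. set xs \<subseteq> U \<times> V \<and> t = (\<Sum>(u, v)\<leftarrow>xs. tensor sU U sV V u v)"
    using t unfolding tensor_space_def
  proof (induction rule: T.span_induct_alt)
    case base
    show ?case by (rule exI[of _ "[]"]) simp
  next
    case (step c x y)
    then obtain u v xs where "x = tensor sU U sV V u v" "u \<in> U" "v \<in> V"
      "set xs \<subseteq> U \<times> V" "y = (\<Sum>(u, v)\<leftarrow>xs. tensor sU U sV V u v)" by blast
    moreover from this have "tensor_scale c x = tensor sU U sV V (sU c u) v"
      by (auto simp: tensor_scale_def tensor_def bilinear_on_def fun_eq_iff)
    ultimately show ?case using U by (intro exI[of _ "(sU c u, v) # xs"]) auto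
  qed
  then show ?thesis using that by blast
qed

lemma tensor_universal:
  fixes sU :: "'k::field \<Rightarrow> 'u::ab_group_add \<Rightarrow> 'u" and sV :: "'k \<Rightarrow> 'v::ab_group_add \<Rightarrow> 'v"
    and sW :: "'k \<Rightarrow> 'w::ab_group_add \<Rightarrow> 'w"
  assumes W: "vector_space sW" and f: "bilinear_on sU U sV V sW f"
    and U: "\<And>c u. u \<in> U \<Longrightarrow> sU c u \<in> U"
  defines "T \<equiv> tensor_space sU U sV V" and "F \<equiv> tensor_lift sU U sV V f"
  shows "bilinear_on sU U sV V tensor_scale (tensor sU U sV V)"
    and "u \<in> U \<Longrightarrow> v \<in> V \<Longrightarrow> tensor sU U sV V u v \<in> T"
    and "u \<in> U \<Longrightarrow> v \<in> V \<Longrightarrow> F (tensor sU U sV V u v) = f u v"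
    and "t \<in> T \<Longrightarrow> t' \<in> T \<Longrightarrow> F (t + t') = F t + F t'"
    and "t \<in> T \<Longrightarrow> F (tensor_scale c t) = sW c (F t)"
proof -
  interpret T: module "tensor_scale :: 'k \<Rightarrow> ('u, 'v, 'k) tensor \<Rightarrow> _"
    by unfold_locales (auto simp: tensor_scale_def fun_eq_iff algebra_simps)
  interpret W: vector_space sW by (rule W)
  note lift = tensor_lift_sum_list[OF W f, folded F_def]
  show "bilinear_on sU U sV V tensor_scale (tensor sU U sV V)"
    unfolding bilinear_on_def tensor_scale_def tensor_def fun_eq_iff by simp
  show "tensor sU U sV V u v \<in> T" if "u \<in> U" "v \<in> V"
    unfolding T_def tensor_space_def by (rule T.span_base) (use that in blast)
  show "F (tensor sU U sV V u v) = f u v" if "u \<in> U" "v \<in> V"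
    using lift[of "[(u, v)]"] that by simp
  show "F (t + t') = F t + F t'" if tT: "t \<in> T" "t' \<in> T"
  proof -
    obtain xs where "set xs \<subseteq> U \<times> V" "t = (\<Sum>(u, v)\<leftarrow>xs. tensor sU U sV V u v)"
      by (rule tensor_space_sums[OF U tT(1)[unfolded T_def]])
    moreover obtain ys where "set ys \<subseteq> U \<times> V" "t' = (\<Sum>(u, v)\<leftarrow>ys. tensor sU U sV V u v)"
      by (rule tensor_space_sums[OF U tT(2)[unfolded T_def]])
    ultimately show ?thesis using lift[of xs] lift[of ys] lift[of "xs @ ys"] by simp
  qed
  show "F (tensor_scale c t) = sW c (F t)" if tT: "t \<in> T"
  proof -
    obtain xs where xs: "set xs \<subseteq> U \<times> V" "t = (\<Sum>(u, v)\<leftarrow>xs. tensor sU U sV V u v)"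
      by (rule tensor_space_sums[OF U tT[unfolded T_def]])
    let ?zs = "map (\<lambda>(u, v). (sU c u, v)) xs"
    have "set ?zs \<subseteq> U \<times> V" using xs(1) U by auto
    moreover have "tensor_scale c t = (\<Sum>(u, v)\<leftarrow>?zs. tensor sU U sV V u v)"
      unfolding xs(2) using xs(1)
      by (induction xs)
        (auto simp: T.scale_right_distrib, auto simp: tensor_scale_def tensor_def bilinear_on_def fun_eq_iff)
    moreover have "(\<Sum>(u, v)\<leftarrow>?zs. f u v) = sW c (\<Sum>(u, v)\<leftarrow>xs. f u v)"
      using xs(1) f by (induction xs) (auto simp: W.scale_right_distrib bilinear_on_def)
    ultimately show ?thesis using lift[of ?zs] lift[OF xs(1)] xs(2) by simp
  qed
qed


section \<open>Poisson conformal coalgebras and bialgebras\<close>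

text \<open>\<open>V \<otimes> V \<otimes> V\<close> is \<open>(V \<otimes> V) \<otimes> V\<close>; the operators below on \<open>V \<otimes> (V \<otimes> V)\<close> include the
  associativity identification.\<close>

type_synonym ('v, 'k) tensor2 = "('v, 'v, 'k) tensor"
type_synonym ('v, 'k) tensor3 = "(('v, 'k) tensor2, 'v, 'k) tensor"

context
  fixes s :: "'k::field_char_0 poly \<Rightarrow> 'v::ab_group_add \<Rightarrow> 'v" and V :: "'v set"
begin

definition space2 :: "('v, 'k) tensor2 set" where
  "space2 = tensor_space (kscale s) V (kscale s) V"

definition tens2 :: "'v \<Rightarrow> 'v \<Rightarrow> ('v, 'k) tensor2" where
  "tens2 u v = tensor (kscale s) V (kscale s) V u v"

definition lift2 :: "('v \<Rightarrow> 'v \<Rightarrow> 'w::ab_group_add) \<Rightarrow> ('v, 'k) tensor2 \<Rightarrow> 'w" where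
  "lift2 = tensor_lift (kscale s) V (kscale s) V"

definition tens21 :: "('v, 'k) tensor2 \<Rightarrow> 'v \<Rightarrow> ('v, 'k) tensor3" where
  "tens21 t v = tensor tensor_scale space2 (kscale s) V t v"

definition lift21 :: "(('v, 'k) tensor2 \<Rightarrow> 'v \<Rightarrow> 'w::ab_group_add) \<Rightarrow> ('v, 'k) tensor3 \<Rightarrow> 'w" where
  "lift21 = tensor_lift tensor_scale space2 (kscale s) V"

definition flip_tensor :: "('v, 'k) tensor2 \<Rightarrow> ('v, 'k) tensor2" where
  "flip_tensor = lift2 (\<lambda>u v. tens2 v u)"

definition der2 :: "('v, 'k) tensor2 \<Rightarrow> ('v, 'k) tensor2" where
  "der2 = lift2 (\<lambda>u v. tens2 (der s u) v + tens2 u (der s v))"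

text \<open>\<open>\<Delta> \<otimes> I\<close>, \<open>I \<otimes> \<Delta>\<close> on \<open>V \<otimes> V\<close>, and \<open>\<tau> \<otimes> I\<close> on \<open>V \<otimes> V \<otimes> V\<close>\<close>

definition cop_left :: "('v \<Rightarrow> ('v, 'k) tensor2) \<Rightarrow> ('v, 'k) tensor2 \<Rightarrow> ('v, 'k) tensor3" where
  "cop_left \<Delta> = lift2 (\<lambda>u v. tens21 (\<Delta> u) v)"

definition cop_right :: "('v \<Rightarrow> ('v, 'k) tensor2) \<Rightarrow> ('v, 'k) tensor2 \<Rightarrow> ('v, 'k) tensor3" where
  "cop_right \<Delta> = lift2 (\<lambda>u v. lift2 (\<lambda>x y. tens21 (tens2 u x) y) (\<Delta> v))"

definition flip_left :: "('v, 'k) tensor3 \<Rightarrow> ('v, 'k) tensor3" where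
  "flip_left = lift21 (\<lambda>t v. tens21 (flip_tensor t) v)"

text \<open>For \<open>T = (\<nu> \<mapsto> T\<^sub>\<nu>)\<close>: \<open>T\<^sub>\<lambda> \<otimes> I\<close>, \<open>I \<otimes> T\<^sub>\<lambda>\<close>, and the same operators with \<open>\<lambda>\<close> replaced
  by \<open>-\<lambda>-\<partial>\<close>, where \<open>\<partial>\<close> acts on \<open>V \<otimes> V\<close>.\<close>

definition op_left :: "('v \<Rightarrow> 'v poly) \<Rightarrow> ('v, 'k) tensor2 \<Rightarrow> ('v, 'k) tensor2 poly" where
  "op_left T = lift2 (\<lambda>u v. map_poly (\<lambda>w. tens2 w v) (T u))"

definition op_right :: "('v \<Rightarrow> 'v poly) \<Rightarrow> ('v, 'k) tensor2 \<Rightarrow> ('v, 'k) tensor2 poly" where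
  "op_right T = lift2 (\<lambda>u v. map_poly (\<lambda>w. tens2 u w) (T v))"

definition op_left_flip :: "('v \<Rightarrow> 'v poly) \<Rightarrow> ('v, 'k) tensor2 \<Rightarrow> ('v, 'k) tensor2 poly" where
  "op_left_flip T = lift2 (\<lambda>u v. flip_by der2 (\<lambda>w. tens2 w v) (T u))"

definition op_right_flip :: "('v \<Rightarrow> 'v poly) \<Rightarrow> ('v, 'k) tensor2 \<Rightarrow> ('v, 'k) tensor2 poly" where
  "op_right_flip T = lift2 (\<lambda>u v. flip_by der2 (\<lambda>w. tens2 u w) (T v))"

definition coproduct :: "('v \<Rightarrow> ('v, 'k) tensor2) \<Rightarrow> bool" where
  "coproduct \<Delta> \<longleftrightarrow>
     (\<forall>a\<in>V. \<Delta> a \<in> space2) \<and>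
     (\<forall>a\<in>V. \<forall>b\<in>V. \<Delta> (a + b) = \<Delta> a + \<Delta> b) \<and>
     (\<forall>c. \<forall>a\<in>V. \<Delta> (kscale s c a) = tensor_scale c (\<Delta> a)) \<and>
     (\<forall>a\<in>V. \<Delta> (der s a) = der2 (\<Delta> a))"

definition cocomm_coassoc_conformal :: "('v \<Rightarrow> ('v, 'k) tensor2) \<Rightarrow> bool" where
  "cocomm_coassoc_conformal \<Delta> \<longleftrightarrow>
     fg_module s V \<and> coproduct \<Delta> \<and>
     (\<forall>a\<in>V. cop_right \<Delta> (\<Delta> a) = cop_left \<Delta> (\<Delta> a)) \<and>
     (\<forall>a\<in>V. \<Delta> a = flip_tensor (\<Delta> a))"

definition lie_conformal_coalgebra :: "('v \<Rightarrow> ('v, 'k) tensor2) \<Rightarrow> bool" where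
  "lie_conformal_coalgebra \<delta> \<longleftrightarrow>
     fg_module s V \<and> coproduct \<delta> \<and>
     (\<forall>a\<in>V. \<delta> a = - flip_tensor (\<delta> a)) \<and>
     (\<forall>a\<in>V. cop_right \<delta> (\<delta> a) - flip_left (cop_right \<delta> (\<delta> a)) = cop_left \<delta> (\<delta> a))"

definition poisson_conformal_coalgebra ::
  "('v \<Rightarrow> ('v, 'k) tensor2) \<Rightarrow> ('v \<Rightarrow> ('v, 'k) tensor2) \<Rightarrow> bool" where
  "poisson_conformal_coalgebra \<delta> \<Delta> \<longleftrightarrow>
     lie_conformal_coalgebra \<delta> \<and> cocomm_coassoc_conformal \<Delta> \<and>
     (\<forall>a\<in>V. cop_right \<Delta> (\<delta> a) = cop_left \<delta> (\<Delta> a) + flip_left (cop_right \<delta> (\<Delta> a)))"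

definition poisson_conformal_bialgebra ::
  "('v \<Rightarrow> 'v \<Rightarrow> 'v poly) \<Rightarrow> ('v \<Rightarrow> 'v \<Rightarrow> 'v poly) \<Rightarrow>
   ('v \<Rightarrow> ('v, 'k) tensor2) \<Rightarrow> ('v \<Rightarrow> ('v, 'k) tensor2) \<Rightarrow> bool" where
  "poisson_conformal_bialgebra br m \<delta> \<Delta> \<longleftrightarrow>
     poisson_conformal s V br m \<and> poisson_conformal_coalgebra \<delta> \<Delta> \<and>
     (\<forall>a\<in>V. \<forall>b\<in>V.
        map_poly \<delta> (br a b) =
          op_left (br a) (\<delta> b) + op_right (br a) (\<delta> b)
          - (op_left_flip (br b) (\<delta> a) + op_right_flip (br b) (\<delta> a)) \<and>
        map_poly \<Delta> (m a b) =
          op_right (m a) (\<Delta> b) + op_left_flip (m b) (\<Delta> a) \<and>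
        map_poly \<delta> (m a b) =
          op_left (m a) (\<delta> b) + op_left_flip (m b) (\<delta> a)
          + op_right (br a) (\<Delta> b) + op_right_flip (br b) (\<Delta> a) \<and>
        map_poly \<Delta> (br a b) =
          op_left (br a) (\<Delta> b) + op_right (br a) (\<Delta> b)
          - op_right_flip (m b) (\<delta> a) + op_left_flip (m b) (\<delta> a))"

text \<open>\<open>(f\<^sub>\<lambda> g)\<^sub>\<mu>(a) = \<Sum> f\<^sub>\<lambda>(a') g\<^bsub>\<mu>-\<lambda>\<^esub>(a'')\<close> for a coproduct \<open>a \<mapsto> \<Sum> a' \<otimes> a''\<close>\<close>

definition dual_product ::
  "('v \<Rightarrow> ('v, 'k) tensor2) \<Rightarrow> ('v \<Rightarrow> 'k poly) \<Rightarrow> ('v \<Rightarrow> 'k poly) \<Rightarrow> ('v \<Rightarrow> 'k poly) poly" where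
  "dual_product \<Delta> f g = dual_poly V (\<lambda>a.
     lift2 (\<lambda>x y. subst lam const2 (f x) * subst (\<lambda>q. mu q - lam q) const2 (g y)) (\<Delta> a))"

end

text \<open>\<open>\<langle>a + f, b + g\<rangle>\<^sub>\<lambda> = f\<^sub>\<lambda>(b) + g\<^bsub>-\<lambda>\<^esub>(a)\<close>\<close>

definition double_form ::
  "'v \<times> ('v \<Rightarrow> 'k::field_char_0 poly) \<Rightarrow> 'v \<times> ('v \<Rightarrow> 'k poly) \<Rightarrow> 'k poly" where
  "double_form = (\<lambda>(a, f) (b, g). f b + neg_var (g a))"

text \<open>The products on \<open>P \<times> Q\<close> that extend given products on \<open>P\<close> and \<open>Q\<close>.\<close>

definition extends_products ::
  "'p::zero set \<Rightarrow> ('p \<Rightarrow> 'p \<Rightarrow> 'p poly) \<Rightarrow> 'q::zero set \<Rightarrow> ('q \<Rightarrow> 'q \<Rightarrow> 'q poly) \<Rightarrow>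
   ('p \<times> 'q \<Rightarrow> 'p \<times> 'q \<Rightarrow> ('p \<times> 'q) poly) \<Rightarrow> bool" where
  "extends_products P mP Q mQ m \<longleftrightarrow>
     (\<forall>a\<in>P. \<forall>b\<in>P. m (a, 0) (b, 0) = pair_poly (mP a b) 0) \<and>
     (\<forall>x\<in>Q. \<forall>y\<in>Q. m (0, x) (0, y) = pair_poly 0 (mQ x y))"

end

theory Submission
  imports Defs
begin

text \<open>
  The idea is to remove the formal variables. The field \<open>k\<close> is infinite, so a polynomial is
  determined by its values and every \<open>\<lambda>\<close>, \<open>\<mu>\<close> may be replaced by scalars. A product then becomes a
  family of bilinear maps \<open>a\<^sub>\<alpha> b\<close>, and each argument has a scalar momentum \<open>\<alpha>\<close>: after pairing with
  enough linear forms, \<open>\<partial>\<close> acts on it as \<open>-\<alpha>\<close>. Operators such as \<open>-\<lambda>-\<partial>\<close> turn into the missing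
  momentum of a list of momenta with sum zero (\<open>hat_flip_by\<close>, \<open>momentum_form_flip\<close>).

  Let \<open>R\<close> be the direct sum of \<open>P\<close> and its conformal dual, with the given form. For a product on
  \<open>R\<close> and \<open>\<alpha> + \<beta> + \<gamma> = 0\<close> put \<open>T(x,\<alpha>; y,\<beta>; z,\<gamma>) = \<langle>x\<^sub>\<alpha> y, z\<rangle>\<close>, the form being taken at \<open>\<alpha> + \<beta>\<close>.
  Invariance of the form says that \<open>T\<close> is unchanged under cyclic rotations (\<open>invariant_form_iff\<close>).
  Hence an invariant product is determined by the products of the two summands:
  \<open>T\<close> is the sum of the three rotations of \<open>h(a\<^sub>\<alpha> b)\<close> and the three rotations of
  \<open>(f \<otimes> g)(\<Delta>(c))\<close>, which is the predicate \<open>doubles\<close>. The matched pair products of the coadjoint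
  actions are of this form (\<open>matched_bracket_doubles\<close>, \<open>matched_mult_doubles\<close>), and so is every
  invariant extension (\<open>cyclic_extension_doubles\<close>). Therefore both the matched pair and the Manin
  triple amount to the statement that \<open>R\<close>, with such products, is a Poisson conformal algebra.

  It remains to compare this with the bialgebra conditions (\<open>double_poisson_iff\<close>). Pairing an axiom
  for \<open>x, y, z\<close> with a fourth element \<open>w\<close> and using invariance gives a relation between numbers
  \<open>\<langle>x\<^sub>\<alpha> y, z\<^sub>\<gamma> w\<rangle>\<close> and their permutations:
  the Jacobi identity says that the sum over the three ways of splitting \<open>x, y, z, w\<close> into pairs
  vanishes (with signs), associativity that the three numbers agree, and the Leibniz rule is the mixed version.
  These relations are symmetric enough to permute the arguments, and additive, so each argument may
  be taken from one of the summands (\<open>for_quadruples_split\<close>). If three arguments lie in the same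
  summand, the relation is an axiom of \<open>P\<close>, or an axiom of the dual, that is, a coalgebra axiom
  (\<open>poisson_conformal_dual\<close>). If two lie in each, computing both kinds of numbers
  (\<open>quartic_pure\<close>, \<open>quartic_mixed\<close>) turns it into a compatibility condition between product and
  coproduct, evaluated at \<open>f \<otimes> g\<close>; such evaluations separate the points of \<open>P \<otimes> P\<close>
  (\<open>S2_separates\<close>) because \<open>P\<close> is free.
\<close>

section \<open>Evaluation at scalars\<close>

definition ev :: "('k::field \<Rightarrow> 'v \<Rightarrow> 'v) \<Rightarrow> 'k \<Rightarrow> 'v::ab_group_add poly \<Rightarrow> 'v" where
  "ev sc c p = (\<Sum>k\<le>degree p. sc (c ^ k) (coeff p k))"

definition linear_form :: "('k::field \<Rightarrow> 'v::ab_group_add \<Rightarrow> 'v) \<Rightarrow> ('v \<Rightarrow> 'k) \<Rightarrow> bool" where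
  "linear_form sc \<psi> \<longleftrightarrow> (\<forall>x y. \<psi> (x + y) = \<psi> x + \<psi> y) \<and> (\<forall>c x. \<psi> (sc c x) = c * \<psi> x)"

text \<open>
  For a linear form \<open>\<psi>\<close> this is \<open>\<psi>(p(c))\<close>
  (\<open>linear_form_ev\<close>). Unlike \<open>\<psi>(p(c))\<close> it can be nested, which
  evaluates polynomials in two variables, and it makes sense for functions \<open>\<psi>\<close>
  that are linear on a subspace only.
\<close>

definition hat :: "('v::zero \<Rightarrow> 'k::field) \<Rightarrow> 'k \<Rightarrow> 'v poly \<Rightarrow> 'k" where
  "hat \<psi> c p = poly (map_poly \<psi> p) c"

lemma linear_form_add: "linear_form sc \<psi> \<Longrightarrow> \<psi> (x + y) = \<psi> x + \<psi> y"
  and linear_form_scale: "linear_form sc \<psi> \<Longrightarrow> \<psi> (sc c x) = c * \<psi> x"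
  by (auto simp: linear_form_def)

lemma linear_form_0: "linear_form sc \<psi> \<Longrightarrow> \<psi> 0 = 0"
  by (metis add.right_neutral add_left_cancel linear_form_add)

lemma linear_form_minus: "linear_form sc \<psi> \<Longrightarrow> \<psi> (- x) = - \<psi> x"
  using linear_form_add[of sc \<psi> "- x" x] by (simp add: linear_form_0 eq_neg_iff_add_eq_0)

lemma linear_form_diff: "linear_form sc \<psi> \<Longrightarrow> \<psi> (x - y) = \<psi> x - \<psi> y"
  using linear_form_add[of sc \<psi> x "- y"] by (simp add: linear_form_minus)

lemma linear_form_sum: "linear_form sc \<psi> \<Longrightarrow> \<psi> (sum g A) = (\<Sum>i\<in>A. \<psi> (g i))"
  by (induction A rule: infinite_finite_induct) (auto simp: linear_form_0 linear_form_add)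

lemmas linear_form_simps =
  linear_form_add linear_form_scale linear_form_0 linear_form_minus linear_form_diff

lemma hat_sum: "degree p \<le> n \<Longrightarrow> \<psi> 0 = 0 \<Longrightarrow> hat \<psi> c p = (\<Sum>k\<le>n. c ^ k * \<psi> (coeff p k))"
proof -
  assume "degree p \<le> n" and \<psi>: "\<psi> 0 = 0"
  then have "degree (map_poly \<psi> p) \<le> n" using map_poly_degree_leq[of \<psi> p] by simp
  then have "(\<Sum>k\<le>n. coeff (map_poly \<psi> p) k * c ^ k) = poly (map_poly \<psi> p) c"
    unfolding poly_altdef by (intro sum.mono_neutral_right) (auto simp: coeff_eq_0)
  then show ?thesis by (simp add: hat_def coeff_map_poly \<psi> mult.commute)
qed

lemma hat_conv_sum: "\<psi> 0 = 0 \<Longrightarrow> hat \<psi> c p = (\<Sum>k\<le>degree p. c ^ k * \<psi> (coeff p k))"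
  by (simp add: hat_sum)

lemma hat_0 [simp]: "hat \<psi> c 0 = 0"
  by (simp add: hat_def)

lemma hat_const: "\<psi> 0 = 0 \<Longrightarrow> hat \<psi> c [:v:] = \<psi> v"
  by (simp add: hat_conv_sum)

lemma hat_pCons: "\<psi> 0 = 0 \<Longrightarrow> hat \<psi> c (pCons 0 p) = c * hat \<psi> c p"
  by (simp add: hat_def map_poly_pCons)

lemma hat_map_poly: "D 0 = 0 \<Longrightarrow> \<psi> 0 = 0 \<Longrightarrow> hat \<psi> c (map_poly D p) = hat (\<lambda>x. \<psi> (D x)) c p"
  by (simp add: hat_def map_poly_map_poly o_def)

lemma hat_eigen:
  assumes "D 0 = 0" "\<psi> 0 = 0" "\<And>n. \<psi> (D (coeff p n)) = d * \<psi> (coeff p n)"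
  shows "hat \<psi> c (map_poly D p) = d * hat \<psi> c p"
proof -
  have "hat \<psi> c (map_poly D p) = (\<Sum>k\<le>degree p. c ^ k * \<psi> (D (coeff p k)))"
    unfolding hat_map_poly[of D, OF assms(1), of \<psi>, OF assms(2)] using assms by (subst hat_conv_sum) auto
  then show ?thesis
    using assms hat_conv_sum[of \<psi> c p] by (simp add: sum_distrib_left mult_ac)
qed

lemma linear_form_hat:
  assumes "linear_form sc \<psi>" "\<And>c. sc c 0 = 0"
  shows "linear_form (\<lambda>c. map_poly (sc c)) (hat \<psi> l)"
proof -
  have "map_poly \<psi> (p + q) = map_poly \<psi> p + map_poly \<psi> q" for p q
    using assms by (intro poly_eqI) (simp add: coeff_map_poly linear_form_simps)
  then show ?thesis
    using assms by (simp add: linear_form_def[of "\<lambda>c. map_poly (sc c)"] hat_eigen linear_form_simps)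
       (simp add: hat_def)
qed

lemma (in vector_space) linear_form_separates:
  assumes "x \<noteq> 0"
  obtains \<psi> where "linear_form scale \<psi>" "\<psi> x \<noteq> 0"
proof -
  interpret K: vector_space "(*) :: 'a \<Rightarrow> 'a \<Rightarrow> 'a" by unfold_locales (auto simp: algebra_simps)
  interpret WK: vector_space_pair scale "(*) :: 'a \<Rightarrow> 'a \<Rightarrow> 'a" ..
  have "independent {x}" using assms by (simp add: dependent_single)
  then obtain g where g: "Vector_Spaces.linear scale (*) g" "g x = 1"
    using WK.linear_independent_extend[of "{x}" "\<lambda>_. 1"] by auto
  interpret g: Vector_Spaces.linear scale "(*)" g by (rule g(1))
  show ?thesis by (rule that[of g]) (auto simp: linear_form_def g.add g.scale g(2))
qed

lemma (in vector_space) eq_linear_formI: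
  assumes "\<And>\<psi>. linear_form scale \<psi> \<Longrightarrow> \<psi> x = \<psi> y"
  shows "x = y"
proof (rule ccontr)
  assume "x \<noteq> y"
  then obtain \<psi> where "linear_form scale \<psi>" "\<psi> (x - y) \<noteq> 0"
    using linear_form_separates[of "x - y"] by auto
  then show False using assms by (auto simp: linear_form_diff)
qed

lemma vector_space_poly:
  assumes "vector_space sc"
  shows "vector_space (\<lambda>c. map_poly (sc c))"
proof -
  interpret vector_space sc by fact
  show ?thesis
    by unfold_locales (auto intro!: poly_eqI simp: coeff_map_poly algebra_simps)
qed

lemma linear_form_ev: "linear_form sc \<psi> \<Longrightarrow> \<psi> (ev sc c p) = hat \<psi> c p"
  by (simp add: ev_def linear_form_sum hat_conv_sum linear_form_simps)

text \<open>
  Every form turns the two polynomials into polynomials over \<open>k\<close> that agree at all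
  points of an infinite field. The set \<open>W\<close> allows for forms that separate only part
  of a type, such as \<open>P \<otimes> P\<close> inside the space of all functionals.
\<close>

lemma poly_eqI_forms:
  fixes p q :: "'v::ab_group_add poly" and sc :: "'k::field_char_0 \<Rightarrow> 'v \<Rightarrow> 'v"
  assumes W: "\<And>n. coeff p n - coeff q n \<in> W"
    and sep: "\<And>x. x \<in> W \<Longrightarrow> (\<And>\<psi>. \<psi> \<in> \<Psi> \<Longrightarrow> \<psi> x = 0) \<Longrightarrow> x = 0"
    and lin: "\<And>\<psi>. \<psi> \<in> \<Psi> \<Longrightarrow> linear_form sc \<psi>"
    and eq: "\<And>\<psi> c. \<psi> \<in> \<Psi> \<Longrightarrow> hat \<psi> c p = hat \<psi> c q"
  shows "p = q"
proof (rule poly_eqI)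
  fix n
  have "coeff p n - coeff q n = 0"
  proof (rule sep[OF W])
    fix \<psi> assume \<psi>: "\<psi> \<in> \<Psi>"
    have "poly (map_poly \<psi> p) = poly (map_poly \<psi> q)"
      using eq[OF \<psi>] by (auto simp: hat_def)
    then have "map_poly \<psi> p = map_poly \<psi> q" by (simp add: poly_eq_poly_eq_iff)
    then have "coeff (map_poly \<psi> p) n = coeff (map_poly \<psi> q) n" by simp
    then show "\<psi> (coeff p n - coeff q n) = 0"
      using lin[OF \<psi>] by (simp add: coeff_map_poly linear_form_simps)
  qed
  then show "coeff p n = coeff q n" by simp
qed

lemma poly_eqI_ev:
  fixes p q :: "'v::ab_group_add poly" and sc :: "'k::field_char_0 \<Rightarrow> 'v \<Rightarrow> 'v"
  assumes "vector_space sc" "\<And>c. ev sc c p = ev sc c q"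
  shows "p = q"
proof -
  interpret vector_space sc by fact
  show ?thesis
  proof (rule poly_eqI_forms[where W = UNIV and \<Psi> = "{\<psi>. linear_form sc \<psi>}" and sc = sc])
    show "x = 0" if "\<And>\<psi>. \<psi> \<in> {\<psi>. linear_form sc \<psi>} \<Longrightarrow> \<psi> x = 0" for x
      using that linear_form_separates by blast
    show "hat \<psi> c p = hat \<psi> c q" if "\<psi> \<in> {\<psi>. linear_form sc \<psi>}" for \<psi> c
      using that assms(2) linear_form_ev[of sc \<psi>] by (metis mem_Collect_eq)
  qed auto
qed

lemma poly2_eqI_hat:
  fixes p q :: "'v::ab_group_add poly poly" and sc :: "'k::field_char_0 \<Rightarrow> 'v \<Rightarrow> 'v"
  assumes V: "vector_space sc"
    and eq: "\<And>\<psi> c d. linear_form sc \<psi> \<Longrightarrow> hat (hat \<psi> d) c p = hat (hat \<psi> d) c q"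
  shows "p = q"
proof -
  interpret vector_space sc by fact
  let ?\<Psi> = "{hat \<psi> d |\<psi> d. linear_form sc \<psi>}"
  show ?thesis
  proof (rule poly_eqI_forms[where W = UNIV and \<Psi> = ?\<Psi> and sc = "\<lambda>c. map_poly (sc c)"])
    fix x :: "'v poly" assume x: "\<And>\<phi>. \<phi> \<in> ?\<Psi> \<Longrightarrow> \<phi> x = 0"
    show "x = 0"
    proof (rule poly_eqI_forms[where W = UNIV and \<Psi> = "{\<psi>. linear_form sc \<psi>}" and sc = sc])
      show "x = 0" if "\<And>\<psi>. \<psi> \<in> {\<psi>. linear_form sc \<psi>} \<Longrightarrow> \<psi> x = 0" for x
        using that linear_form_separates by blast
    qed (use x in auto)
  qed (use eq in \<open>auto intro: linear_form_hat\<close>)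
qed

context vector_space
begin

lemma ev_add: "ev scale c (p + q) = ev scale c p + ev scale c q"
proof (rule eq_linear_formI)
  fix \<psi> assume \<psi>: "linear_form scale \<psi>"
  then show "\<psi> (ev scale c (p + q)) = \<psi> (ev scale c p + ev scale c q)"
    using linear_form_add[OF linear_form_hat[OF \<psi>]] by (simp add: linear_form_ev linear_form_add)
qed

lemma ev_0 [simp]: "ev scale c 0 = 0"
  by (simp add: ev_def)

lemma ev_minus: "ev scale c (- p) = - ev scale c p"
  using ev_add[of c p "- p"] by (simp add: eq_neg_iff_add_eq_0 add.commute)

lemma ev_diff: "ev scale c (p - q) = ev scale c p - ev scale c q"
  using ev_add[of c p "- q"] by (simp add: ev_minus)

lemma ev_scale: "ev scale c (map_poly (scale d) p) = scale d (ev scale c p)"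
proof (rule eq_linear_formI)
  fix \<psi> assume \<psi>: "linear_form scale \<psi>"
  then show "\<psi> (ev scale c (map_poly (scale d) p)) = \<psi> (scale d (ev scale c p))"
    using linear_form_scale[OF linear_form_hat[OF \<psi>]]
    by (simp add: linear_form_ev linear_form_scale)
qed

lemma ev_pCons: "ev scale c (pCons 0 p) = scale c (ev scale c p)"
proof (rule eq_linear_formI)
  fix \<psi> assume \<psi>: "linear_form scale \<psi>"
  then show "\<psi> (ev scale c (pCons 0 p)) = \<psi> (scale c (ev scale c p))"
    by (simp add: linear_form_ev linear_form_scale hat_pCons linear_form_0)
qed

end

lemma ev_map_poly:
  assumes "vector_space sc" "vector_space sc'"
    and D: "\<And>x y. D (x + y) = D x + D y" "\<And>c x. D (sc c x) = sc' c (D x)"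
  shows "ev sc' c (map_poly D p) = D (ev sc c p)"
proof -
  interpret vector_space sc' by fact
  have D0: "D 0 = 0" using D(1)[of 0 0] by simp
  show ?thesis
  proof (rule eq_linear_formI)
    fix \<psi> assume \<psi>: "linear_form sc' \<psi>"
    then have "linear_form sc (\<lambda>x. \<psi> (D x))" by (auto simp: linear_form_def D)
    then show "\<psi> (ev sc' c (map_poly D p)) = \<psi> (D (ev sc c p))"
      using \<psi> linear_form_ev[of sc "\<lambda>x. \<psi> (D x)" c p]
      by (simp add: linear_form_ev hat_map_poly D0 linear_form_0)
  qed
qed

text \<open>
  A form on which the substituted operator acts as a number turns the substitution into the
  evaluation of a polynomial. Every \<open>subst\<close> in the definitions is computed in this
  way.
\<close>

lemma subst_form:
  assumes "linear_form sc \<phi>"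
    and W: "\<And>x. x \<in> W \<Longrightarrow> T x \<in> W \<and> \<phi> (T x) = d * \<phi> x"
    and e: "\<And>k. e (coeff p k) \<in> W" and e0: "\<phi> (e 0) = 0"
  shows "\<phi> (subst T e p) = hat (\<lambda>v. \<phi> (e v)) d p"
proof -
  have *: "(T ^^ k) x \<in> W \<and> \<phi> ((T ^^ k) x) = d ^ k * \<phi> x" if "x \<in> W" for x k
    using that W by (induction k) auto
  show ?thesis
    unfolding subst_def linear_form_sum[OF assms(1)]
    using * e by (simp add: hat_conv_sum e0)
qed

lemma subst_mem:
  assumes W: "\<And>x. x \<in> W \<Longrightarrow> T x \<in> W" "\<And>x y. x \<in> W \<Longrightarrow> y \<in> W \<Longrightarrow> x + y \<in> W" "0 \<in> W"
    and e: "\<And>k. e (coeff p k) \<in> W"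
  shows "subst T e p \<in> W"
proof -
  have *: "(T ^^ k) x \<in> W" if "x \<in> W" for x k
    using that W by (induction k) auto
  have "(\<Sum>k\<in>A. (T ^^ k) (e (coeff p k))) \<in> W" if "finite A" for A
    using that by induction (auto intro: W * e)
  then show ?thesis by (simp add: subst_def)
qed

text \<open>
  If \<open>D\<close> acts on \<open>\<psi>\<close> as \<open>d\<close>, then at \<open>\<lambda>
  = c\<close> the operator \<open>-\<lambda>-D\<close> acts as \<open>-c-d\<close>. The set
  \<open>W\<close> is there for the operator \<open>\<partial>\<close> on \<open>P \<otimes>
  P\<close>, which is a lifted map and is known only on tensors.
\<close>

lemma hat_flip_by:
  assumes \<psi>: "linear_form sc \<psi>" "\<And>c. sc c 0 = 0"
    and W: "\<And>x. x \<in> W \<Longrightarrow> D x \<in> W \<and> \<psi> (D x) = d * \<psi> x"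
      "\<And>x y. x \<in> W \<Longrightarrow> y \<in> W \<Longrightarrow> x - y \<in> W" "0 \<in> W" "D 0 = 0"
    and e: "\<And>k. e (coeff p k) \<in> W" "\<psi> (e 0) = 0"
  shows "hat \<psi> c (flip_by D e p) = hat (\<lambda>v. \<psi> (e v)) (- c - d) p"
    and "coeff (flip_by D e p) n \<in> W"
proof -
  let ?W = "{q. \<forall>n. coeff q n \<in> W}" and ?T = "\<lambda>q. - pCons 0 q - map_poly D q"
  have neg: "- x \<in> W" if "x \<in> W" for x
    using W(2)[of 0 x] W(3) that by simp
  have add: "x + y \<in> W" if "x \<in> W" "y \<in> W" for x y
    using W(2)[of x "- y"] neg that by simp
  note hat_lin = linear_form_hat[OF \<psi>, of c]
  have \<psi>0: "\<psi> 0 = 0" by (rule linear_form_0[OF \<psi>(1)])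
  have T: "?T q \<in> ?W \<and> hat \<psi> c (?T q) = (- c - d) * hat \<psi> c q" if "q \<in> ?W" for q
  proof
    show "?T q \<in> ?W"
      using that W neg by (auto simp: coeff_pCons coeff_map_poly split: nat.split)
    have "hat \<psi> c (map_poly D q) = d * hat \<psi> c q"
      using that W \<psi>0 by (intro hat_eigen) auto
    then show "hat \<psi> c (?T q) = (- c - d) * hat \<psi> c q"
      using \<psi>0 by (simp add: linear_form_diff[OF hat_lin] linear_form_minus[OF hat_lin] hat_pCons
          algebra_simps)
  qed
  have "hat \<psi> c (subst ?T (\<lambda>v. [:e v:]) p) = hat (\<lambda>v. hat \<psi> c [:e v:]) (- c - d) p"
    by (rule subst_form[OF hat_lin, where W = ?W])
      (use T e W(3) \<psi>0 in \<open>auto simp: hat_const coeff_pCons split: nat.split\<close>)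
  then show "hat \<psi> c (flip_by D e p) = hat (\<lambda>v. \<psi> (e v)) (- c - d) p"
    by (simp add: flip_by_def hat_const \<psi>0)
  have "subst ?T (\<lambda>v. [:e v:]) p \<in> ?W"
    by (rule subst_mem) (use T e W(3) add in \<open>auto simp: coeff_pCons split: nat.split\<close>)
  then show "coeff (flip_by D e p) n \<in> W" by (simp add: flip_by_def)
qed

lemma hat2_lam: "\<psi> 0 = 0 \<Longrightarrow> hat (hat \<psi> d) c (lam q) = c * hat (hat \<psi> d) c q"
  by (simp add: lam_def hat_pCons)

lemma hat2_mu: "\<psi> 0 = 0 \<Longrightarrow> hat (hat \<psi> d) c (mu q) = d * hat (hat \<psi> d) c q"
  unfolding mu_def by (rule hat_eigen) (auto simp: hat_pCons)

lemma hat2_const: "\<psi> 0 = 0 \<Longrightarrow> hat (hat \<psi> d) c (const2 v) = \<psi> v"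
  by (simp add: const2_def hat_const)

lemma linear_form_hat2:
  assumes "linear_form sc \<psi>" "\<And>c. sc c 0 = 0"
  shows "linear_form (\<lambda>c. map_poly (map_poly (sc c))) (hat (hat \<psi> d) c)"
  by (rule linear_form_hat[OF linear_form_hat]) (use assms in auto)

lemma hat2_subst:
  assumes \<psi>: "linear_form sc \<psi>" "\<And>c. sc c 0 = 0"
    and T: "\<And>q. hat (hat \<psi> r) l (T q) = t * hat (hat \<psi> r) l q"
    and e0: "hat (hat \<psi> r) l (e 0) = 0"
  shows "hat (hat \<psi> r) l (subst T e p) = hat (\<lambda>v. hat (hat \<psi> r) l (e v)) t p"
  by (rule subst_form[OF linear_form_hat2[OF \<psi>], where W = UNIV]) (auto simp: T e0)

section \<open>The axioms at scalar spectral parameters\<close>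

abbreviation evs :: "('k::field_char_0 poly \<Rightarrow> 'v \<Rightarrow> 'v) \<Rightarrow> 'k \<Rightarrow> 'v::ab_group_add poly \<Rightarrow> 'v" where
  "evs s \<equiv> ev (kscale s)"

lemma vector_space_kscale: "module s \<Longrightarrow> vector_space (kscale s)"
proof -
  assume "module s"
  then interpret module s .
  show ?thesis
    by unfold_locales (auto simp: kscale_def scale_right_distrib scale_left_distrib[symmetric]
        one_pCons[symmetric] mult.commute)
qed

lemma kscale_0 [simp]: "module s \<Longrightarrow> kscale s c 0 = 0"
  by (simp add: kscale_def module.scale_zero_right)

lemma der_add: "module s \<Longrightarrow> der s (x + y) = der s x + der s y"
  by (simp add: der_def module.scale_right_distrib)

lemma der_0 [simp]: "module s \<Longrightarrow> der s 0 = 0"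
  by (simp add: der_def module.scale_zero_right)

lemma der_kscale: "module s \<Longrightarrow> der s (kscale s c x) = kscale s c (der s x)"
  by (simp add: der_def kscale_def module.scale_scale)

lemma evs_der: "module s \<Longrightarrow> evs s c (map_poly (der s) p) = der s (evs s c p)"
  by (rule ev_map_poly) (auto simp: der_add der_kscale vector_space_kscale)

definition kspace :: "('k::field \<Rightarrow> 'v::ab_group_add \<Rightarrow> 'v) \<Rightarrow> 'v set \<Rightarrow> bool" where
  "kspace sc W \<longleftrightarrow> 0 \<in> W \<and> (\<forall>x\<in>W. \<forall>y\<in>W. x + y \<in> W) \<and> (\<forall>c. \<forall>x\<in>W. sc c x \<in> W)"

lemma kspace_kscale: "module s \<Longrightarrow> module.subspace s W \<Longrightarrow> kspace (kscale s) W"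
  by (auto simp: kspace_def module.subspace_def kscale_def)

lemma der_mem: "module s \<Longrightarrow> module.subspace s W \<Longrightarrow> x \<in> W \<Longrightarrow> der s x \<in> W"
  by (auto simp: module.subspace_def der_def)

lemma kspace_minus:
  assumes "vector_space sc" "kspace sc W" "x \<in> W"
  shows "- x \<in> W"
proof -
  interpret vector_space sc by fact
  have "sc (- 1) x = - x" by (simp only: scale_minus_left scale_one)
  moreover have "sc (- 1) x \<in> W" using assms(2,3) unfolding kspace_def by blast
  ultimately show ?thesis by simp
qed

lemma kspace_diff: "vector_space sc \<Longrightarrow> kspace sc W \<Longrightarrow> x \<in> W \<Longrightarrow> y \<in> W \<Longrightarrow> x - y \<in> W"
  using kspace_minus[of sc W y] unfolding kspace_def diff_conv_add_uminus by blast

lemma kspace_sum: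
  assumes "kspace sc W" "\<And>i. i \<in> A \<Longrightarrow> g i \<in> W"
  shows "sum g A \<in> W"
  using assms(2) by (induction A rule: infinite_finite_induct) (use assms(1) in \<open>auto simp: kspace_def\<close>)

lemma ev_mem: "kspace sc W \<Longrightarrow> (\<And>n. coeff p n \<in> W) \<Longrightarrow> ev sc c p \<in> W"
  unfolding ev_def by (rule kspace_sum) (auto simp: kspace_def)

text \<open>
  Products on the dual are linear on their carrier only, so evaluation has to commute with maps
  that are not linear on the whole type.
\<close>

lemma hat_on_kspace:
  assumes W: "kspace sc W" "\<And>n. coeff p n \<in> W"
    and \<chi>: "\<And>x y. x \<in> W \<Longrightarrow> y \<in> W \<Longrightarrow> \<chi> (x + y) = \<chi> x + \<chi> y"
      "\<And>c x. x \<in> W \<Longrightarrow> \<chi> (sc c x) = c * \<chi> x"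
  shows "hat \<chi> r p = \<chi> (ev sc r p)"
proof -
  have W0: "0 \<in> W" using W by (simp add: kspace_def)
  have \<chi>0: "\<chi> 0 = 0" using \<chi>(1)[OF W0 W0] by (metis add.right_neutral add_left_cancel)
  have "\<chi> (\<Sum>k\<in>A. sc (r ^ k) (coeff p k)) = (\<Sum>k\<in>A. r ^ k * \<chi> (coeff p k))" if "finite A" for A
    using that
  proof induction
    case (insert k A)
    have "(\<Sum>k\<in>A. sc (r ^ k) (coeff p k)) \<in> W"
      using W by (intro kspace_sum) (auto simp: kspace_def)
    then show ?case using insert W \<chi> by (simp add: kspace_def)
  qed (simp add: \<chi>0)
  then show ?thesis by (simp add: hat_conv_sum[of \<chi>, OF \<chi>0] ev_def)
qed

lemma gc_homD:
  assumes mods: "module t" "module.subspace t Q" and \<rho>: "gc_hom s P t Q \<rho>"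
    and P: "a \<in> P" "b \<in> P" and Q: "x \<in> Q" "y \<in> Q"
  shows "coeff (\<rho> a x) n \<in> Q" "evs t \<alpha> (\<rho> a x) \<in> Q"
    and "evs t \<alpha> (\<rho> (a + b) x) = evs t \<alpha> (\<rho> a x) + evs t \<alpha> (\<rho> b x)"
    and "evs t \<alpha> (\<rho> (kscale s c a) x) = kscale t c (evs t \<alpha> (\<rho> a x))"
    and "evs t \<alpha> (\<rho> (der s a) x) = - kscale t \<alpha> (evs t \<alpha> (\<rho> a x))"
    and "evs t \<alpha> (\<rho> a (x + y)) = evs t \<alpha> (\<rho> a x) + evs t \<alpha> (\<rho> a y)"
    and "evs t \<alpha> (\<rho> a (kscale t c x)) = kscale t c (evs t \<alpha> (\<rho> a x))"
    and "evs t \<alpha> (\<rho> a (der t x)) = der t (evs t \<alpha> (\<rho> a x)) + kscale t \<alpha> (evs t \<alpha> (\<rho> a x))"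
proof -
  interpret V: vector_space "kscale t" using mods by (simp add: vector_space_kscale)
  have cm: "conformal_map t Q t Q (\<rho> a)" using \<rho> P by (simp add: gc_hom_def)
  show "coeff (\<rho> a x) n \<in> Q" for n using cm Q by (auto simp: conformal_map_def)
  then show "evs t \<alpha> (\<rho> a x) \<in> Q" by (intro ev_mem kspace_kscale mods)
  show "evs t \<alpha> (\<rho> (a + b) x) = evs t \<alpha> (\<rho> a x) + evs t \<alpha> (\<rho> b x)"
    "evs t \<alpha> (\<rho> (kscale s c a) x) = kscale t c (evs t \<alpha> (\<rho> a x))"
    "evs t \<alpha> (\<rho> (der s a) x) = - kscale t \<alpha> (evs t \<alpha> (\<rho> a x))"
    using \<rho> P Q by (auto simp: gc_hom_def V.ev_add V.ev_scale V.ev_minus V.ev_pCons)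
  show "evs t \<alpha> (\<rho> a (x + y)) = evs t \<alpha> (\<rho> a x) + evs t \<alpha> (\<rho> a y)"
    "evs t \<alpha> (\<rho> a (kscale t c x)) = kscale t c (evs t \<alpha> (\<rho> a x))"
    "evs t \<alpha> (\<rho> a (der t x)) = der t (evs t \<alpha> (\<rho> a x)) + kscale t \<alpha> (evs t \<alpha> (\<rho> a x))"
    using cm Q by (auto simp: conformal_map_def V.ev_add V.ev_scale V.ev_pCons evs_der mods)
qed

lemma gc_homI:
  assumes mods: "module t"
    and closed: "\<And>a x n. a \<in> P \<Longrightarrow> x \<in> Q \<Longrightarrow> coeff (\<rho> a x) n \<in> Q"
    and "\<And>a b x \<alpha>. a \<in> P \<Longrightarrow> b \<in> P \<Longrightarrow> x \<in> Q \<Longrightarrow>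
        evs t \<alpha> (\<rho> (a + b) x) = evs t \<alpha> (\<rho> a x) + evs t \<alpha> (\<rho> b x)"
      "\<And>c a x \<alpha>. a \<in> P \<Longrightarrow> x \<in> Q \<Longrightarrow> evs t \<alpha> (\<rho> (kscale s c a) x) = kscale t c (evs t \<alpha> (\<rho> a x))"
      "\<And>a x \<alpha>. a \<in> P \<Longrightarrow> x \<in> Q \<Longrightarrow> evs t \<alpha> (\<rho> (der s a) x) = - kscale t \<alpha> (evs t \<alpha> (\<rho> a x))"
      "\<And>a x y \<alpha>. a \<in> P \<Longrightarrow> x \<in> Q \<Longrightarrow> y \<in> Q \<Longrightarrow>
        evs t \<alpha> (\<rho> a (x + y)) = evs t \<alpha> (\<rho> a x) + evs t \<alpha> (\<rho> a y)"
      "\<And>c a x \<alpha>. a \<in> P \<Longrightarrow> x \<in> Q \<Longrightarrow> evs t \<alpha> (\<rho> a (kscale t c x)) = kscale t c (evs t \<alpha> (\<rho> a x))"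
      "\<And>a x \<alpha>. a \<in> P \<Longrightarrow> x \<in> Q \<Longrightarrow>
        evs t \<alpha> (\<rho> a (der t x)) = der t (evs t \<alpha> (\<rho> a x)) + kscale t \<alpha> (evs t \<alpha> (\<rho> a x))"
  shows "gc_hom s P t Q \<rho>"
proof -
  interpret V: vector_space "kscale t" using mods by (simp add: vector_space_kscale)
  note eqI = poly_eqI_ev[OF V.vector_space_axioms]
  show ?thesis
    unfolding gc_hom_def conformal_map_def
    by (intro conjI ballI allI closed eqI)
      (simp_all add: V.ev_add V.ev_scale V.ev_minus V.ev_pCons evs_der[OF mods] assms)
qed

lemma gc_hom_uminus:
  assumes "module t" "module.subspace t Q" "gc_hom r P t Q \<rho>"
  shows "gc_hom r P t Q (\<lambda>a x. - \<rho> a x)"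
proof -
  interpret T: vector_space "kscale t" using assms(1) by (rule vector_space_kscale)
  note gc = gc_homD[OF assms]
  have neg: "- y \<in> Q" if "y \<in> Q" for y
    using kspace_minus[OF T.vector_space_axioms kspace_kscale[OF assms(1,2)] that] .
  have "der t (- y) = - der t y" for y
    using der_add[OF assms(1), of y "- y"] der_0[OF assms(1)] by (simp add: eq_neg_iff_add_eq_0 add.commute)
  then show ?thesis
    by (intro gc_homI) (auto simp: T.ev_minus gc neg assms(1))
qed

subsection \<open>Iterated products\<close>

lemma hat_nest:
  assumes mods: "module t" "module.subspace t Q" and \<rho>: "gc_hom s P t Q \<rho>" and a: "a \<in> P"
    and p: "\<And>n. coeff p n \<in> Q" and \<psi>: "linear_form (kscale t) \<psi>"
  shows "hat (\<lambda>v. \<psi> (evs t l (\<rho> a v))) r p = \<psi> (evs t l (\<rho> a (evs t r p)))"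
  by (rule hat_on_kspace[OF kspace_kscale[OF mods] p])
    (use gc_homD[OF mods \<rho> a a] in \<open>auto simp: linear_form_simps[OF \<psi>]\<close>)

lemma gc_hom_0:
  assumes "module t" "module.subspace t Q" "gc_hom s P t Q \<rho>" "a \<in> P"
  shows "\<rho> a 0 = 0"
proof -
  have "0 \<in> Q" using assms by (simp add: module.subspace_def)
  then have "\<rho> a (0 + 0) = \<rho> a 0 + \<rho> a 0"
    using assms unfolding gc_hom_def conformal_map_def by blast
  then show ?thesis by simp
qed

lemma gc_hom_0_left:
  assumes "module s" "module.subspace s P" "gc_hom s P t Q \<rho>" "x \<in> Q"
  shows "\<rho> 0 x = 0"
proof -
  have "0 \<in> P" using assms by (simp add: module.subspace_def)
  then have "\<rho> (0 + 0) x = \<rho> 0 x + \<rho> 0 x"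
    using assms unfolding gc_hom_def by blast
  then show ?thesis by simp
qed

context
  fixes s :: "'k::field_char_0 poly \<Rightarrow> 'v::ab_group_add \<Rightarrow> 'v" and V :: "'v set"
    and m m' :: "'v \<Rightarrow> 'v \<Rightarrow> 'v poly"
  assumes s: "module s" and V: "module.subspace s V"
    and m: "gc_hom s V s V m" and m': "gc_hom s V s V m'"
begin

interpretation vector_space "kscale s"
  using s by (rule vector_space_kscale)

text \<open>
  Evaluating at \<open>\<lambda> = l\<close>, \<open>\<mu> = r\<close> turns iterated products
  into iterated products at scalars.
\<close>

lemma hat2_nest_right:
  assumes "a \<in> V" "b \<in> V" "c \<in> V" and \<psi>: "linear_form (kscale s) \<psi>"
  shows "hat (hat \<psi> r) l (nest_right m m' lam mu a b c) = \<psi> (evs s l (m a (evs s r (m' b c))))"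
    and "hat (hat \<psi> r) l (nest_right m m' mu lam a b c) = \<psi> (evs s r (m a (evs s l (m' b c))))"
proof -
  have \<psi>0: "\<psi> 0 = 0" using \<psi> by (rule linear_form_0)
  have *: "hat (hat \<psi> r) l (subst T const2 p) = \<psi> (evs s t p)"
    if "\<And>q. hat (hat \<psi> r) l (T q) = t * hat (hat \<psi> r) l q" for T t p
  proof -
    have "hat (hat \<psi> r) l (subst T const2 p) = hat (\<lambda>v. hat (hat \<psi> r) l (const2 v)) t p"
      by (rule hat2_subst[where sc = "kscale s"]) (use that \<psi> s in \<open>auto simp: hat2_const \<psi>0\<close>)
    then show ?thesis using \<psi> by (simp add: hat2_const \<psi>0 linear_form_ev[OF \<psi>])
  qed
  have **: "hat (hat \<psi> r) l (nest_right m m' T T' a b c) = \<psi> (evs s t (m a (evs s t' (m' b c))))"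
    if T: "\<And>q::'v poly poly. hat (hat \<psi> r) l (T q) = t * hat (hat \<psi> r) l q"
      "\<And>q. hat (hat \<psi> r) l (T' q) = t' * hat (hat \<psi> r) l q" for T T' t t'
  proof -
    have "hat (hat \<psi> r) l (nest_right m m' T T' a b c) =
        hat (\<lambda>v. hat (hat \<psi> r) l (subst T const2 (m a v))) t' (m' b c)"
      unfolding nest_right_def
      by (rule hat2_subst[where sc = "kscale s"])
        (use T(2) \<psi> s assms in \<open>auto simp: *[OF T(1)] gc_hom_0[OF s V m] \<psi>0\<close>)
    also have "\<dots> = \<psi> (evs s t (m a (evs s t' (m' b c))))"
      unfolding *[OF T(1)]
      by (rule hat_nest[OF s V m assms(1) _ \<psi>]) (use gc_homD(1)[OF s V m'] assms in auto)
    finally show ?thesis .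
  qed
  show "hat (hat \<psi> r) l (nest_right m m' lam mu a b c) = \<psi> (evs s l (m a (evs s r (m' b c))))"
    "hat (hat \<psi> r) l (nest_right m m' mu lam a b c) = \<psi> (evs s r (m a (evs s l (m' b c))))"
    by (rule **; simp add: hat2_lam hat2_mu \<psi>0)+
qed

lemma hat2_nest_left:
  assumes "a \<in> V" "b \<in> V" "c \<in> V" and \<psi>: "linear_form (kscale s) \<psi>"
  shows "hat (hat \<psi> r) l (nest_left m m' a b c) = \<psi> (evs s (l + r) (m (evs s l (m' a b)) c))"
proof -
  have \<psi>0: "\<psi> 0 = 0" using \<psi> by (rule linear_form_0)
  have T: "hat (hat \<psi> r) l (lam q + mu q) = (l + r) * hat (hat \<psi> r) l q" for q
    using \<psi> s by (simp add: linear_form_add[OF linear_form_hat2] hat2_lam hat2_mu \<psi>0 algebra_simps)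
  have inner: "hat (hat \<psi> r) l (subst (\<lambda>q. lam q + mu q) const2 p) = \<psi> (evs s (l + r) p)" for p
  proof -
    have "hat (hat \<psi> r) l (subst (\<lambda>q. lam q + mu q) const2 p) =
        hat (\<lambda>v. hat (hat \<psi> r) l (const2 v)) (l + r) p"
      by (rule hat2_subst[where sc = "kscale s"]) (use T \<psi> s in \<open>auto simp: hat2_const \<psi>0\<close>)
    then show ?thesis using \<psi> by (simp add: hat2_const \<psi>0 linear_form_ev[OF \<psi>])
  qed
  have "hat (hat \<psi> r) l (nest_left m m' a b c) =
      hat (\<lambda>v. hat (hat \<psi> r) l (subst (\<lambda>q. lam q + mu q) const2 (m v c))) l (m' a b)"
    unfolding nest_left_def
    by (rule hat2_subst[where sc = "kscale s"])
      (use \<psi> s assms in \<open>auto simp: hat2_lam inner gc_hom_0_left[OF s V m] \<psi>0\<close>)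
  also have "\<dots> = \<psi> (evs s (l + r) (m (evs s l (m' a b)) c))"
    unfolding inner
    by (rule hat_on_kspace[OF kspace_kscale[OF s V]])
      (use gc_homD[OF s V m _ _ assms(3) assms(3)] gc_homD(1)[OF s V m'] assms
        in \<open>auto simp: linear_form_simps[OF \<psi>]\<close>)
  finally show ?thesis .
qed

end

definition assoc_at :: "('k::field_char_0 poly \<Rightarrow> 'v::ab_group_add \<Rightarrow> 'v) \<Rightarrow> 'v set \<Rightarrow>
    ('v \<Rightarrow> 'v \<Rightarrow> 'v poly) \<Rightarrow> bool" where
  "assoc_at s V m \<longleftrightarrow> (\<forall>a\<in>V. \<forall>b\<in>V. \<forall>c\<in>V. \<forall>\<alpha> \<beta>.
     evs s (\<alpha> + \<beta>) (m (evs s \<alpha> (m a b)) c) = evs s \<alpha> (m a (evs s \<beta> (m b c))))"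

text \<open>Jacobi is the case \<open>m = br\<close>, the Leibniz rule the case of the commutative product.\<close>

definition leibniz_at :: "('k::field_char_0 poly \<Rightarrow> 'v::ab_group_add \<Rightarrow> 'v) \<Rightarrow> 'v set \<Rightarrow>
    ('v \<Rightarrow> 'v \<Rightarrow> 'v poly) \<Rightarrow> ('v \<Rightarrow> 'v \<Rightarrow> 'v poly) \<Rightarrow> bool" where
  "leibniz_at s V br m \<longleftrightarrow> (\<forall>a\<in>V. \<forall>b\<in>V. \<forall>c\<in>V. \<forall>\<alpha> \<beta>.
     evs s \<alpha> (br a (evs s \<beta> (m b c))) =
     evs s (\<alpha> + \<beta>) (m (evs s \<alpha> (br a b)) c) + evs s \<beta> (m b (evs s \<alpha> (br a c))))"

lemma assoc_at_iff:
  assumes s: "module s" and V: "module.subspace s V" and m: "gc_hom s V s V m"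
  shows "(\<forall>a\<in>V. \<forall>b\<in>V. \<forall>c\<in>V. nest_left m m a b c = nest_right m m lam mu a b c) \<longleftrightarrow>
    assoc_at s V m"
proof -
  interpret vector_space "kscale s" using s by (rule vector_space_kscale)
  note ev = hat2_nest_left[OF s V m m] hat2_nest_right[OF s V m m]
  show ?thesis
    unfolding assoc_at_def
  proof (intro ball_cong refl iffI allI)
    fix a b c \<alpha> \<beta> assume V: "a \<in> V" "b \<in> V" "c \<in> V"
      and eq: "nest_left m m a b c = nest_right m m lam mu a b c"
    show "evs s (\<alpha> + \<beta>) (m (evs s \<alpha> (m a b)) c) = evs s \<alpha> (m a (evs s \<beta> (m b c)))"
      by (rule eq_linear_formI) (simp only: ev[OF V, symmetric] eq)
  next
    fix a b c assume V: "a \<in> V" "b \<in> V" "c \<in> V"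
      and eq: "\<forall>\<alpha> \<beta>. evs s (\<alpha> + \<beta>) (m (evs s \<alpha> (m a b)) c) = evs s \<alpha> (m a (evs s \<beta> (m b c)))"
    show "nest_left m m a b c = nest_right m m lam mu a b c"
      by (rule poly2_eqI_hat[OF vector_space_axioms]) (simp only: ev[OF V] eq[rule_format])
  qed
qed

lemma leibniz_at_iff:
  assumes s: "module s" and V: "module.subspace s V" and br: "gc_hom s V s V br"
    and m: "gc_hom s V s V m"
  shows "(\<forall>a\<in>V. \<forall>b\<in>V. \<forall>c\<in>V. nest_right br m lam mu a b c =
        nest_left m br a b c + nest_right m br mu lam b a c) \<longleftrightarrow> leibniz_at s V br m"
proof -
  interpret vector_space "kscale s" using s by (rule vector_space_kscale)
  note ev = hat2_nest_right(1)[OF s V br m] hat2_nest_left[OF s V m br] hat2_nest_right(2)[OF s V m br]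
  have add: "hat (hat \<psi> d) c (p + q) = hat (hat \<psi> d) c p + hat (hat \<psi> d) c q"
    if "linear_form (kscale s) \<psi>" for \<psi> d c p q
    using linear_form_add[OF linear_form_hat2[OF that]] s by simp
  show ?thesis
    unfolding leibniz_at_def
  proof (intro ball_cong refl iffI allI)
    fix a b c \<alpha> \<beta> assume V: "a \<in> V" "b \<in> V" "c \<in> V"
      and eq: "nest_right br m lam mu a b c = nest_left m br a b c + nest_right m br mu lam b a c"
    show "evs s \<alpha> (br a (evs s \<beta> (m b c))) =
     evs s (\<alpha> + \<beta>) (m (evs s \<alpha> (br a b)) c) + evs s \<beta> (m b (evs s \<alpha> (br a c)))"
    proof (rule eq_linear_formI)
      fix \<psi> assume \<psi>: "linear_form (kscale s) \<psi>"
      show "\<psi> (evs s \<alpha> (br a (evs s \<beta> (m b c)))) =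
        \<psi> (evs s (\<alpha> + \<beta>) (m (evs s \<alpha> (br a b)) c) + evs s \<beta> (m b (evs s \<alpha> (br a c))))"
        unfolding linear_form_add[OF \<psi>] ev(1,2)[OF V \<psi>, symmetric] ev(3)[OF V(2,1,3) \<psi>, symmetric] eq add[OF \<psi>] ..
    qed
  next
    fix a b c assume V: "a \<in> V" "b \<in> V" "c \<in> V"
      and eq: "\<forall>\<alpha> \<beta>. evs s \<alpha> (br a (evs s \<beta> (m b c))) =
     evs s (\<alpha> + \<beta>) (m (evs s \<alpha> (br a b)) c) + evs s \<beta> (m b (evs s \<alpha> (br a c)))"
    show "nest_right br m lam mu a b c = nest_left m br a b c + nest_right m br mu lam b a c"
    proof (rule poly2_eqI_hat[OF vector_space_axioms])
      fix \<psi> c' d assume \<psi>: "linear_form (kscale s) \<psi>"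
      show "hat (hat \<psi> d) c' (nest_right br m lam mu a b c) =
        hat (hat \<psi> d) c' (nest_left m br a b c + nest_right m br mu lam b a c)"
        unfolding add[OF \<psi>] ev(1,2)[OF V \<psi>] ev(3)[OF V(2,1,3) \<psi>] eq[rule_format] linear_form_add[OF \<psi>] ..
    qed
  qed
qed

text \<open>Commutativity and skew-symmetry, with \<open>\<epsilon> = 1\<close> and \<open>\<epsilon> = -1\<close>.\<close>

definition flip_symmetric ::
  "('k::field_char_0 poly \<Rightarrow> 'v::ab_group_add \<Rightarrow> 'v) \<Rightarrow> 'v set \<Rightarrow> 'k \<Rightarrow> ('v \<Rightarrow> 'v \<Rightarrow> 'v poly) \<Rightarrow> bool" where
  "flip_symmetric s V \<epsilon> m \<longleftrightarrow>
     (\<forall>a\<in>V. \<forall>b\<in>V. m a b = map_poly (kscale s \<epsilon>) (flip s (m b a)))"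

text \<open>
  Two elements of \<open>V[\<lambda>,\<mu>]\<close> are equal iff their values at all pairs of
  scalars are.
\<close>

theorem poisson_conformal_at_iff:
  "poisson_conformal s V br m \<longleftrightarrow>
     fg_module s V \<and> gc_hom s V s V br \<and> gc_hom s V s V m \<and>
     flip_symmetric s V (- 1) br \<and> flip_symmetric s V 1 m \<and>
     leibniz_at s V br br \<and> assoc_at s V m \<and> leibniz_at s V br m" (is "?L \<longleftrightarrow> ?R")
proof (cases "fg_module s V \<and> gc_hom s V s V br \<and> gc_hom s V s V m")
  case True
  then have s: "module s" and V: "module.subspace s V" and br: "gc_hom s V s V br"
    and m: "gc_hom s V s V m" by (auto simp: fg_module_def)
  interpret vector_space "kscale s" using s by (rule vector_space_kscale)
  have "map_poly (kscale s (- 1)) p = - p" "map_poly (kscale s 1) p = p" for p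
    by (auto intro!: poly_eqI simp: coeff_map_poly)
  then show ?thesis
    using True unfolding poisson_conformal_def lie_conformal_def comm_assoc_conformal_def
      flip_symmetric_def leibniz_at_iff[OF s V br br] leibniz_at_iff[OF s V br m]
      assoc_at_iff[OF s V m] by (simp; argo)
qed (auto simp: poisson_conformal_def lie_conformal_def comm_assoc_conformal_def)

text \<open>
  The linear forms on the fibre \<open>V/(\<partial>-d)V\<close>.
\<close>

definition momentum_form :: "('k::field_char_0 poly \<Rightarrow> 'v::ab_group_add \<Rightarrow> 'v) \<Rightarrow> 'k \<Rightarrow> ('v \<Rightarrow> 'k) \<Rightarrow> bool" where
  "momentum_form s d \<psi> \<longleftrightarrow> linear_form (kscale s) \<psi> \<and> (\<forall>x. \<psi> (der s x) = d * \<psi> x)"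

text \<open>
  On the fibre \<open>V/(\<partial>-d)V\<close> the operator \<open>-\<lambda>-\<partial>\<close>
  is a scalar. This is what turns commutativity and skew-symmetry into identities between values
  at scalars.
\<close>

lemma momentum_form_flip:
  assumes s: "module s" and \<psi>: "momentum_form s d \<psi>"
  shows "\<psi> (evs s c (flip s p)) = \<psi> (evs s (- c - d) p)"
proof -
  have lin: "linear_form (kscale s) \<psi>" using \<psi> by (simp add: momentum_form_def)
  have "hat \<psi> c (flip_by (der s) (\<lambda>v. v) p) = hat \<psi> (- c - d) p"
    by (rule hat_flip_by(1)[OF lin, where W = UNIV])
      (use s \<psi> in \<open>auto simp: momentum_form_def linear_form_0[OF lin]\<close>)
  then show ?thesis by (simp add: flip_def linear_form_ev[OF lin])
qed

lemma flip_symmetric_iff: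
  fixes d :: "'i \<Rightarrow> 'k::field_char_0" and \<psi> :: "'i \<Rightarrow> 'v::ab_group_add \<Rightarrow> 'k"
  assumes s: "module s" and \<psi>: "\<And>i. i \<in> I \<Longrightarrow> momentum_form s (d i) (\<psi> i)"
    and sep: "\<And>x. (\<And>i. i \<in> I \<Longrightarrow> \<psi> i x = 0) \<Longrightarrow> x = 0"
  shows "flip_symmetric s V \<epsilon> m \<longleftrightarrow> (\<forall>a\<in>V. \<forall>b\<in>V. \<forall>i\<in>I. \<forall>\<alpha>.
    \<psi> i (evs s \<alpha> (m a b)) = \<epsilon> * \<psi> i (evs s (- \<alpha> - d i) (m b a)))"
proof -
  interpret vector_space "kscale s" using s by (rule vector_space_kscale)
  have lin: "linear_form (kscale s) (\<psi> i)" if "i \<in> I" for i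
    using \<psi>[OF that] by (simp add: momentum_form_def)
  have ev: "\<psi> i (evs s \<alpha> (map_poly (kscale s \<epsilon>) (flip s p))) = \<epsilon> * \<psi> i (evs s (- \<alpha> - d i) p)"
    if "i \<in> I" for i \<alpha> p
    using lin[OF that] momentum_form_flip[OF s \<psi>[OF that]] by (simp add: ev_scale linear_form_scale[OF lin[OF that]])
  have "m a b = map_poly (kscale s \<epsilon>) (flip s (m b a))"
    if eq: "\<forall>i\<in>I. \<forall>\<alpha>. \<psi> i (evs s \<alpha> (m a b)) = \<epsilon> * \<psi> i (evs s (- \<alpha> - d i) (m b a))" for a b
  proof (rule poly_eqI_ev[OF vector_space_axioms])
    fix c
    have "evs s c (m a b) - evs s c (map_poly (kscale s \<epsilon>) (flip s (m b a))) = 0"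
    proof (rule sep)
      fix i assume i: "i \<in> I"
      then show "\<psi> i (evs s c (m a b) - evs s c (map_poly (kscale s \<epsilon>) (flip s (m b a)))) = 0"
        unfolding linear_form_diff[OF lin[OF i]] ev[OF i] using bspec[OF eq i] by simp
    qed
    then show "evs s c (m a b) = evs s c (map_poly (kscale s \<epsilon>) (flip s (m b a)))" by simp
  qed
  then show ?thesis
    unfolding flip_symmetric_def
  proof (intro iffI ballI allI, goal_cases)
    case (1 a b i \<alpha>)
    then have "m a b = map_poly (kscale s \<epsilon>) (flip s (m b a))" by blast
    from arg_cong[OF this, of "\<lambda>p. \<psi> i (evs s \<alpha> p)"] show ?case
      unfolding ev[OF \<open>i \<in> I\<close>] .
  next
    case (2 a b)
    then show ?case by blast
  qed
qed

section \<open>Finite free modules and their conformal duals\<close>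

locale finite_free_module = module s
  for s :: "'k::field_char_0 poly \<Rightarrow> 'p::ab_group_add \<Rightarrow> 'p" +
  fixes B :: "'p set"
  assumes finite_basis: "finite B" and independent_basis: "independent B"
    and span_basis: "span B = UNIV"

text \<open>
  Finitely many generators involve finitely many elements of a basis, and these already form a
  basis.
\<close>

lemma finite_free_moduleI:
  assumes "fg_module s (UNIV :: 'p::ab_group_add set)" "free_module s (UNIV :: 'p set)"
  obtains B where "finite_free_module s B"
proof -
  obtain S where s: "module s" and S: "finite S" "module.span s S = UNIV"
    using assms(1) by (auto simp: fg_module_def)
  obtain B where B: "\<not> module.dependent s B" "module.span s B = UNIV"
    using assms(2) by (auto simp: free_module_def)
  interpret module s by (rule s)
  have "\<exists>T. finite T \<and> T \<subseteq> B \<and> x \<in> span T" for x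
  proof -
    have "x \<in> span B" using B by simp
    then obtain T r where "finite T" "T \<subseteq> B" "x = (\<Sum>a\<in>T. s (r a) a)"
      unfolding span_explicit by blast
    then show ?thesis by (intro exI[of _ T]) (auto intro: span_sum span_scale span_base)
  qed
  then obtain T where T: "\<And>x. finite (T x) \<and> T x \<subseteq> B \<and> x \<in> span (T x)" by metis
  define B0 where "B0 = (\<Union>x\<in>S. T x)"
  have "finite B0" "B0 \<subseteq> B" using T S by (auto simp: B0_def)
  have "S \<subseteq> span B0" using T by (auto simp: B0_def intro: span_mono[THEN subsetD, rotated])
  then have "span S \<subseteq> span B0" by (metis span_mono span_span)
  then have "span B0 = UNIV" using S by auto
  have "independent B0" using B(1) \<open>B0 \<subseteq> B\<close> dependent_mono by blast
  show ?thesis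
    by (rule that[of B0], unfold_locales) fact+
qed

lemma neg_var_simps:
  "neg_var 0 = 0" "neg_var (p + q) = neg_var p + neg_var q" "neg_var (- p) = - neg_var p"
  "neg_var (p * q) = neg_var p * neg_var q" "neg_var (smult c p) = smult c (neg_var p)"
  "neg_var 1 = 1" "neg_var [:c:] = [:c:]" "neg_var (neg_var p) = p"
  "poly (neg_var p) c = poly p (- c)" "neg_var (pCons 0 p) = - pCons 0 (neg_var p)"
proof -
  show "neg_var (neg_var p) = p"
    by (simp add: neg_var_def pcompose_assoc[symmetric] pcompose_pCons)
qed (simp_all add: neg_var_def pcompose_add pcompose_uminus pcompose_mult pcompose_smult
    pcompose_1 pcompose_pCons poly_pcompose)

lemma triv_scale_simps: "kscale triv_scale c x = c * x" "der triv_scale x = (0::'k::field_char_0)"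
  by (simp_all add: kscale_def der_def triv_scale_def)

lemma mem_conf_dual_iff:
  fixes s :: "'k::field_char_0 poly \<Rightarrow> 'v::ab_group_add \<Rightarrow> 'v"
  shows "f \<in> conf_dual s V \<longleftrightarrow> (\<forall>u\<in>V. \<forall>v\<in>V. f (u + v) = f u + f v) \<and>
    (\<forall>c. \<forall>u\<in>V. f (kscale s c u) = smult c (f u)) \<and> (\<forall>u\<in>V. f (der s u) = pCons 0 (f u)) \<and>
    (\<forall>u. u \<notin> V \<longrightarrow> f u = 0)"
proof -
  have "map_poly (kscale triv_scale c) p = smult c p" "map_poly (der triv_scale) p = 0" for c and p :: "'k poly"
    by (auto intro!: poly_eqI simp: coeff_map_poly triv_scale_simps)
  then show ?thesis by (auto simp: conf_dual_def conformal_map_def)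
qed

lemma module_dual_scale: "module (dual_scale :: 'k::field_char_0 poly \<Rightarrow> ('v \<Rightarrow> 'k poly) \<Rightarrow> _)"
  by unfold_locales (auto simp: dual_scale_def neg_var_simps fun_eq_iff algebra_simps)

lemma dual_scale_simps:
  "kscale dual_scale c f = (\<lambda>v. smult c (f v))" "der dual_scale f = (\<lambda>v. - pCons 0 (f v))"
  by (simp_all add: kscale_def der_def dual_scale_def neg_var_simps fun_eq_iff)

lemma dual_momentum_form:
  "momentum_form dual_scale (- \<nu>) (\<lambda>f. poly (f v) \<nu>)"
  by (simp add: momentum_form_def linear_form_def dual_scale_simps)

lemma subspace_conf_dual:
  "module s \<Longrightarrow> module.subspace dual_scale (conf_dual s V)"
  by (auto simp: module.subspace_def[OF module_dual_scale] mem_conf_dual_iff dual_scale_def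
      smult_add_right algebra_simps)

lemma conf_dual_scale:
  fixes s :: "'k::field_char_0 poly \<Rightarrow> 'v::ab_group_add \<Rightarrow> 'v"
  assumes s: "module s" "module.subspace s V" and f: "f \<in> conf_dual s V" and u: "u \<in> V"
  shows "f (s r u) = r * f u"
proof (induction r)
  case 0
  have "0 \<in> V" using s by (simp add: module.subspace_def)
  then have "f (0 + 0) = f 0 + f 0" using f unfolding mem_conf_dual_iff by blast
  then show ?case by (simp add: module.scale_zero_left[OF s(1)])
next
  case (pCons c r)
  interpret module s by (rule s(1))
  have mem: "s r u \<in> V" for r using s u by (simp add: module.subspace_def)
  have "s (pCons c r) u = s ([:c:] + [:0, 1:] * r) u" by simp
  also have "\<dots> = kscale s c u + der s (s r u)"
    by (simp only: scale_left_distrib kscale_def der_def scale_scale)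
  finally have *: "s (pCons c r) u = kscale s c u + der s (s r u)" .
  have "kscale s c u \<in> V" "der s (s r u) \<in> V"
    by (simp_all only: kscale_def der_def scale_scale mem)
  then have "f (s (pCons c r) u) = f (kscale s c u) + f (der s (s r u))"
    using f unfolding * mem_conf_dual_iff by blast
  moreover have "f (kscale s c u) = smult c (f u)" "f (der s (s r u)) = pCons 0 (f (s r u))"
    using f mem u unfolding mem_conf_dual_iff by blast+
  ultimately show ?case using pCons.IH by simp
qed

abbreviation pv :: "('v \<Rightarrow> 'k::field_char_0 poly) \<Rightarrow> 'k \<Rightarrow> 'v \<Rightarrow> 'k" where
  "pv f \<nu> v \<equiv> poly (f v) \<nu>"

abbreviation hat2 :: "'k::field_char_0 \<Rightarrow> 'k \<Rightarrow> 'k poly poly \<Rightarrow> 'k" where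
  "hat2 \<alpha> \<nu> \<equiv> hat (hat (\<lambda>x. x) \<nu>) \<alpha>"

lemma hat_id: "hat (\<lambda>x. x) = (\<lambda>\<nu> p. poly p \<nu>)"
  by (simp add: hat_def fun_eq_iff)

lemma linear_form_poly: "linear_form smult (\<lambda>p. poly p \<nu>)"
  by (simp add: linear_form_def)

lemma hat2_linear:
  "hat2 \<alpha> \<nu> (p + q) = hat2 \<alpha> \<nu> p + hat2 \<alpha> \<nu> q" "hat2 \<alpha> \<nu> (- p) = - hat2 \<alpha> \<nu> p"
  "hat2 \<alpha> \<nu> (p - q) = hat2 \<alpha> \<nu> p - hat2 \<alpha> \<nu> q"
  "hat2 \<alpha> \<nu> (smult r p) = poly r \<nu> * hat2 \<alpha> \<nu> p"
proof -
  have *: "linear_form (\<lambda>c. map_poly (smult c)) (hat2 \<alpha> \<nu>)"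
    unfolding hat_id by (rule linear_form_hat[OF linear_form_poly]) simp
  show "hat2 \<alpha> \<nu> (p + q) = hat2 \<alpha> \<nu> p + hat2 \<alpha> \<nu> q" "hat2 \<alpha> \<nu> (- p) = - hat2 \<alpha> \<nu> p"
    "hat2 \<alpha> \<nu> (p - q) = hat2 \<alpha> \<nu> p - hat2 \<alpha> \<nu> q"
    using linear_form_simps[OF *] by auto
  have "smult r p = map_poly ((*) r) p" by (intro poly_eqI) (simp add: coeff_map_poly)
  then show "hat2 \<alpha> \<nu> (smult r p) = poly r \<nu> * hat2 \<alpha> \<nu> p"
    by (simp only: hat_id, subst hat_eigen) auto
qed

lemma hat2_eqI:
  fixes p q :: "'k::field_char_0 poly poly"
  assumes "\<And>\<alpha> \<nu>. hat2 \<alpha> \<nu> p = hat2 \<alpha> \<nu> q"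
  shows "p = q"
proof (rule poly_eqI_forms[where W = UNIV and \<Psi> = "range (\<lambda>\<nu> p. poly p \<nu>)" and sc = smult])
  show "x = 0" if "\<And>\<psi>. \<psi> \<in> range (\<lambda>\<nu> p. poly p \<nu>) \<Longrightarrow> \<psi> x = 0" for x :: "'k poly"
    using that by (auto simp: poly_all_0_iff_0[symmetric])
qed (use assms in \<open>auto simp: linear_form_poly hat_id\<close>)

lemma hat2_subst_lam: "hat2 \<alpha> \<nu> (subst lam const2 q) = poly q \<alpha>"
  by (subst hat2_subst[where sc = "(*)" and t = \<alpha>])
    (auto simp: linear_form_def hat2_lam hat2_const, simp add: hat_id)

lemma hat2_subst_mu_lam: "hat2 \<alpha> \<nu> (subst (\<lambda>q. mu q - lam q) const2 q) = poly q (\<nu> - \<alpha>)"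
  by (subst hat2_subst[where sc = "(*)" and t = "\<nu> - \<alpha>"])
    (auto simp: linear_form_def hat2_lam hat2_mu hat2_const hat2_linear left_diff_distrib, simp add: hat_id)

lemma hat2_subst_mu: "hat2 \<alpha> \<nu> (subst mu const2 q) = poly q \<nu>"
  by (subst hat2_subst[where sc = "(*)" and t = \<nu>])
    (auto simp: linear_form_def hat2_mu hat2_const, simp add: hat_id)

context finite_free_module
begin

abbreviation "Pd \<equiv> conf_dual s UNIV"

text \<open>
  The dual basis of \<open>B\<close>.
\<close>

definition coord :: "'p \<Rightarrow> 'p \<Rightarrow> 'k poly" where
  "coord b v = representation B v b"

lemma mods: "module s" "module.subspace s UNIV"
  by (simp_all add: module_axioms)

lemma sum_coord: "(\<Sum>b\<in>B. s (coord b v) b) = v"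
  unfolding coord_def
  by (rule sum_representation_eq) (auto simp: independent_basis finite_basis span_basis)

lemma coord_simps: "coord b (u + v) = coord b u + coord b v" "coord b (s r v) = r * coord b v"
  by (simp_all add: coord_def representation_add representation_scale independent_basis span_basis)

lemma coord_mem: "coord b \<in> Pd"
  by (simp add: mem_conf_dual_iff coord_simps kscale_def der_def)

lemma dual_scale_apply: "f \<in> Pd \<Longrightarrow> f (s r u) = r * f u"
  by (rule conf_dual_scale[OF mods]) auto

lemma dual_add: "f \<in> Pd \<Longrightarrow> f (u + v) = f u + f v"
  by (simp add: mem_conf_dual_iff)

lemma dual_sum: "f \<in> Pd \<Longrightarrow> f (sum g A) = (\<Sum>i\<in>A. f (g i))"
  using dual_scale_apply[of f 0 0]
  by (induction A rule: infinite_finite_induct) (auto simp: dual_add)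

lemma dual_expand: "f \<in> Pd \<Longrightarrow> f v = (\<Sum>b\<in>B. coord b v * f b)"
  using dual_sum[of f "\<lambda>b. s (coord b v) b" B] by (simp add: sum_coord dual_scale_apply)

lemma dual_form: "f \<in> Pd \<Longrightarrow> momentum_form s \<nu> (pv f \<nu>)"
  by (simp add: momentum_form_def linear_form_def mem_conf_dual_iff)

lemma dual_form_linear: "f \<in> Pd \<Longrightarrow> linear_form (kscale s) (pv f \<nu>)"
  using dual_form by (simp add: momentum_form_def)

lemma dual_separates:
  assumes "\<And>f \<nu>. f \<in> Pd \<Longrightarrow> pv f \<nu> x = 0"
  shows "x = 0"
proof -
  have "coord b x = 0" for b
    using assms[OF coord_mem] by (simp add: poly_all_0_iff_0[symmetric])
  then show ?thesis using sum_coord[of x] by simp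
qed

lemma dual_eqI: "(\<And>f \<nu>. f \<in> Pd \<Longrightarrow> pv f \<nu> x = pv f \<nu> y) \<Longrightarrow> x = y"
  using dual_separates[of "x - y"] linear_form_diff[OF dual_form_linear] by (metis diff_self eq_iff_diff_eq_0)

lemma dual_span:
  assumes "f \<in> Pd"
  shows "f = (\<Sum>b\<in>B. dual_scale (neg_var (f b)) (coord b))"
proof
  fix v
  have "(\<Sum>b\<in>A. dual_scale (neg_var (f b)) (g b)) v = (\<Sum>b\<in>A. f b * g b v)" for A and g :: "'p \<Rightarrow> 'p \<Rightarrow> 'k poly"
    by (induction A rule: infinite_finite_induct) (auto simp: dual_scale_def neg_var_simps)
  then show "f v = (\<Sum>b\<in>B. dual_scale (neg_var (f b)) (coord b)) v"
    using dual_expand[OF assms, of v] by (simp add: mult.commute)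
qed

lemma fg_module_dual: "fg_module dual_scale Pd"
proof -
  interpret D: module "dual_scale :: 'k poly \<Rightarrow> ('p \<Rightarrow> 'k poly) \<Rightarrow> _" by (rule module_dual_scale)
  have "D.span (coord ` B) \<subseteq> Pd"
    by (rule D.span_minimal) (auto simp: coord_mem subspace_conf_dual module_axioms)
  moreover have "f \<in> D.span (coord ` B)" if "f \<in> Pd" for f
    by (subst dual_span[OF that]) (auto intro!: D.span_sum D.span_scale intro: D.span_base)
  ultimately show ?thesis
    unfolding fg_module_def
    by (auto simp: module_dual_scale subspace_conf_dual module_axioms finite_basis
        intro!: exI[of _ "coord ` B"])
qed

lemma fg_module_self: "fg_module s UNIV"
  unfolding fg_module_def using module_axioms finite_basis span_basis by auto

subsection \<open>Polynomials with values in the conformal dual\<close>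

text \<open>
  The polynomial \<open>dual_poly UNIV F\<close> has the expected coefficients only if the degrees
  in \<open>\<lambda>\<close> are bounded. They are: since \<open>\<partial>\<close> acts on the
  values of \<open>F\<close> as \<open>\<mu>\<close>, the map \<open>F\<close> is
  \<open>k[\<partial>]\<close>-linear, and the degree of \<open>F v\<close> is at most the largest
  degree of \<open>F\<close> on the finite basis. Linearity of \<open>F\<close> is read off from
  its values \<open>G\<close> at scalars.
\<close>

lemma dual_poly:
  fixes F :: "'p \<Rightarrow> 'k poly poly"
  assumes G: "\<And>v \<alpha> \<nu>. hat2 \<alpha> \<nu> (F v) = G v \<alpha> \<nu>"
    and lin: "\<And>u v \<alpha> \<nu>. G (u + v) \<alpha> \<nu> = G u \<alpha> \<nu> + G v \<alpha> \<nu>" "\<And>c v \<alpha> \<nu>. G (kscale s c v) \<alpha> \<nu> = c * G v \<alpha> \<nu>"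
      "\<And>v \<alpha> \<nu>. G (der s v) \<alpha> \<nu> = \<nu> * G v \<alpha> \<nu>"
  shows "coeff (dual_poly UNIV F) n \<in> Pd"
    and "pv (evs dual_scale \<alpha> (dual_poly UNIV F)) \<nu> v = G v \<alpha> \<nu>"
proof -
  have add: "F (u + v) = F u + F v" for u v
    by (rule hat2_eqI) (simp add: G lin hat2_linear)
  have sc: "F (kscale s c v) = smult [:c:] (F v)" for c v
    by (rule hat2_eqI) (simp add: G lin hat2_linear)
  have der: "F (der s v) = smult [:0, 1:] (F v)" for v
    by (rule hat2_eqI) (simp add: G lin hat2_linear)
  have F0: "F 0 = 0" using add[of 0 0] by simp
  have mult: "F (s r v) = smult r (F v)" for r v
  proof (induction r)
    case (pCons c r)
    have "s (pCons c r) v = s ([:c:] + [:0, 1:] * r) v" by simp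
    also have "\<dots> = kscale s c v + der s (s r v)"
      by (simp only: scale_left_distrib kscale_def der_def scale_scale)
    finally have "F (s (pCons c r) v) = smult [:c:] (F v) + smult [:0, 1:] (smult r (F v))"
      by (simp only: add sc der pCons)
    also have "\<dots> = smult ([:c:] + [:0, 1:] * r) (F v)"
      by (simp only: smult_add_left smult_smult)
    finally show ?case by simp
  qed (simp add: F0)
  have Fsum: "F (sum g A) = (\<Sum>i\<in>A. F (g i))" for g and A :: "'p set"
    by (induction A rule: infinite_finite_induct) (auto simp: F0 add)
  have expand: "F v = (\<Sum>b\<in>B. smult (coord b v) (F b))" for v
    using Fsum[of "\<lambda>b. s (coord b v) b" B] by (simp add: sum_coord mult)
  define N where "N = Max (insert 0 ((\<lambda>b. degree (F b)) ` B))"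
  have deg: "degree (F b) \<le> N" if "b \<in> B" for b
    unfolding N_def using that finite_basis by (intro Max_ge) auto
  have "coeff (F v) n = 0" if "n > N" for n v
  proof -
    have "coeff (F b) n = 0" if "b \<in> B" for b
      using deg[OF that] \<open>n > N\<close> by (intro coeff_eq_0) simp
    then show ?thesis by (subst expand) (simp add: coeff_sum)
  qed
  then have coeff: "coeff (dual_poly UNIV F) = (\<lambda>n v. coeff (F v) n)"
    unfolding dual_poly_def by (subst coeff_Abs_poly[of N]) (auto simp: fun_eq_iff)
  show "coeff (dual_poly UNIV F) n \<in> Pd"
    by (simp add: mem_conf_dual_iff coeff add sc der)
  have "map_poly (\<lambda>f. pv f \<nu> v) (dual_poly UNIV F) = map_poly (hat (\<lambda>x. x) \<nu>) (F v)"
    by (rule poly_eqI) (simp add: coeff_map_poly coeff hat_id)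
  then have "hat (\<lambda>f. pv f \<nu> v) \<alpha> (dual_poly UNIV F) = G v \<alpha> \<nu>"
    by (simp add: hat_def[of _ \<alpha>] G[symmetric])
  then show "pv (evs dual_scale \<alpha> (dual_poly UNIV F)) \<nu> v = G v \<alpha> \<nu>"
    using dual_momentum_form[of \<nu> v] linear_form_ev[of "kscale dual_scale" "\<lambda>f. pv f \<nu> v"]
    by (simp add: momentum_form_def)
qed

lemma dual_rep_at:
  assumes \<phi>: "gc_hom s UNIV s UNIV \<phi>" and f: "f \<in> Pd"
  shows "coeff (dual_rep UNIV \<phi> a f) n \<in> Pd"
    and "pv (evs dual_scale \<alpha> (dual_rep UNIV \<phi> a f)) \<nu> v = - pv f (\<nu> - \<alpha>) (evs s \<alpha> (\<phi> a v))"
proof -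
  note gc = gc_homD[OF mods \<phi> UNIV_I UNIV_I UNIV_I UNIV_I]
  let ?F = "\<lambda>v. - subst lam (\<lambda>w. subst (\<lambda>q. mu q - lam q) const2 (f w)) (\<phi> a v)"
  let ?G = "\<lambda>v \<alpha> \<nu>. - pv f (\<nu> - \<alpha>) (evs s \<alpha> (\<phi> a v))"
  have f0: "f 0 = 0" using dual_add[OF f, of 0 0] by simp
  have G: "hat2 \<alpha> \<nu> (?F v) = ?G v \<alpha> \<nu>" for v \<alpha> \<nu>
    using linear_form_ev[OF dual_form_linear[OF f]]
    by (subst hat2_linear, subst hat2_subst[where sc = "(*)" and t = \<alpha>])
      (auto simp: hat2_subst_mu_lam linear_form_def hat2_lam f0)
  have f_ev: "pv f \<kappa> (x + y) = pv f \<kappa> x + pv f \<kappa> y" "pv f \<kappa> (kscale s c x) = c * pv f \<kappa> x"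
    "pv f \<kappa> (der s x) = \<kappa> * pv f \<kappa> x" for \<kappa> c x y
    using dual_form[OF f, of \<kappa>] by (simp_all add: momentum_form_def linear_form_def)
  have "coeff (dual_poly UNIV ?F) n \<in> Pd"
    by (rule dual_poly(1)[of ?F ?G]) (use G in \<open>auto simp: gc f_ev algebra_simps\<close>)
  moreover have "pv (evs dual_scale \<alpha> (dual_poly UNIV ?F)) \<nu> v = ?G v \<alpha> \<nu>"
    by (rule dual_poly(2)[of ?F ?G]) (use G in \<open>auto simp: gc f_ev algebra_simps\<close>)
  ultimately show "coeff (dual_rep UNIV \<phi> a f) n \<in> Pd"
    "pv (evs dual_scale \<alpha> (dual_rep UNIV \<phi> a f)) \<nu> v = - pv f (\<nu> - \<alpha>) (evs s \<alpha> (\<phi> a v))"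
    by (simp_all add: dual_rep_def)
qed

end

section \<open>Tensors as functionals\<close>

lemma vector_space_tensor_scale: "vector_space (tensor_scale :: 'k::field \<Rightarrow> ('u, 'v, 'k) tensor \<Rightarrow> _)"
  by unfold_locales (auto simp: tensor_scale_def fun_eq_iff algebra_simps)

lemma linear_form_apply: "linear_form tensor_scale (\<lambda>t. t C)"
  by (simp add: linear_form_def tensor_scale_def)

lemma tensor_bilinear: "bilinear_on sU U sV V tensor_scale (tensor sU U sV V)"
  unfolding bilinear_on_def tensor_scale_def tensor_def fun_eq_iff by simp

lemma bilinear_on_form:
  "bilinear_on sU U sV V sW F \<Longrightarrow> linear_form sW \<psi> \<Longrightarrow> bilinear_on sU U sV V (*) (\<lambda>u v. \<psi> (F u v))"
  by (simp add: bilinear_on_def linear_form_def)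

lemma tensor_sum_apply:
  assumes "bilinear_on sU U sV V (*) C"
  shows "(\<Sum>(u, v)\<leftarrow>xs. tensor sU U sV V u v) C = (\<Sum>(u, v)\<leftarrow>xs. C u v)"
  using assms by (induction xs) (auto simp: tensor_def)

text \<open>
  A tensor is a functional on bilinear forms, so a linear form on a lifted map is the tensor
  evaluated at a bilinear form. Operators on tensors can thus be computed without choosing
  expressions \<open>\<Sum>i. u\<^sub>i \<otimes> v\<^sub>i\<close>.
\<close>

lemma tensor_lift_form:
  fixes sU :: "'k::field \<Rightarrow> 'u::ab_group_add \<Rightarrow> 'u" and sV :: "'k \<Rightarrow> 'v::ab_group_add \<Rightarrow> 'v"
  assumes U: "\<And>c u. u \<in> U \<Longrightarrow> sU c u \<in> U" and t: "t \<in> tensor_space sU U sV V"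
    and W: "vector_space sW" and F: "bilinear_on sU U sV V sW F" and \<psi>: "linear_form sW \<psi>"
  shows "\<psi> (tensor_lift sU U sV V F t) = t (\<lambda>u v. \<psi> (F u v))"
proof -
  obtain xs where xs: "set xs \<subseteq> U \<times> V" "t = (\<Sum>(u, v)\<leftarrow>xs. tensor sU U sV V u v)"
    by (rule tensor_space_sums[OF U t])
  have "\<psi> (\<Sum>(u, v)\<leftarrow>xs. F u v) = (\<Sum>(u, v)\<leftarrow>xs. \<psi> (F u v))"
    by (induction xs) (auto simp: linear_form_0[OF \<psi>] linear_form_add[OF \<psi>])
  then show ?thesis
    unfolding xs(2) tensor_lift_sum_list[OF W F xs(1)] tensor_sum_apply[OF bilinear_on_form[OF F \<psi>]] .
qed

lemma tensor_lift_mem: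
  fixes sU :: "'k::field \<Rightarrow> 'u::ab_group_add \<Rightarrow> 'u" and sV :: "'k \<Rightarrow> 'v::ab_group_add \<Rightarrow> 'v"
  assumes U: "\<And>c u. u \<in> U \<Longrightarrow> sU c u \<in> U" and t: "t \<in> tensor_space sU U sV V"
    and W: "vector_space sW" and F: "bilinear_on sU U sV V sW F"
    and S: "0 \<in> S" "\<And>x y. x \<in> S \<Longrightarrow> y \<in> S \<Longrightarrow> x + y \<in> S" "\<And>u v. u \<in> U \<Longrightarrow> v \<in> V \<Longrightarrow> F u v \<in> S"
  shows "tensor_lift sU U sV V F t \<in> S"
proof -
  obtain xs where xs: "set xs \<subseteq> U \<times> V" "t = (\<Sum>(u, v)\<leftarrow>xs. tensor sU U sV V u v)"
    by (rule tensor_space_sums[OF U t])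
  have "(\<Sum>(u, v)\<leftarrow>xs. F u v) \<in> S"
    using xs(1) by (induction xs) (auto intro: S)
  then show ?thesis
    unfolding xs(2) tensor_lift_sum_list[OF W F xs(1)] .
qed

lemma tensor_arg_linear:
  fixes sU :: "'k::field \<Rightarrow> 'u::ab_group_add \<Rightarrow> 'u" and sV :: "'k \<Rightarrow> 'v::ab_group_add \<Rightarrow> 'v"
  assumes U: "\<And>c u. u \<in> U \<Longrightarrow> sU c u \<in> U" and t: "t \<in> tensor_space sU U sV V"
    and C: "bilinear_on sU U sV V (*) C" "bilinear_on sU U sV V (*) C'"
  shows "t (\<lambda>u v. C u v + C' u v) = t C + t C'" "t (\<lambda>u v. c * C u v) = c * t C"
proof -
  obtain xs where xs: "set xs \<subseteq> U \<times> V" "t = (\<Sum>(u, v)\<leftarrow>xs. tensor sU U sV V u v)"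
    by (rule tensor_space_sums[OF U t])
  have "bilinear_on sU U sV V (*) (\<lambda>u v. C u v + C' u v)" "bilinear_on sU U sV V (*) (\<lambda>u v. c * C u v)"
    using C by (auto simp: bilinear_on_def algebra_simps)
  note * = this[THEN tensor_sum_apply] C[THEN tensor_sum_apply]
  have "(\<Sum>(u, v)\<leftarrow>xs. C u v + C' u v) = (\<Sum>(u, v)\<leftarrow>xs. C u v) + (\<Sum>(u, v)\<leftarrow>xs. C' u v)"
    "(\<Sum>(u, v)\<leftarrow>xs. c * C u v) = c * (\<Sum>(u, v)\<leftarrow>xs. C u v)"
    by (induction xs) (auto simp: algebra_simps)
  then show "t (\<lambda>u v. C u v + C' u v) = t C + t C'" "t (\<lambda>u v. c * C u v) = c * t C"
    unfolding xs(2) * by auto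
qed

context finite_free_module
begin

sublocale K: vector_space "kscale s"
  by (rule vector_space_kscale) (rule module_axioms)

abbreviation "S2 \<equiv> space2 s (UNIV :: 'p set)"
abbreviation "bil \<equiv> bilinear_on (kscale s) UNIV (kscale s) UNIV"

text \<open>
  The functional \<open>f\<^sub>\<alpha> \<otimes> g\<^sub>\<beta>\<close> on \<open>P \<otimes>
  P\<close>.
\<close>

abbreviation pair :: "('p \<Rightarrow> 'k poly) \<Rightarrow> 'k \<Rightarrow> ('p \<Rightarrow> 'k poly) \<Rightarrow> 'k \<Rightarrow> ('p, 'k) tensor2 \<Rightarrow> 'k" where
  "pair f \<alpha> g \<beta> t \<equiv> t (\<lambda>x y. pv f \<alpha> x * pv g \<beta> y)"

lemma bil_prod: "linear_form (kscale s) \<phi> \<Longrightarrow> linear_form (kscale s) \<chi> \<Longrightarrow> bil (*) (\<lambda>x y. \<phi> x * \<chi> y)"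
  by (simp add: bilinear_on_def linear_form_def algebra_simps)

lemma bil_pair: "f \<in> Pd \<Longrightarrow> g \<in> Pd \<Longrightarrow> bil (*) (\<lambda>x y. pv f \<alpha> x * pv g \<beta> y)"
  by (rule bil_prod) (auto intro: dual_form_linear)

lemma tens2_apply: "bil (*) C \<Longrightarrow> tens2 s UNIV u v C = C u v"
  by (simp add: tens2_def tensor_def)

lemma tens2_mem: "tens2 s UNIV u v \<in> S2"
proof -
  interpret T: module "tensor_scale :: 'k \<Rightarrow> ('p, 'k) tensor2 \<Rightarrow> _"
    by unfold_locales (auto simp: tensor_scale_def fun_eq_iff algebra_simps)
  show ?thesis unfolding tens2_def space2_def tensor_space_def by (rule T.span_base) blast
qed

lemma kspace_S2: "kspace tensor_scale S2"
proof -
  interpret T: module "tensor_scale :: 'k \<Rightarrow> ('p, 'k) tensor2 \<Rightarrow> _"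
    by unfold_locales (auto simp: tensor_scale_def fun_eq_iff algebra_simps)
  show ?thesis
    unfolding kspace_def space2_def tensor_space_def
    by (auto intro: T.span_zero T.span_add T.span_scale)
qed

lemma S2_closed: "0 \<in> S2" "x \<in> S2 \<Longrightarrow> y \<in> S2 \<Longrightarrow> x + y \<in> S2" "x \<in> S2 \<Longrightarrow> y \<in> S2 \<Longrightarrow> x - y \<in> S2"
  "x \<in> S2 \<Longrightarrow> tensor_scale c x \<in> S2"
  using kspace_S2 kspace_diff[OF vector_space_tensor_scale kspace_S2] by (auto simp: kspace_def)

lemma tens2_linear:
  "tens2 s UNIV (u + u') v = tens2 s UNIV u v + tens2 s UNIV u' v"
  "tens2 s UNIV u (v + v') = tens2 s UNIV u v + tens2 s UNIV u v'"
  "tens2 s UNIV (kscale s c u) v = tensor_scale c (tens2 s UNIV u v)"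
  "tens2 s UNIV u (kscale s c v) = tensor_scale c (tens2 s UNIV u v)"
  using tensor_bilinear[of "kscale s" UNIV "kscale s" UNIV]
  unfolding bilinear_on_def tens2_def by auto

lemma tens2_0: "tens2 s UNIV 0 v = 0" "tens2 s UNIV u 0 = 0"
  using tens2_linear(1)[of 0 0 v] tens2_linear(2)[of u 0 0] by auto

lemma lift2_form:
  assumes "t \<in> S2" "vector_space sW" "bil sW F" "linear_form sW \<psi>"
  shows "\<psi> (lift2 s UNIV F t) = t (\<lambda>u v. \<psi> (F u v))"
  unfolding lift2_def by (rule tensor_lift_form) (use assms in \<open>auto simp: space2_def\<close>)

lemma lift2_mem:
  assumes "t \<in> S2" "vector_space sW" "bil sW F" "0 \<in> S" "\<And>x y. x \<in> S \<Longrightarrow> y \<in> S \<Longrightarrow> x + y \<in> S"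
    "\<And>u v. F u v \<in> S"
  shows "lift2 s UNIV F t \<in> S"
  unfolding lift2_def by (rule tensor_lift_mem) (use assms in \<open>auto simp: space2_def\<close>)

lemma S2_arg_add:
  "t \<in> S2 \<Longrightarrow> bil (*) C \<Longrightarrow> bil (*) C' \<Longrightarrow> t (\<lambda>u v. C u v + C' u v) = t C + t C'"
  using tensor_arg_linear(1)[of UNIV "kscale s" t "kscale s" UNIV C C'] by (auto simp: space2_def)

lemma S2_arg_scale: "t \<in> S2 \<Longrightarrow> bil (*) C \<Longrightarrow> t (\<lambda>u v. c * C u v) = c * t C"
  using tensor_arg_linear(2)[of UNIV "kscale s" t "kscale s" UNIV C C c] by (auto simp: space2_def)

text \<open>
  Contracting one factor of \<open>t\<close> with \<open>g\<^sub>\<beta>\<close> gives a vector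
  that is killed by the dual, hence zero. So \<open>t\<close> vanishes on \<open>\<phi> \<otimes>
  g\<^sub>\<beta>\<close> for every \<open>k\<close>-linear form \<open>\<phi>\<close>, and
  contracting the other factor with \<open>\<phi>\<close> gives zero as well. Coordinates for a
  \<open>k\<close>-basis of \<open>P\<close> are such forms, and expanding the first factors in
  this basis shows that \<open>t\<close> vanishes on all bilinear forms.
\<close>

lemma S2_separates:
  assumes t: "t \<in> S2" and 0: "\<And>f \<alpha> g \<beta>. f \<in> Pd \<Longrightarrow> g \<in> Pd \<Longrightarrow> pair f \<alpha> g \<beta> t = 0"
  shows "t = 0"
proof
  fix C
  obtain xs where xs: "t = (\<Sum>(u, v)\<leftarrow>xs. tens2 s UNIV u v)"
    using tensor_space_sums[of UNIV "kscale s" t "kscale s" UNIV] t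
    unfolding space2_def tens2_def by auto
  have t_apply: "t C = (\<Sum>(u, v)\<leftarrow>xs. C u v)" if "bil (*) C" for C
    unfolding xs tens2_def by (rule tensor_sum_apply[OF that])
  show "t C = 0 C"
  proof (cases "bil (*) C")
    case False
    have "(\<Sum>(u, v)\<leftarrow>xs. tens2 s UNIV u v) C = 0"
      using False by (induction xs) (auto simp: tens2_def tensor_def)
    then show ?thesis by (simp add: xs)
  next
    case True
    have form_sum: "\<psi> (\<Sum>(u, v)\<leftarrow>xs. kscale s (a u v) (w u v)) = (\<Sum>(u, v)\<leftarrow>xs. a u v * \<psi> (w u v))"
      if \<psi>: "linear_form (kscale s) \<psi>" for \<psi> a w
      by (induction xs) (auto simp: linear_form_0[OF \<psi>] linear_form_add[OF \<psi>] linear_form_scale[OF \<psi>])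
    have left: "(\<Sum>(u, v)\<leftarrow>xs. kscale s (pv g \<beta> v) u) = 0" if g: "g \<in> Pd" for g \<beta>
    proof (rule dual_separates)
      fix f \<nu> assume f: "f \<in> Pd"
      show "pv f \<nu> (\<Sum>(u, v)\<leftarrow>xs. kscale s (pv g \<beta> v) u) = 0"
        using 0[OF f g, of \<nu> \<beta>] t_apply[OF bil_pair[OF f g]]
        by (simp add: form_sum[OF dual_form_linear[OF f]] mult.commute)
    qed
    have right: "(\<Sum>(u, v)\<leftarrow>xs. kscale s (\<phi> u) v) = 0" if \<phi>: "linear_form (kscale s) \<phi>" for \<phi>
    proof (rule dual_separates)
      fix g \<beta> assume g: "g \<in> Pd"
      show "pv g \<beta> (\<Sum>(u, v)\<leftarrow>xs. kscale s (\<phi> u) v) = 0"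
        using form_sum[OF \<phi>, of "\<lambda>u v. pv g \<beta> v" "\<lambda>u v. u"] left[OF g]
        by (simp add: form_sum[OF dual_form_linear[OF g]] linear_form_0[OF \<phi>] mult.commute)
    qed
    \<comment> \<open>a basis of \<open>P\<close> over \<open>k\<close>, with coordinate forms \<open>r e\<close>\<close>
    define E where "E = K.extend_basis {}"
    have E: "K.independent E" "K.span E = UNIV"
      unfolding E_def using K.independent_extend_basis[OF K.independent_empty]
        K.span_extend_basis[OF K.independent_empty] by simp_all
    define r where "r e u = K.representation E u e" for e u
    have r: "linear_form (kscale s) (r e)" for e
      using E by (simp add: linear_form_def r_def K.representation_add K.representation_scale)
    define J where "J = (\<Union>(u, v)\<in>set xs. {e. r e u \<noteq> 0})"
    have J: "finite J" by (auto simp: J_def r_def K.finite_representation)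
    have "C u v = (\<Sum>e\<in>J. C e (kscale s (r e u) v))" if "(u, v) \<in> set xs" for u v
    proof -
      have sub: "{e. r e u \<noteq> 0} \<subseteq> J" using that by (auto simp: J_def)
      have "u = (\<Sum>e | r e u \<noteq> 0. kscale s (r e u) e)"
        unfolding r_def using E K.sum_nonzero_representation_eq[of E u] by simp
      also have "\<dots> = (\<Sum>e\<in>J. kscale s (r e u) e)"
        by (rule sum.mono_neutral_left) (use J sub in auto)
      finally have u: "u = (\<Sum>e\<in>J. kscale s (r e u) e)" .
      have C0: "C 0 v = 0" using True unfolding bilinear_on_def by (metis UNIV_I add_cancel_left_left)
      have "C (sum g J) v = (\<Sum>e\<in>J. C (g e) v)" for g
        using True by (induction J rule: infinite_finite_induct) (auto simp: C0 bilinear_on_def)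
      then have "C u v = (\<Sum>e\<in>J. C (kscale s (r e u) e) v)"
        by (subst u)
      also have "\<dots> = (\<Sum>e\<in>J. C e (kscale s (r e u) v))"
        using True by (simp add: bilinear_on_def)
      finally show ?thesis .
    qed
    then have "t C = (\<Sum>(u, v)\<leftarrow>xs. \<Sum>e\<in>J. C e (kscale s (r e u) v))"
      unfolding t_apply[OF True] by (intro arg_cong[of _ _ sum_list] map_cong) auto
    also have "\<dots> = (\<Sum>e\<in>J. \<Sum>(u, v)\<leftarrow>xs. C e (kscale s (r e u) v))"
      by (induction xs) (auto simp: sum.distrib)
    also have "\<dots> = (\<Sum>e\<in>J. C e (\<Sum>(u, v)\<leftarrow>xs. kscale s (r e u) v))"
    proof (rule sum.cong[OF refl])
      fix e
      have C0: "C e 0 = 0" using True unfolding bilinear_on_def by (metis UNIV_I add_cancel_left_left)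
      show "(\<Sum>(u, v)\<leftarrow>xs. C e (kscale s (r e u) v)) = C e (\<Sum>(u, v)\<leftarrow>xs. kscale s (r e u) v)"
        using True by (induction xs) (auto simp: C0 bilinear_on_def)
    qed
    also have "\<dots> = 0"
    proof -
      have "C e 0 = 0" for e using True unfolding bilinear_on_def by (metis UNIV_I add_cancel_left_left)
      then show ?thesis by (simp add: right[OF r])
    qed
    finally show ?thesis by simp
  qed
qed

subsection \<open>The operators on \<open>P \<otimes> P\<close>\<close>

lemma flip_tensor_apply:
  assumes "t \<in> S2" "bil (*) C"
  shows "flip_tensor s UNIV t C = t (\<lambda>u v. C v u)"
proof -
  have "bil tensor_scale (\<lambda>u v. tens2 s UNIV v u)"
    by (simp add: bilinear_on_def tens2_linear)
  from lift2_form[OF assms(1) vector_space_tensor_scale this linear_form_apply[of C]]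
  show ?thesis using assms by (simp add: flip_tensor_def tens2_apply)
qed

lemma flip_tensor_mem: "t \<in> S2 \<Longrightarrow> flip_tensor s UNIV t \<in> S2"
  unfolding flip_tensor_def
  by (rule lift2_mem[OF _ vector_space_tensor_scale])
    (auto simp: bilinear_on_def tens2_linear tens2_mem S2_closed)

lemma bil_der2: "bil tensor_scale (\<lambda>u v. tens2 s UNIV (der s u) v + tens2 s UNIV u (der s v))"
  by (simp add: bilinear_on_def tens2_linear der_add der_kscale module_axioms tensor_scale_def
      fun_eq_iff algebra_simps)

lemma der2_mem: "t \<in> S2 \<Longrightarrow> der2 s UNIV t \<in> S2"
  unfolding der2_def
  by (rule lift2_mem[OF _ vector_space_tensor_scale bil_der2]) (auto simp: tens2_mem S2_closed)

lemma pair_der2: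
  assumes t: "t \<in> S2" and f: "f \<in> Pd" and g: "g \<in> Pd"
  shows "pair f \<alpha> g \<beta> (der2 s UNIV t) = (\<alpha> + \<beta>) * pair f \<alpha> g \<beta> t"
proof -
  have "pv f \<alpha> (der s u) * pv g \<beta> v + pv f \<alpha> u * pv g \<beta> (der s v) = (\<alpha> + \<beta>) * (pv f \<alpha> u * pv g \<beta> v)" for u v
    using dual_form[OF f] dual_form[OF g] by (simp add: momentum_form_def algebra_simps)
  then have "pair f \<alpha> g \<beta> (der2 s UNIV t) = t (\<lambda>u v. (\<alpha> + \<beta>) * (pv f \<alpha> u * pv g \<beta> v))"
    using lift2_form[OF t vector_space_tensor_scale bil_der2 linear_form_apply[of "\<lambda>x y. pv f \<alpha> x * pv g \<beta> y"]]
    by (simp add: der2_def tens2_apply bil_pair f g)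
  then show ?thesis by (simp add: S2_arg_scale[OF t] bil_pair f g)
qed

lemma der2_0: "der2 s UNIV 0 = 0"
proof (rule S2_separates)
  show "der2 s UNIV 0 \<in> S2" by (simp add: der2_mem S2_closed)
qed (simp add: pair_der2 S2_closed)

lemma poly_S2_eqI:
  fixes p q :: "('p, 'k) tensor2 poly"
  assumes "\<And>n. coeff p n \<in> S2" "\<And>n. coeff q n \<in> S2"
    "\<And>f \<gamma> g \<delta> \<alpha>. f \<in> Pd \<Longrightarrow> g \<in> Pd \<Longrightarrow> hat (pair f \<gamma> g \<delta>) \<alpha> p = hat (pair f \<gamma> g \<delta>) \<alpha> q"
  shows "p = q"
proof (rule poly_eqI_forms[where W = S2 and sc = tensor_scale
      and \<Psi> = "{pair f \<gamma> g \<delta> |f \<gamma> g \<delta>. f \<in> Pd \<and> g \<in> Pd}"])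
  fix x assume "x \<in> S2" and 0: "\<And>\<psi>. \<psi> \<in> {pair f \<gamma> g \<delta> |f \<gamma> g \<delta>. f \<in> Pd \<and> g \<in> Pd} \<Longrightarrow> \<psi> x = 0"
  show "x = 0"
    by (rule S2_separates[OF \<open>x \<in> S2\<close>]) (use 0 in blast)
qed (use assms in \<open>auto simp: S2_closed linear_form_apply\<close>)

end

lemma hat_cong:
  assumes "\<psi> 0 = 0" "\<psi>' 0 = 0" "\<And>n. \<psi> (coeff p n) = \<psi>' (coeff p n)"
  shows "hat \<psi> c p = hat \<psi>' c p"
proof -
  have "map_poly \<psi> p = map_poly \<psi>' p" by (rule poly_eqI) (simp add: assms coeff_map_poly)
  then show ?thesis by (simp add: hat_def)
qed

lemma hat2_conv_poly: "hat2 \<alpha> \<nu> p = poly (poly p [:\<alpha>:]) \<nu>"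
proof (induction p)
  case (pCons a p)
  then show ?case by (simp add: hat_id hat_def map_poly_pCons)
qed simp

context finite_free_module
begin

abbreviation k_linear :: "('p \<Rightarrow> 'p poly) \<Rightarrow> bool" where
  "k_linear T \<equiv> (\<forall>u v. T (u + v) = T u + T v) \<and> (\<forall>c u. T (kscale s c u) = map_poly (kscale s c) (T u))"

lemma form_at:
  assumes T: "k_linear T" and \<phi>: "linear_form (kscale s) \<phi>"
  shows "linear_form (kscale s) (\<lambda>u. \<phi> (evs s c (T u)))"
  using T by (simp add: linear_form_def[of _ "\<lambda>u. _ u"] K.ev_add K.ev_scale linear_form_add[OF \<phi>]
      linear_form_scale[OF \<phi>])

text \<open>
  The bilinearity that is required for lifting \<open>F\<close> is checked through the separating
  functionals, where it is the bilinearity of \<open>H\<close>.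
\<close>

lemma lift2_poly:
  fixes F :: "'p \<Rightarrow> 'p \<Rightarrow> ('p, 'k) tensor2 poly"
  assumes t: "t \<in> S2" and mem: "\<And>u v n. coeff (F u v) n \<in> S2"
    and H: "\<And>f \<gamma> g \<delta> \<alpha> u v. f \<in> Pd \<Longrightarrow> g \<in> Pd \<Longrightarrow> hat (pair f \<gamma> g \<delta>) \<alpha> (F u v) = H f \<gamma> g \<delta> \<alpha> u v"
    and bil: "\<And>f \<gamma> g \<delta> \<alpha>. f \<in> Pd \<Longrightarrow> g \<in> Pd \<Longrightarrow> bil (*) (H f \<gamma> g \<delta> \<alpha>)"
  shows "coeff (lift2 s UNIV F t) n \<in> S2"
    and "f \<in> Pd \<Longrightarrow> g \<in> Pd \<Longrightarrow> hat (pair f \<gamma> g \<delta>) \<alpha> (lift2 s UNIV F t) = t (H f \<gamma> g \<delta> \<alpha>)"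
proof -
  interpret T: vector_space "tensor_scale :: 'k \<Rightarrow> ('p, 'k) tensor2 \<Rightarrow> _" by (rule vector_space_tensor_scale)
  let ?sW = "\<lambda>c::'k. map_poly (tensor_scale c :: ('p, 'k) tensor2 \<Rightarrow> _)"
  have W: "vector_space ?sW" by (rule vector_space_poly[OF vector_space_tensor_scale])
  have form: "linear_form ?sW (hat (pair f \<gamma> g \<delta>) \<alpha>)" for f g :: "'p \<Rightarrow> 'k poly" and \<gamma> \<delta> \<alpha>
    by (rule linear_form_hat[OF linear_form_apply]) simp
  have F: "bil ?sW F"
    unfolding bilinear_on_def
  proof (intro conjI ballI allI)
    fix u u' v v' c
    note rules = H linear_form_add[OF form] linear_form_scale[OF form]
    show "F (u + u') v = F u v + F u' v"
      by (rule poly_S2_eqI) (use bil in \<open>auto simp: mem S2_closed rules bilinear_on_def\<close>)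
    show "F u (v + v') = F u v + F u v'"
      by (rule poly_S2_eqI) (use bil in \<open>auto simp: mem S2_closed rules bilinear_on_def\<close>)
    show "F (kscale s c u) v = ?sW c (F u v)"
      by (rule poly_S2_eqI) (use bil in \<open>auto simp: mem S2_closed coeff_map_poly rules bilinear_on_def\<close>)
    show "F u (kscale s c v) = ?sW c (F u v)"
      by (rule poly_S2_eqI) (use bil in \<open>auto simp: mem S2_closed coeff_map_poly rules bilinear_on_def\<close>)
  qed
  have "lift2 s UNIV F t \<in> {q. \<forall>n. coeff q n \<in> S2}"
    by (rule lift2_mem[OF t W F]) (auto simp: S2_closed mem)
  then show "coeff (lift2 s UNIV F t) n \<in> S2" by simp
  show "hat (pair f \<gamma> g \<delta>) \<alpha> (lift2 s UNIV F t) = t (H f \<gamma> g \<delta> \<alpha>)" if "f \<in> Pd" "g \<in> Pd"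
    using lift2_form[OF t W F form] by (simp add: H that)
qed

lemma
  assumes T: "k_linear T" and t: "t \<in> S2"
  shows op_left_mem: "coeff (op_left s UNIV T t) n \<in> S2"
    and op_left_at: "f \<in> Pd \<Longrightarrow> g \<in> Pd \<Longrightarrow> hat (pair f \<gamma> g \<delta>) \<alpha> (op_left s UNIV T t) =
      t (\<lambda>u v. pv f \<gamma> (evs s \<alpha> (T u)) * pv g \<delta> v)"
    and op_right_mem: "coeff (op_right s UNIV T t) n \<in> S2"
    and op_right_at: "f \<in> Pd \<Longrightarrow> g \<in> Pd \<Longrightarrow> hat (pair f \<gamma> g \<delta>) \<alpha> (op_right s UNIV T t) =
      t (\<lambda>u v. pv f \<gamma> u * pv g \<delta> (evs s \<alpha> (T v)))"
    and op_left_flip_mem: "coeff (op_left_flip s UNIV T t) n \<in> S2"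
    and op_left_flip_at: "f \<in> Pd \<Longrightarrow> g \<in> Pd \<Longrightarrow> hat (pair f \<gamma> g \<delta>) \<alpha> (op_left_flip s UNIV T t) =
      t (\<lambda>u v. pv f \<gamma> (evs s (- \<alpha> - \<gamma> - \<delta>) (T u)) * pv g \<delta> v)"
    and op_right_flip_mem: "coeff (op_right_flip s UNIV T t) n \<in> S2"
    and op_right_flip_at: "f \<in> Pd \<Longrightarrow> g \<in> Pd \<Longrightarrow> hat (pair f \<gamma> g \<delta>) \<alpha> (op_right_flip s UNIV T t) =
      t (\<lambda>u v. pv f \<gamma> u * pv g \<delta> (evs s (- \<alpha> - \<gamma> - \<delta>) (T v)))"
proof -
  interpret T: vector_space "tensor_scale :: 'k \<Rightarrow> ('p, 'k) tensor2 \<Rightarrow> _" by (rule vector_space_tensor_scale)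
  have left: "hat (\<lambda>w. pair f \<gamma> g \<delta> (tens2 s UNIV w v)) \<alpha> p = pv f \<gamma> (evs s \<alpha> p) * pv g \<delta> v"
    and right: "hat (\<lambda>w. pair f \<gamma> g \<delta> (tens2 s UNIV v w)) \<alpha> p = pv f \<gamma> v * pv g \<delta> (evs s \<alpha> p)"
    if fg: "f \<in> Pd" "g \<in> Pd" for f \<gamma> g \<delta> \<alpha> p v
  proof -
    have "linear_form (kscale s) (\<lambda>w. pv f \<gamma> w * pv g \<delta> v)" "linear_form (kscale s) (\<lambda>w. pv f \<gamma> v * pv g \<delta> w)"
      using fg by (auto simp: linear_form_def mem_conf_dual_iff algebra_simps)
    then show "hat (\<lambda>w. pair f \<gamma> g \<delta> (tens2 s UNIV w v)) \<alpha> p = pv f \<gamma> (evs s \<alpha> p) * pv g \<delta> v"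
      "hat (\<lambda>w. pair f \<gamma> g \<delta> (tens2 s UNIV v w)) \<alpha> p = pv f \<gamma> v * pv g \<delta> (evs s \<alpha> p)"
      using linear_form_ev[of "kscale s" "\<lambda>w. pv f \<gamma> w * pv g \<delta> v" \<alpha> p]
        linear_form_ev[of "kscale s" "\<lambda>w. pv f \<gamma> v * pv g \<delta> w" \<alpha> p]
      by (simp_all add: tens2_apply bil_pair fg)
  qed
  have bils: "bil (*) (\<lambda>u v. pv f \<gamma> (evs s \<alpha> (T u)) * pv g \<delta> v)"
    "bil (*) (\<lambda>u v. pv f \<gamma> u * pv g \<delta> (evs s \<alpha> (T v)))" if fg: "f \<in> Pd" "g \<in> Pd" for f \<gamma> g \<delta> \<alpha>
    using fg by (auto intro!: bil_prod dual_form_linear form_at[OF T])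
  have flip: "hat (pair f \<gamma> g \<delta>) \<alpha> (flip_by (der2 s UNIV) e p) = hat (\<lambda>w. pair f \<gamma> g \<delta> (e w)) (- \<alpha> - (\<gamma> + \<delta>)) p"
    "coeff (flip_by (der2 s UNIV) e p) n \<in> S2"
    if fg: "f \<in> Pd" "g \<in> Pd" and e: "\<And>w. e w \<in> S2" "e 0 = 0" for f \<gamma> g \<delta> \<alpha> e n and p :: "'p poly"
  proof -
    note flip = hat_flip_by[OF linear_form_apply[of "\<lambda>x y. pv f \<gamma> x * pv g \<delta> y"],
      where W = S2 and D = "der2 s UNIV" and d = "\<gamma> + \<delta>"]
    show "hat (pair f \<gamma> g \<delta>) \<alpha> (flip_by (der2 s UNIV) e p) = hat (\<lambda>w. pair f \<gamma> g \<delta> (e w)) (- \<alpha> - (\<gamma> + \<delta>)) p"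
      by (rule flip(1)) (use fg e in \<open>auto simp: der2_mem pair_der2 S2_closed der2_0\<close>)
    show "coeff (flip_by (der2 s UNIV) e p) n \<in> S2"
      by (rule flip(2)) (use fg e in \<open>auto simp: der2_mem pair_der2 S2_closed der2_0\<close>)
  qed
  note zero_mem = coord_mem[of 0]
  let ?F = "\<lambda>u v. map_poly (\<lambda>w. tens2 s UNIV w v) (T u)"
  let ?H = "\<lambda>f \<gamma> g \<delta> \<alpha> u v. pv f \<gamma> (evs s \<alpha> (T u)) * pv g \<delta> v"
  have 1: "coeff (?F u v) n \<in> S2" "f \<in> Pd \<Longrightarrow> g \<in> Pd \<Longrightarrow> hat (pair f \<gamma> g \<delta>) \<alpha> (?F u v) = ?H f \<gamma> g \<delta> \<alpha> u v"
    for u v n f \<gamma> g \<delta> \<alpha>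
    by (auto simp: coeff_map_poly tens2_0 tens2_mem hat_map_poly left)
  show "coeff (op_left s UNIV T t) n \<in> S2"
    unfolding op_left_def by (rule lift2_poly[OF t, of ?F ?H]) (use 1 bils in auto)
  show "hat (pair f \<gamma> g \<delta>) \<alpha> (op_left s UNIV T t) = t (?H f \<gamma> g \<delta> \<alpha>)" if "f \<in> Pd" "g \<in> Pd"
    unfolding op_left_def by (rule lift2_poly[OF t, of ?F ?H]) (use 1 bils that in auto)
  let ?F = "\<lambda>u v. map_poly (\<lambda>w. tens2 s UNIV u w) (T v)"
  let ?H = "\<lambda>f \<gamma> g \<delta> \<alpha> u v. pv f \<gamma> u * pv g \<delta> (evs s \<alpha> (T v))"
  have 1: "coeff (?F u v) n \<in> S2" "f \<in> Pd \<Longrightarrow> g \<in> Pd \<Longrightarrow> hat (pair f \<gamma> g \<delta>) \<alpha> (?F u v) = ?H f \<gamma> g \<delta> \<alpha> u v"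
    for u v n f \<gamma> g \<delta> \<alpha>
    by (auto simp: coeff_map_poly tens2_0 tens2_mem hat_map_poly right)
  show "coeff (op_right s UNIV T t) n \<in> S2"
    unfolding op_right_def by (rule lift2_poly[OF t, of ?F ?H]) (use 1 bils in auto)
  show "hat (pair f \<gamma> g \<delta>) \<alpha> (op_right s UNIV T t) = t (?H f \<gamma> g \<delta> \<alpha>)" if "f \<in> Pd" "g \<in> Pd"
    unfolding op_right_def by (rule lift2_poly[OF t, of ?F ?H]) (use 1 bils that in auto)
  let ?F = "\<lambda>u v. flip_by (der2 s UNIV) (\<lambda>w. tens2 s UNIV w v) (T u)"
  let ?H = "\<lambda>f \<gamma> g \<delta> \<alpha> u v. pv f \<gamma> (evs s (- \<alpha> - \<gamma> - \<delta>) (T u)) * pv g \<delta> v"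
  have 1: "coeff (?F u v) n \<in> S2" "f \<in> Pd \<Longrightarrow> g \<in> Pd \<Longrightarrow> hat (pair f \<gamma> g \<delta>) \<alpha> (?F u v) = ?H f \<gamma> g \<delta> \<alpha> u v"
    for u v n f \<gamma> g \<delta> \<alpha>
    using flip(1)[of f g "\<lambda>w. tens2 s UNIV w v"] flip(2)[OF zero_mem zero_mem, of "\<lambda>w. tens2 s UNIV w v"]
    by (auto simp: tens2_0 tens2_mem left diff_diff_eq)
  show "coeff (op_left_flip s UNIV T t) n \<in> S2"
    unfolding op_left_flip_def by (rule lift2_poly[OF t, of ?F ?H]) (use 1 bils in auto)
  show "hat (pair f \<gamma> g \<delta>) \<alpha> (op_left_flip s UNIV T t) = t (?H f \<gamma> g \<delta> \<alpha>)" if "f \<in> Pd" "g \<in> Pd"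
    unfolding op_left_flip_def by (rule lift2_poly[OF t, of ?F ?H]) (use 1 bils that in auto)
  let ?F = "\<lambda>u v. flip_by (der2 s UNIV) (\<lambda>w. tens2 s UNIV u w) (T v)"
  let ?H = "\<lambda>f \<gamma> g \<delta> \<alpha> u v. pv f \<gamma> u * pv g \<delta> (evs s (- \<alpha> - \<gamma> - \<delta>) (T v))"
  have 1: "coeff (?F u v) n \<in> S2" "f \<in> Pd \<Longrightarrow> g \<in> Pd \<Longrightarrow> hat (pair f \<gamma> g \<delta>) \<alpha> (?F u v) = ?H f \<gamma> g \<delta> \<alpha> u v"
    for u v n f \<gamma> g \<delta> \<alpha>
    using flip(1)[of f g "\<lambda>w. tens2 s UNIV u w"] flip(2)[OF zero_mem zero_mem, of "\<lambda>w. tens2 s UNIV u w"]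
    by (auto simp: tens2_0 tens2_mem right diff_diff_eq)
  show "coeff (op_right_flip s UNIV T t) n \<in> S2"
    unfolding op_right_flip_def by (rule lift2_poly[OF t, of ?F ?H]) (use 1 bils in auto)
  show "hat (pair f \<gamma> g \<delta>) \<alpha> (op_right_flip s UNIV T t) = t (?H f \<gamma> g \<delta> \<alpha>)" if "f \<in> Pd" "g \<in> Pd"
    unfolding op_right_flip_def by (rule lift2_poly[OF t, of ?F ?H]) (use 1 bils that in auto)
qed

section \<open>The products on the dual defined by a coproduct\<close>

abbreviation "dp \<equiv> dual_product s (UNIV :: 'p set)"

lemma pair_add:
  "t \<in> S2 \<Longrightarrow> f \<in> Pd \<Longrightarrow> f' \<in> Pd \<Longrightarrow> g \<in> Pd \<Longrightarrow>
    pair (f + f') \<alpha> g \<beta> t = pair f \<alpha> g \<beta> t + pair f' \<alpha> g \<beta> t"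
  "t \<in> S2 \<Longrightarrow> f \<in> Pd \<Longrightarrow> g \<in> Pd \<Longrightarrow> g' \<in> Pd \<Longrightarrow>
    pair f \<alpha> (g + g') \<beta> t = pair f \<alpha> g \<beta> t + pair f \<alpha> g' \<beta> t"
  using S2_arg_add[OF _ bil_pair bil_pair, of t f g f' g \<alpha> \<beta> \<alpha> \<beta>]
    S2_arg_add[OF _ bil_pair bil_pair, of t f g f g' \<alpha> \<beta> \<alpha> \<beta>]
  by (simp_all add: algebra_simps)

lemma pair_scale:
  assumes "t \<in> S2" "f \<in> Pd" "g \<in> Pd"
  shows "pair (kscale dual_scale c f) \<alpha> g \<beta> t = c * pair f \<alpha> g \<beta> t"
    "pair f \<alpha> (kscale dual_scale c g) \<beta> t = c * pair f \<alpha> g \<beta> t"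
    "pair (der dual_scale f) \<alpha> g \<beta> t = - \<alpha> * pair f \<alpha> g \<beta> t"
    "pair f \<alpha> (der dual_scale g) \<beta> t = - \<beta> * pair f \<alpha> g \<beta> t"
  using S2_arg_scale[OF assms(1) bil_pair[OF assms(2,3)], of c \<alpha> \<beta>]
    S2_arg_scale[OF assms(1) bil_pair[OF assms(2,3)], of "- \<alpha>" \<alpha> \<beta>]
    S2_arg_scale[OF assms(1) bil_pair[OF assms(2,3)], of "- \<beta>" \<alpha> \<beta>]
  by (simp_all add: dual_scale_simps algebra_simps)

lemmas pair_linear = pair_add pair_scale

lemma coproduct_mem: "coproduct s UNIV D \<Longrightarrow> D v \<in> S2"
  by (simp add: coproduct_def)

lemma pair_coproduct:
  assumes D: "coproduct s UNIV D" and fg: "f \<in> Pd" "g \<in> Pd"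
  shows "D v \<in> S2" "pair f \<alpha> g \<beta> (D (u + v)) = pair f \<alpha> g \<beta> (D u) + pair f \<alpha> g \<beta> (D v)"
    "pair f \<alpha> g \<beta> (D (kscale s c v)) = c * pair f \<alpha> g \<beta> (D v)"
    "pair f \<alpha> g \<beta> (D (der s v)) = (\<alpha> + \<beta>) * pair f \<alpha> g \<beta> (D v)"
  using D fg by (auto simp: coproduct_def tensor_scale_def pair_der2)

lemma pair_coproduct_form:
  assumes D: "coproduct s UNIV D" and fg: "f \<in> Pd" "g \<in> Pd"
  shows "linear_form (kscale s) (\<lambda>v. pair f \<alpha> g \<beta> (D v))"
  using pair_coproduct[OF assms] by (simp add: linear_form_def)

lemma
  assumes D: "coproduct s UNIV D" and fg: "f \<in> Pd" "g \<in> Pd"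
  shows dual_product_mem: "coeff (dp D f g) n \<in> Pd"
    and dual_product_at: "pv (evs dual_scale \<alpha> (dp D f g)) \<nu> v = pair f \<alpha> g (\<nu> - \<alpha>) (D v)"
proof -
  let ?F = "\<lambda>v. lift2 s UNIV (\<lambda>x y. subst lam const2 (f x) * subst (\<lambda>q. mu q - lam q) const2 (g y)) (D v)"
  let ?G = "\<lambda>v \<alpha> \<nu>. pair f \<alpha> g (\<nu> - \<alpha>) (D v)"
  let ?sW = "\<lambda>c. smult [:c::'k:]"
  have W: "vector_space ?sW" by unfold_locales (auto simp: smult_add_right algebra_simps one_pCons[symmetric] simp flip: smult_add_left)
  have eval: "hat2 \<alpha> \<nu> (subst lam const2 (f x) * subst (\<lambda>q. mu q - lam q) const2 (g y)) =
      pv f \<alpha> x * pv g (\<nu> - \<alpha>) y" for x y \<alpha> \<nu>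
    using hat2_subst_lam[of \<nu> \<alpha> "f x"] hat2_subst_mu_lam[of \<nu> \<alpha> "g y"] by (simp add: hat2_conv_poly)
  have bil: "bil ?sW (\<lambda>x y. subst lam const2 (f x) * subst (\<lambda>q. mu q - lam q) const2 (g y))"
    unfolding bilinear_on_def
    by (intro conjI ballI allI; rule hat2_eqI)
      (use fg in \<open>simp_all only: eval hat2_linear, simp_all add: mem_conf_dual_iff algebra_simps\<close>)
  have form: "linear_form ?sW (hat2 \<alpha> \<nu>)" for \<alpha> \<nu>
    by (simp add: linear_form_def hat2_linear)
  have G: "hat2 \<alpha> \<nu> (?F v) = ?G v \<alpha> \<nu>" for v \<alpha> \<nu>
    using lift2_form[OF pair_coproduct(1)[OF D fg] W bil form] by (simp add: eval)
  note dp = dual_poly[of ?F ?G, OF G]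
  have "coeff (dual_poly UNIV ?F) n \<in> Pd"
    by (rule dp(1)) (simp_all add: pair_coproduct[OF D fg])
  moreover have "pv (evs dual_scale \<alpha> (dual_poly UNIV ?F)) \<nu> v = ?G v \<alpha> \<nu>"
    by (rule dp(2)) (simp_all add: pair_coproduct[OF D fg])
  ultimately show "coeff (dp D f g) n \<in> Pd" "pv (evs dual_scale \<alpha> (dp D f g)) \<nu> v = ?G v \<alpha> \<nu>"
    by (simp_all add: dual_product_def)
qed

lemma dual_fun_eqI:
  fixes f g :: "'p \<Rightarrow> 'k poly"
  assumes "\<And>\<nu> v. pv f \<nu> v = pv g \<nu> v"
  shows "f = g"
  by (rule ext, subst poly_eq_poly_eq_iff[symmetric]) (use assms in auto)

lemma Pd_closed:
  "0 \<in> Pd" "f \<in> Pd \<Longrightarrow> g \<in> Pd \<Longrightarrow> f + g \<in> Pd" "f \<in> Pd \<Longrightarrow> kscale dual_scale c f \<in> Pd"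
  "f \<in> Pd \<Longrightarrow> der dual_scale f \<in> Pd" "f \<in> Pd \<Longrightarrow> - f \<in> Pd"
  by (auto simp: mem_conf_dual_iff dual_scale_simps smult_add_right algebra_simps)

lemma gc_hom_dual_product:
  assumes D: "coproduct s UNIV D"
  shows "gc_hom dual_scale Pd dual_scale Pd (dp D)"
proof (rule gc_homI[OF module_dual_scale])
  show "coeff (dp D f g) n \<in> Pd" if "f \<in> Pd" "g \<in> Pd" for f g n
    by (rule dual_product_mem[OF D that])
qed (rule dual_fun_eqI, simp only: dual_product_at[OF D] Pd_closed, simp only: pair_linear Pd_closed coproduct_mem[OF D],
    simp add: dual_product_at[OF D] dual_scale_simps algebra_simps)+

lemma subspace_Pd: "module.subspace dual_scale Pd"
  by (rule subspace_conf_dual) (rule module_axioms)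

subsection \<open>The action of the dual on the module\<close>

lemma inj_bidual: "inj (bidual s (UNIV :: 'p set))"
proof (rule injI, rule dual_eqI)
  fix x y f \<nu> assume eq: "bidual s UNIV x = bidual s (UNIV :: 'p set) y" and f: "f \<in> Pd"
  have "neg_var (f x) = neg_var (f y)" using fun_cong[OF eq, of f] f by (simp add: bidual_def)
  then have "neg_var (neg_var (f x)) = neg_var (neg_var (f y))" by simp
  then show "pv f \<nu> x = pv f \<nu> y" by (simp add: neg_var_simps)
qed

text \<open>
  \<open>\<Sum> g\<^sub>\<lambda>(x) y\<close> for \<open>D a = \<Sum> x \<otimes> y\<close>.
\<close>

definition contract :: "('p \<Rightarrow> ('p, 'k) tensor2) \<Rightarrow> ('p \<Rightarrow> 'k poly) \<Rightarrow> 'p \<Rightarrow> 'p poly" where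
  "contract D g a = lift2 s UNIV (\<lambda>x y. map_poly (\<lambda>c. kscale s c y) (g x)) (D a)"

lemma contract_at:
  assumes D: "coproduct s UNIV D" and g: "g \<in> Pd" and f: "f \<in> Pd"
  shows "pv f \<nu> (evs s \<alpha> (contract D g a)) = pair g \<alpha> f \<nu> (D a)"
proof -
  have W: "vector_space (\<lambda>c. map_poly (kscale s c))"
    by (rule vector_space_poly) (rule K.vector_space_axioms)
  have bil: "bil (\<lambda>c. map_poly (kscale s c)) (\<lambda>x y. map_poly (\<lambda>c. kscale s c y) (g x))"
    using g by (auto simp: bilinear_on_def mem_conf_dual_iff coeff_map_poly intro!: poly_eqI)
      (auto simp: K.scale_left_distrib K.scale_right_distrib mult.commute)
  have form: "linear_form (\<lambda>c. map_poly (kscale s c)) (hat (pv f \<nu>) \<alpha>)"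
    by (rule linear_form_hat[OF dual_form_linear[OF f]]) simp
  have f0: "f 0 = 0" and fs: "f (kscale s c y) = smult c (f y)" for c y
    using f dual_scale_apply[OF f, of 0 0] by (auto simp: mem_conf_dual_iff)
  have "hat (pv f \<nu>) \<alpha> (map_poly (\<lambda>c. kscale s c y) (g x)) = pv g \<alpha> x * pv f \<nu> y" for x y
  proof -
    have "hat (\<lambda>c. pv f \<nu> (kscale s c y)) \<alpha> (g x) = (\<Sum>k\<le>degree (g x). \<alpha> ^ k * (coeff (g x) k * pv f \<nu> y))"
      by (subst hat_conv_sum) (auto simp: fs f0)
    then show ?thesis
      by (simp add: hat_map_poly f0 poly_altdef sum_distrib_right algebra_simps)
  qed
  then show ?thesis
    using lift2_form[OF coproduct_mem[OF D] W bil form]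
    by (simp add: contract_def linear_form_ev[OF dual_form_linear[OF f]])
qed

text \<open>
  The coadjoint action of the dual is transported along the embedding of \<open>P\<close> into its
  double dual. The coefficients of \<open>- contract D g a\<close> are explicit preimages of the
  coefficients to be transported, so the inverse of the embedding is computed from its
  injectivity.
\<close>

lemma codual_rep_eq:
  assumes D: "coproduct s UNIV D" and g: "g \<in> Pd"
  shows "codual_rep s UNIV (dp D) g a = - contract D g a"
proof -
  let ?A = "bidual s UNIV a" and ?p = "- contract D g a"
  let ?F = "\<lambda>f. - subst lam (\<lambda>w. subst (\<lambda>q. mu q - lam q) const2 (?A w)) (dp D g f)"
  have bidual0: "bidual s UNIV 0 = (0 :: ('p \<Rightarrow> 'k poly) \<Rightarrow> 'k poly)"
  proof
    show "bidual s UNIV 0 f = 0 f" for f :: "'p \<Rightarrow> 'k poly"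
      using dual_scale_apply[of f 0 0] by (simp add: bidual_def neg_var_simps)
  qed
  have F: "?F f = map_poly (\<lambda>w. neg_var (f w)) ?p" if f: "f \<in> Pd" for f
  proof (rule hat2_eqI)
    fix \<alpha> \<nu>
    have f0: "f 0 = 0" using dual_scale_apply[OF f, of 0 0] by simp
    have A: "poly (?A w) c = pv w (- c) a" if "w \<in> Pd" for w c
      using that by (simp add: bidual_def neg_var_simps)
    have A0: "?A 0 = 0" using Pd_closed(1) by (simp add: bidual_def neg_var_simps)
    have "hat2 \<alpha> \<nu> (?F f) = - hat (\<lambda>w. poly (?A w) (\<nu> - \<alpha>)) \<alpha> (dp D g f)"
      by (subst hat2_linear, subst hat2_subst[where sc = "(*)" and t = \<alpha>])
        (auto simp: hat2_subst_mu_lam linear_form_def hat2_lam A0)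
    also have "hat (\<lambda>w. poly (?A w) (\<nu> - \<alpha>)) \<alpha> (dp D g f) = hat (\<lambda>w. pv w (\<alpha> - \<nu>) a) \<alpha> (dp D g f)"
      by (rule hat_cong) (auto simp: A0 A dual_product_mem[OF D g f])
    also have "\<dots> = pair g \<alpha> f (- \<nu>) (D a)"
      using dual_momentum_form[where \<nu> = "\<alpha> - \<nu>" and v = a] linear_form_ev[of "kscale dual_scale" "\<lambda>w. pv w (\<alpha> - \<nu>) a" \<alpha> "dp D g f"]
        dual_product_at[OF D g f, of \<alpha> a "\<alpha> - \<nu>"] by (simp add: momentum_form_def)
    also have "- \<dots> = hat (\<lambda>w. pv f (- \<nu>) w) \<alpha> ?p"
      using linear_form_ev[OF dual_form_linear[OF f, of "- \<nu>"], of \<alpha> ?p] contract_at[OF D g f]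
      by (simp add: K.ev_minus linear_form_minus[OF dual_form_linear[OF f]])
    also have "\<dots> = hat2 \<alpha> \<nu> (map_poly (\<lambda>w. neg_var (f w)) ?p)"
      by (simp add: hat_map_poly hat_id f0 neg_var_simps)
    finally show "hat2 \<alpha> \<nu> (?F f) = hat2 \<alpha> \<nu> (map_poly (\<lambda>w. neg_var (f w)) ?p)" .
  qed
  have "(\<lambda>n f. if f \<in> Pd then coeff (?F f) n else 0) = coeff (map_poly (bidual s UNIV) ?p)"
  proof (intro ext)
    fix n and f :: "'p \<Rightarrow> 'k poly"
    have "neg_var (f 0) = 0" if "f \<in> Pd" using dual_scale_apply[OF that, of 0 0] by (simp add: neg_var_simps)
    then show "(if f \<in> Pd then coeff (?F f) n else 0) = coeff (map_poly (bidual s UNIV) ?p) n f"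
      using arg_cong[OF F[of f], of "\<lambda>q. coeff q n"] coeff_map_poly[of "bidual s UNIV", OF bidual0, of ?p n]
        coeff_map_poly[of "\<lambda>w. neg_var (f w)" ?p n]
      by (cases "f \<in> Pd") (simp_all only: bidual_def if_True if_False simp_thms)
  qed
  then have "dual_rep Pd (dp D) g ?A = map_poly (bidual s UNIV) ?p"
    by (simp only: dual_rep_def dual_poly_def coeff_inverse)
  moreover have "map_poly (inv_into UNIV (bidual s UNIV)) (map_poly (bidual s UNIV) ?p) = ?p"
    using inv_into_f_f[OF inj_bidual, of 0]
    by (subst map_poly_map_poly) (auto simp: bidual0 inv_o_cancel[OF inj_bidual])
  ultimately show ?thesis by (simp only: codual_rep_def)
qed

lemma codual_rep_at:
  assumes "coproduct s UNIV D" "g \<in> Pd" "f \<in> Pd"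
  shows "pv f \<nu> (evs s \<alpha> (codual_rep s UNIV (dp D) g a)) = - pair g \<alpha> f \<nu> (D a)"
  using contract_at[OF assms] linear_form_minus[OF dual_form_linear[OF assms(3)]]
  by (simp add: codual_rep_eq assms K.ev_minus)

lemma pv_simps:
  assumes "f \<in> Pd"
  shows "pv f \<nu> (x + y) = pv f \<nu> x + pv f \<nu> y" "pv f \<nu> (- x) = - pv f \<nu> x"
    "pv f \<nu> (x - y) = pv f \<nu> x - pv f \<nu> y" "pv f \<nu> (kscale s c x) = c * pv f \<nu> x"
    "pv f \<nu> (der s x) = \<nu> * pv f \<nu> x"
  using linear_form_simps[OF dual_form_linear[OF assms]] dual_form[OF assms, of \<nu>]
  by (auto simp: momentum_form_def)

lemma gc_hom_codual:
  assumes D: "coproduct s UNIV D"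
  shows "gc_hom dual_scale Pd s UNIV (codual_rep s UNIV (dp D))"
  by (rule gc_homI[OF module_axioms]; (rule UNIV_I)?)
    (rule dual_eqI, simp only: codual_rep_at[OF D] pv_simps Pd_closed,
      simp only: pair_linear Pd_closed coproduct_mem[OF D] pair_coproduct[OF D],
      simp add: algebra_simps)+

lemma gc_hom_dual_rep:
  assumes \<phi>: "gc_hom s UNIV s UNIV \<phi>"
  shows "gc_hom s UNIV dual_scale Pd (dual_rep UNIV \<phi>)"
proof (rule gc_homI[OF module_dual_scale])
  show "coeff (dual_rep UNIV \<phi> a f) n \<in> Pd" if "f \<in> Pd" for a f n
    by (rule dual_rep_at[OF \<phi> that])
qed (rule dual_fun_eqI, simp only: dual_rep_at(2)[OF \<phi>] Pd_closed,
    simp add: dual_rep_at(2)[OF \<phi>] dual_scale_simps pv_simps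
      gc_homD[OF mods \<phi> UNIV_I UNIV_I UNIV_I UNIV_I] algebra_simps)+

section \<open>The dual of a Poisson conformal coalgebra\<close>

abbreviation "S3 \<equiv> tensor_space tensor_scale S2 (kscale s) UNIV"

text \<open>
  The functional \<open>f\<^sub>\<alpha> \<otimes> g\<^sub>\<beta> \<otimes>
  h\<^sub>\<gamma>\<close> on \<open>P \<otimes> P \<otimes> P\<close>.
\<close>

abbreviation triple :: "('p \<Rightarrow> 'k poly) \<Rightarrow> 'k \<Rightarrow> ('p \<Rightarrow> 'k poly) \<Rightarrow> 'k \<Rightarrow> ('p \<Rightarrow> 'k poly) \<Rightarrow> 'k \<Rightarrow>
    ('p, 'k) tensor3 \<Rightarrow> 'k" where
  "triple f \<alpha> g \<beta> h \<gamma> r \<equiv> r (\<lambda>t v. pair f \<alpha> g \<beta> t * pv h \<gamma> v)"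

lemma bil_triple:
  "h \<in> Pd \<Longrightarrow> bilinear_on tensor_scale S2 (kscale s) UNIV (*) (\<lambda>t v. pair f \<alpha> g \<beta> t * pv h \<gamma> v)"
  by (simp add: bilinear_on_def tensor_scale_def pv_simps algebra_simps)

lemma tens21_linear:
  "t \<in> S2 \<Longrightarrow> t' \<in> S2 \<Longrightarrow> tens21 s UNIV (t + t') v = tens21 s UNIV t v + tens21 s UNIV t' v"
  "t \<in> S2 \<Longrightarrow> tens21 s UNIV t (v + v') = tens21 s UNIV t v + tens21 s UNIV t v'"
  "t \<in> S2 \<Longrightarrow> tens21 s UNIV (tensor_scale c t) v = tensor_scale c (tens21 s UNIV t v)"
  "t \<in> S2 \<Longrightarrow> tens21 s UNIV t (kscale s c v) = tensor_scale c (tens21 s UNIV t v)"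
  using tensor_bilinear[of tensor_scale S2 "kscale s" UNIV]
  unfolding bilinear_on_def tens21_def by auto

lemma triple_tens21: "h \<in> Pd \<Longrightarrow> triple f \<alpha> g \<beta> h \<gamma> (tens21 s UNIV t v) = pair f \<alpha> g \<beta> t * pv h \<gamma> v"
  by (simp add: tens21_def tensor_def bil_triple)

lemma S3_closed: "0 \<in> S3" "x \<in> S3 \<Longrightarrow> y \<in> S3 \<Longrightarrow> x + y \<in> S3" "t \<in> S2 \<Longrightarrow> tens21 s UNIV t v \<in> S3"
proof -
  interpret T: module "tensor_scale :: 'k \<Rightarrow> ('p, 'k) tensor3 \<Rightarrow> _"
    by unfold_locales (auto simp: tensor_scale_def fun_eq_iff algebra_simps)
  show "0 \<in> S3" "x \<in> S3 \<Longrightarrow> y \<in> S3 \<Longrightarrow> x + y \<in> S3"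
    unfolding tensor_space_def by (auto intro: T.span_zero T.span_add)
  show "tens21 s UNIV t v \<in> S3" if "t \<in> S2"
    unfolding tens21_def tensor_space_def by (rule T.span_base) (use that in blast)
qed

lemma triple_cop_left:
  assumes D: "coproduct s UNIV D" and t: "t \<in> S2" and h: "h \<in> Pd"
  shows "triple f \<alpha> g \<beta> h \<gamma> (cop_left s UNIV D t) = t (\<lambda>u v. pair f \<alpha> g \<beta> (D u) * pv h \<gamma> v)"
proof -
  have "bil tensor_scale (\<lambda>u v. tens21 s UNIV (D u) v)"
    using D by (simp add: bilinear_on_def tens21_linear coproduct_def)
  from lift2_form[OF t vector_space_tensor_scale this linear_form_apply[of "\<lambda>t v. pair f \<alpha> g \<beta> t * pv h \<gamma> v"]]
  show ?thesis by (simp add: cop_left_def triple_tens21 h)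
qed

lemma
  assumes D: "coproduct s UNIV D" and t: "t \<in> S2"
  shows triple_cop_right: "f \<in> Pd \<Longrightarrow> g \<in> Pd \<Longrightarrow> h \<in> Pd \<Longrightarrow>
      triple f \<alpha> g \<beta> h \<gamma> (cop_right s UNIV D t) = t (\<lambda>u v. pv f \<alpha> u * pair g \<beta> h \<gamma> (D v))"
    and cop_right_mem: "cop_right s UNIV D t \<in> S3"
proof -
  interpret T: vector_space "tensor_scale :: 'k \<Rightarrow> ('p, 'k) tensor3 \<Rightarrow> _" by (rule vector_space_tensor_scale)
  let ?E = "\<lambda>u x y. tens21 s UNIV (tens2 s UNIV u x) y"
  let ?F = "\<lambda>u v. lift2 s UNIV (?E u) (D v)"
  have E: "bil tensor_scale (?E u)" for u
    by (simp add: bilinear_on_def tens2_linear tens21_linear tens2_mem)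
  have Dv: "D v \<in> S2" for v by (rule coproduct_mem[OF D])
  have lift_apply: "lift2 s UNIV (?E u) t C = t (\<lambda>x y. ?E u x y C)" if "t \<in> S2" for u t C
    by (rule lift2_form[OF that vector_space_tensor_scale E linear_form_apply])
  have bilC: "bil (*) (\<lambda>x y. ?E u x y C)" for u C
    by (rule bilinear_on_form[OF E linear_form_apply])
  have F: "bil tensor_scale ?F"
    unfolding bilinear_on_def
  proof (intro conjI ballI allI ext)
    fix u u' v v' c C
    show "?F (u + u') v C = (?F u v + ?F u' v) C"
      by (simp only: plus_fun_apply lift_apply[OF Dv])
        (simp only: plus_fun_apply tens2_linear tens21_linear tens2_mem S2_arg_add[OF Dv bilC bilC])
    show "?F u (v + v') C = (?F u v + ?F u v') C"
      using D by (simp add: lift_apply Dv S2_closed coproduct_def)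
    show "?F (kscale s c u) v C = tensor_scale c (?F u v) C"
      by (simp only: lift_apply[OF Dv], simp only: tens2_linear tens21_linear tens2_mem)
        (simp only: tensor_scale_def lift_apply[OF Dv] S2_arg_scale[OF Dv bilC])
    show "?F u (kscale s c v) C = tensor_scale c (?F u v) C"
      using D by (simp add: lift_apply Dv S2_closed coproduct_def) (simp add: tensor_scale_def lift_apply Dv)
  qed
  show "triple f \<alpha> g \<beta> h \<gamma> (cop_right s UNIV D t) = t (\<lambda>u v. pv f \<alpha> u * pair g \<beta> h \<gamma> (D v))"
    if fgh: "f \<in> Pd" "g \<in> Pd" "h \<in> Pd"
  proof -
    have "triple f \<alpha> g \<beta> h \<gamma> (?F u v) = pv f \<alpha> u * pair g \<beta> h \<gamma> (D v)" for u v
    proof -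
      have "triple f \<alpha> g \<beta> h \<gamma> (?F u v) = D v (\<lambda>x y. pv f \<alpha> u * (pv g \<beta> x * pv h \<gamma> y))"
        by (simp add: lift_apply Dv triple_tens21 fgh tens2_apply bil_pair mult.assoc)
      then show ?thesis by (simp add: S2_arg_scale[OF Dv] bil_pair fgh)
    qed
    then show ?thesis
      using lift2_form[OF t vector_space_tensor_scale F linear_form_apply]
      by (simp add: cop_right_def)
  qed
  show "cop_right s UNIV D t \<in> S3"
    unfolding cop_right_def
    by (intro lift2_mem[OF t vector_space_tensor_scale F] S3_closed
        lift2_mem[OF Dv vector_space_tensor_scale E] tens2_mem)
qed

lemma triple_flip_left:
  assumes r: "r \<in> S3" and fgh: "f \<in> Pd" "g \<in> Pd" "h \<in> Pd"
  shows "triple f \<alpha> g \<beta> h \<gamma> (flip_left s UNIV r) = triple g \<beta> f \<alpha> h \<gamma> r"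
proof -
  have add: "flip_tensor s UNIV (t + t') = flip_tensor s UNIV t + flip_tensor s UNIV t'"
    if "t \<in> S2" "t' \<in> S2" for t t' :: "('p, 'k) tensor2"
    unfolding flip_tensor_def lift2_def
    by (rule tensor_universal(4)[OF vector_space_tensor_scale])
      (use that in \<open>auto simp: bilinear_on_def tens2_linear space2_def\<close>)
  have scale: "flip_tensor s UNIV (tensor_scale c t) = tensor_scale c (flip_tensor s UNIV t)"
    if "t \<in> S2" for t :: "('p, 'k) tensor2" and c
    unfolding flip_tensor_def lift2_def
    by (rule tensor_universal(5)[OF vector_space_tensor_scale])
      (use that in \<open>auto simp: bilinear_on_def tens2_linear space2_def\<close>)
  have bil: "bilinear_on tensor_scale S2 (kscale s) UNIV tensor_scale (\<lambda>t v. tens21 s UNIV (flip_tensor s UNIV t) v)"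
    by (simp add: bilinear_on_def tens21_linear flip_tensor_mem add scale)
  have flip: "pair f \<alpha> g \<beta> (flip_tensor s UNIV t) = pair g \<beta> f \<alpha> t" if "t \<in> S2" for t
    by (simp add: flip_tensor_apply that bil_pair fgh mult.commute)
  obtain xs where xs: "set xs \<subseteq> S2 \<times> UNIV" "r = (\<Sum>(t, v)\<leftarrow>xs. tensor tensor_scale S2 (kscale s) UNIV t v)"
    by (rule tensor_space_sums[of S2 tensor_scale r "kscale s" UNIV]) (use r S2_closed in auto)
  have "triple f \<alpha> g \<beta> h \<gamma> (flip_left s UNIV r) = (\<Sum>(t, v)\<leftarrow>xs. triple f \<alpha> g \<beta> h \<gamma> (tens21 s UNIV (flip_tensor s UNIV t) v))"
    unfolding flip_left_def lift21_def xs(2) tensor_lift_sum_list[OF vector_space_tensor_scale bil xs(1)]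
    by (induction xs) auto
  also have "\<dots> = (\<Sum>(t, v)\<leftarrow>xs. pair g \<beta> f \<alpha> t * pv h \<gamma> v)"
    by (intro arg_cong[of _ _ sum_list] map_cong) (use xs(1) in \<open>auto simp: triple_tens21 fgh flip\<close>)
  also have "\<dots> = triple g \<beta> f \<alpha> h \<gamma> r"
    unfolding xs(2) tensor_sum_apply[OF bil_triple[OF fgh(3)]] ..
  finally show ?thesis .
qed

lemma dual_product_ev_mem:
  "coproduct s UNIV D \<Longrightarrow> f \<in> Pd \<Longrightarrow> g \<in> Pd \<Longrightarrow> evs dual_scale \<alpha> (dp D f g) \<in> Pd"
  by (intro ev_mem kspace_kscale[OF module_dual_scale] subspace_Pd dual_product_mem)

text \<open>
  Iterated products on the dual are transposes of iterated coproducts.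
\<close>

lemma dual_nest:
  assumes D: "coproduct s UNIV D" and D': "coproduct s UNIV D'"
    and fgh: "f \<in> Pd" "g \<in> Pd" "h \<in> Pd"
  shows "pv (evs dual_scale (\<alpha> + \<beta>) (dp D (evs dual_scale \<alpha> (dp D' f g)) h)) \<nu> v =
      triple f \<alpha> g \<beta> h (\<nu> - (\<alpha> + \<beta>)) (cop_left s UNIV D' (D v))"
    and "pv (evs dual_scale \<alpha> (dp D f (evs dual_scale \<beta> (dp D' g h)))) \<nu> v =
      triple f \<alpha> g \<beta> h (\<nu> - (\<alpha> + \<beta>)) (cop_right s UNIV D' (D v))"
  using fgh by (simp_all add: dual_product_at[OF D] dual_product_at[OF D'] dual_product_ev_mem[OF D']
      triple_cop_left[OF D' coproduct_mem[OF D]] triple_cop_right[OF D' coproduct_mem[OF D]] diff_diff_eq)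

lemma flip_symmetric_dual:
  assumes D: "coproduct s UNIV D" and sym: "\<And>v. D v = tensor_scale \<epsilon> (flip_tensor s UNIV (D v))"
  shows "flip_symmetric dual_scale Pd \<epsilon> (dp D)"
proof -
  have "pair f \<alpha> g \<beta> (D v) = \<epsilon> * pair g \<beta> f \<alpha> (D v)" if "f \<in> Pd" "g \<in> Pd" for f g \<alpha> \<beta> v
    by (subst sym) (simp add: tensor_scale_def flip_tensor_apply coproduct_mem[OF D] bil_pair that mult.commute)
  note pair = this
  have "pv (evs dual_scale \<alpha> (dp D f g)) \<nu> v = \<epsilon> * pv (evs dual_scale (\<nu> - \<alpha>) (dp D g f)) \<nu> v"
    if "f \<in> Pd" "g \<in> Pd" for f g \<alpha> \<nu> v
  proof -
    have "\<nu> - (\<nu> - \<alpha>) = \<alpha>" by simp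
    then show ?thesis
      unfolding dual_product_at[OF D that] dual_product_at[OF D that(2,1)] using pair[OF that] by metis
  qed
  note eq = this
  show ?thesis
    by (subst flip_symmetric_iff[OF module_dual_scale, where I = "UNIV :: ('k \<times> 'p) set"
          and d = "\<lambda>(\<nu>, v). - \<nu>" and \<psi> = "\<lambda>(\<nu>, v) f. pv f \<nu> v"])
      (auto simp: dual_momentum_form intro!: dual_fun_eqI eq)
qed

text \<open>
  Each axiom is the corresponding coalgebra axiom evaluated at \<open>f\<^sub>\<alpha> \<otimes>
  g\<^sub>\<beta> \<otimes> h\<close>. The twist \<open>\<tau> \<otimes> I\<close> exchanges
  \<open>f\<^sub>\<alpha>\<close> and \<open>g\<^sub>\<beta>\<close>, which produces the term in
  which the second factor is pulled out.
\<close>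

theorem poisson_conformal_dual:
  assumes "poisson_conformal_coalgebra s UNIV \<delta> \<Delta>"
  shows "poisson_conformal dual_scale Pd (dp \<delta>) (dp \<Delta>)"
proof -
  have \<delta>: "coproduct s UNIV \<delta>" and \<Delta>: "coproduct s UNIV \<Delta>"
    and skew: "\<And>v. \<delta> v = - flip_tensor s UNIV (\<delta> v)" and comm: "\<And>v. \<Delta> v = flip_tensor s UNIV (\<Delta> v)"
    and jac: "\<And>v. cop_right s UNIV \<delta> (\<delta> v) - flip_left s UNIV (cop_right s UNIV \<delta> (\<delta> v)) = cop_left s UNIV \<delta> (\<delta> v)"
    and assoc: "\<And>v. cop_right s UNIV \<Delta> (\<Delta> v) = cop_left s UNIV \<Delta> (\<Delta> v)"
    and leib: "\<And>v. cop_right s UNIV \<Delta> (\<delta> v) = cop_left s UNIV \<delta> (\<Delta> v) + flip_left s UNIV (cop_right s UNIV \<delta> (\<Delta> v))"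
    using assms by (auto simp: poisson_conformal_coalgebra_def lie_conformal_coalgebra_def cocomm_coassoc_conformal_def)
  have "tensor_scale (- 1) t = - t" "tensor_scale 1 t = t" for t :: "('p, 'k) tensor2"
    by (auto simp: tensor_scale_def)
  then have "flip_symmetric dual_scale Pd (- 1) (dp \<delta>)" "flip_symmetric dual_scale Pd 1 (dp \<Delta>)"
    using flip_symmetric_dual[OF \<delta>, of "- 1"] flip_symmetric_dual[OF \<Delta>, of 1] skew comm by auto
  moreover have "assoc_at dual_scale Pd (dp \<Delta>)"
    unfolding assoc_at_def
    by (intro ballI allI dual_fun_eqI) (simp add: dual_nest[OF \<Delta> \<Delta>] assoc)
  moreover have "leibniz_at dual_scale Pd (dp \<delta>) (dp D)"
    if D: "coproduct s UNIV D"
      and eq: "\<And>v. cop_right s UNIV D (\<delta> v) = cop_left s UNIV \<delta> (D v) + flip_left s UNIV (cop_right s UNIV \<delta> (D v))"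
    for D
    unfolding leibniz_at_def
  proof (intro ballI allI dual_fun_eqI)
    fix f g h \<alpha> \<beta> \<nu> v
    assume fgh: "f \<in> Pd" "g \<in> Pd" "h \<in> Pd"
    have "triple f \<alpha> g \<beta> h (\<nu> - (\<alpha> + \<beta>)) (cop_right s UNIV D (\<delta> v)) =
        triple f \<alpha> g \<beta> h (\<nu> - (\<alpha> + \<beta>)) (cop_left s UNIV \<delta> (D v)) +
        triple g \<beta> f \<alpha> h (\<nu> - (\<alpha> + \<beta>)) (cop_right s UNIV \<delta> (D v))"
      by (simp add: eq triple_flip_left fgh cop_right_mem[OF \<delta> coproduct_mem[OF D]])
    moreover have "\<nu> - (\<beta> + \<alpha>) = \<nu> - (\<alpha> + \<beta>)" by simp
    ultimately show "pv (evs dual_scale \<alpha> (dp \<delta> f (evs dual_scale \<beta> (dp D g h)))) \<nu> v =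
        pv (evs dual_scale (\<alpha> + \<beta>) (dp D (evs dual_scale \<alpha> (dp \<delta> f g)) h) +
          evs dual_scale \<beta> (dp D g (evs dual_scale \<alpha> (dp \<delta> f h)))) \<nu> v"
      by (simp only: plus_fun_apply poly_add dual_nest[OF \<delta> D fgh] dual_nest[OF D \<delta> fgh]
          dual_nest[OF D \<delta> fgh(2,1,3)])
  qed
  moreover have "cop_right s UNIV \<delta> (\<delta> v) = cop_left s UNIV \<delta> (\<delta> v) + flip_left s UNIV (cop_right s UNIV \<delta> (\<delta> v))" for v
    using jac[of v] by (metis diff_add_cancel)
  ultimately show ?thesis
    unfolding poisson_conformal_at_iff
    using fg_module_dual gc_hom_dual_product[OF \<delta>] gc_hom_dual_product[OF \<Delta>] \<delta> \<Delta> leib by blast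
qed

section \<open>The compatibility conditions at scalar spectral parameters\<close>

lemma poly_S2_eq_iff:
  fixes p q :: "('p, 'k) tensor2 poly"
  assumes "\<And>n. coeff p n \<in> S2" "\<And>n. coeff q n \<in> S2"
  shows "p = q \<longleftrightarrow> (\<forall>f\<in>Pd. \<forall>g\<in>Pd. \<forall>\<alpha> \<gamma> \<kappa>. hat (pair f \<gamma> g \<kappa>) \<alpha> p = hat (pair f \<gamma> g \<kappa>) \<alpha> q)"
  using poly_S2_eqI[OF assms] by auto

lemma hat_cop:
  assumes D: "coproduct s UNIV D" and fg: "f \<in> Pd" "g \<in> Pd"
  shows "hat (pair f \<gamma> g \<kappa>) \<alpha> (map_poly D p) = pair f \<gamma> g \<kappa> (D (evs s \<alpha> p))"
proof -
  have "D 0 = 0" using D unfolding coproduct_def by (metis UNIV_I add_cancel_left_left)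
  then show ?thesis
    by (simp add: hat_map_poly linear_form_ev[OF pair_coproduct_form[OF D fg]])
qed

text \<open>
  The four compatibility conditions of a bialgebra at \<open>\<lambda> = \<alpha>\<close>,
  evaluated at \<open>f\<^sub>\<gamma> \<otimes> g\<^sub>\<kappa>\<close>. There
  \<open>\<partial>\<close> acts on \<open>P \<otimes> P\<close> as \<open>\<gamma> +
  \<kappa>\<close>, so \<open>-\<lambda>-\<partial>\<close> becomes \<open>\<beta>\<close>, the
  momentum of \<open>b\<close> when all momenta add up to zero.
\<close>

definition lie_compatible :: "('p \<Rightarrow> 'p \<Rightarrow> 'p poly) \<Rightarrow> ('p \<Rightarrow> ('p, 'k) tensor2) \<Rightarrow> bool" where
  "lie_compatible br \<delta> \<longleftrightarrow> (\<forall>a b. \<forall>f\<in>Pd. \<forall>g\<in>Pd. \<forall>\<alpha> \<beta> \<gamma> \<kappa>. \<alpha> + \<beta> + \<gamma> + \<kappa> = 0 \<longrightarrow>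
      pair f \<gamma> g \<kappa> (\<delta> (evs s \<alpha> (br a b))) =
        \<delta> b (\<lambda>x y. pv f \<gamma> (evs s \<alpha> (br a x)) * pv g \<kappa> y)
        + \<delta> b (\<lambda>x y. pv f \<gamma> x * pv g \<kappa> (evs s \<alpha> (br a y)))
        - (\<delta> a (\<lambda>x y. pv f \<gamma> (evs s \<beta> (br b x)) * pv g \<kappa> y)
          + \<delta> a (\<lambda>x y. pv f \<gamma> x * pv g \<kappa> (evs s \<beta> (br b y)))))"

definition assoc_compatible :: "('p \<Rightarrow> 'p \<Rightarrow> 'p poly) \<Rightarrow> ('p \<Rightarrow> ('p, 'k) tensor2) \<Rightarrow> bool" where
  "assoc_compatible m \<Delta> \<longleftrightarrow> (\<forall>a b. \<forall>f\<in>Pd. \<forall>g\<in>Pd. \<forall>\<alpha> \<beta> \<gamma> \<kappa>. \<alpha> + \<beta> + \<gamma> + \<kappa> = 0 \<longrightarrow>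
      pair f \<gamma> g \<kappa> (\<Delta> (evs s \<alpha> (m a b))) =
        \<Delta> b (\<lambda>x y. pv f \<gamma> x * pv g \<kappa> (evs s \<alpha> (m a y)))
        + \<Delta> a (\<lambda>x y. pv f \<gamma> (evs s \<beta> (m b x)) * pv g \<kappa> y))"

definition leibniz_compatible :: "('p \<Rightarrow> 'p \<Rightarrow> 'p poly) \<Rightarrow> ('p \<Rightarrow> 'p \<Rightarrow> 'p poly) \<Rightarrow> ('p \<Rightarrow> ('p, 'k) tensor2) \<Rightarrow> ('p \<Rightarrow> ('p, 'k) tensor2) \<Rightarrow> bool" where
  "leibniz_compatible br m \<delta> \<Delta> \<longleftrightarrow> (\<forall>a b. \<forall>f\<in>Pd. \<forall>g\<in>Pd. \<forall>\<alpha> \<beta> \<gamma> \<kappa>. \<alpha> + \<beta> + \<gamma> + \<kappa> = 0 \<longrightarrow>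
      pair f \<gamma> g \<kappa> (\<delta> (evs s \<alpha> (m a b))) =
        \<delta> b (\<lambda>x y. pv f \<gamma> (evs s \<alpha> (m a x)) * pv g \<kappa> y)
        + \<delta> a (\<lambda>x y. pv f \<gamma> (evs s \<beta> (m b x)) * pv g \<kappa> y)
        + \<Delta> b (\<lambda>x y. pv f \<gamma> x * pv g \<kappa> (evs s \<alpha> (br a y)))
        + \<Delta> a (\<lambda>x y. pv f \<gamma> x * pv g \<kappa> (evs s \<beta> (br b y))))"

definition derivation_compatible :: "('p \<Rightarrow> 'p \<Rightarrow> 'p poly) \<Rightarrow> ('p \<Rightarrow> 'p \<Rightarrow> 'p poly) \<Rightarrow> ('p \<Rightarrow> ('p, 'k) tensor2) \<Rightarrow> ('p \<Rightarrow> ('p, 'k) tensor2) \<Rightarrow> bool" where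
  "derivation_compatible br m \<delta> \<Delta> \<longleftrightarrow> (\<forall>a b. \<forall>f\<in>Pd. \<forall>g\<in>Pd. \<forall>\<alpha> \<beta> \<gamma> \<kappa>. \<alpha> + \<beta> + \<gamma> + \<kappa> = 0 \<longrightarrow>
      pair f \<gamma> g \<kappa> (\<Delta> (evs s \<alpha> (br a b))) =
        \<Delta> b (\<lambda>x y. pv f \<gamma> (evs s \<alpha> (br a x)) * pv g \<kappa> y)
        + \<Delta> b (\<lambda>x y. pv f \<gamma> x * pv g \<kappa> (evs s \<alpha> (br a y)))
        - \<delta> a (\<lambda>x y. pv f \<gamma> x * pv g \<kappa> (evs s \<beta> (m b y)))
        + \<delta> a (\<lambda>x y. pv f \<gamma> (evs s \<beta> (m b x)) * pv g \<kappa> y))"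

lemma all_momenta_iff:
  "(\<forall>\<alpha> \<beta> \<gamma> \<kappa> :: 'k. \<alpha> + \<beta> + \<gamma> + \<kappa> = 0 \<longrightarrow> E \<alpha> \<beta> \<gamma> \<kappa>) \<longleftrightarrow> (\<forall>\<alpha> \<gamma> \<kappa>. E \<alpha> (- \<alpha> - \<gamma> - \<kappa>) \<gamma> \<kappa>)"
proof (intro iffI allI impI)
  fix \<alpha> \<beta> \<gamma> \<kappa> :: 'k
  assume "\<forall>\<alpha> \<gamma> \<kappa>. E \<alpha> (- \<alpha> - \<gamma> - \<kappa>) \<gamma> \<kappa>" "\<alpha> + \<beta> + \<gamma> + \<kappa> = 0"
  moreover from this(2) have "\<beta> = - \<alpha> - \<gamma> - \<kappa>" by algebra
  ultimately show "E \<alpha> \<beta> \<gamma> \<kappa>" by blast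
qed simp

text \<open>
  Both sides of each condition are polynomials with coefficients in \<open>P \<otimes> P\<close>,
  so they may be compared at scalars and on the separating functionals \<open>f\<^sub>\<gamma>
  \<otimes> g\<^sub>\<kappa>\<close>.
\<close>

theorem poisson_conformal_bialgebra_at_iff:
  assumes alg: "poisson_conformal s UNIV br m" and coalg: "poisson_conformal_coalgebra s UNIV \<delta> \<Delta>"
  shows "poisson_conformal_bialgebra s UNIV br m \<delta> \<Delta> \<longleftrightarrow>
    lie_compatible br \<delta> \<and> assoc_compatible m \<Delta> \<and>
    leibniz_compatible br m \<delta> \<Delta> \<and> derivation_compatible br m \<delta> \<Delta>"
proof -
  have D: "coproduct s UNIV \<delta>" "coproduct s UNIV \<Delta>"
    using coalg by (auto simp: poisson_conformal_coalgebra_def lie_conformal_coalgebra_def cocomm_coassoc_conformal_def)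
  have "k_linear (br a)" "k_linear (m a)" for a
    using alg by (auto simp: poisson_conformal_at_iff gc_hom_def conformal_map_def)
  note T = this
  note op_mem = op_left_mem op_right_mem op_left_flip_mem op_right_flip_mem
  note op_at = op_left_at op_right_at op_left_flip_at op_right_flip_at
  note mem = op_mem[OF T(1) coproduct_mem[OF D(1)]] op_mem[OF T(1) coproduct_mem[OF D(2)]]
    op_mem[OF T(2) coproduct_mem[OF D(1)]] op_mem[OF T(2) coproduct_mem[OF D(2)]]
  note at = op_at[OF T(1) coproduct_mem[OF D(1)]] op_at[OF T(1) coproduct_mem[OF D(2)]]
    op_at[OF T(2) coproduct_mem[OF D(1)]] op_at[OF T(2) coproduct_mem[OF D(2)]]
  have form: "linear_form (\<lambda>c::'k. map_poly (tensor_scale c)) (hat (pair f \<gamma> g \<kappa>) \<alpha>)"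
    for f g :: "'p \<Rightarrow> 'k poly" and \<gamma> \<kappa> \<alpha>
    by (rule linear_form_hat[OF linear_form_apply]) (simp add: tensor_scale_def fun_eq_iff)
  have map_mem: "coeff (map_poly E p) n \<in> S2" if "coproduct s UNIV E" for E and p :: "'p poly" and n
  proof -
    have "E 0 = 0" using that unfolding coproduct_def by (metis UNIV_I add_cancel_left_left)
    then show ?thesis using coproduct_mem[OF that] by (simp add: coeff_map_poly)
  qed
  note hats = linear_form_add[OF form] linear_form_diff[OF form] hat_cop[OF D(1)] hat_cop[OF D(2)] at
  note mems = map_mem[OF D(1)] map_mem[OF D(2)] mem S2_closed(2,3)
  let ?E1 = "\<lambda>a b. map_poly \<delta> (br a b) =
          op_left s UNIV (br a) (\<delta> b) + op_right s UNIV (br a) (\<delta> b)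
          - (op_left_flip s UNIV (br b) (\<delta> a) + op_right_flip s UNIV (br b) (\<delta> a))"
  let ?E2 = "\<lambda>a b. map_poly \<Delta> (m a b) =
          op_right s UNIV (m a) (\<Delta> b) + op_left_flip s UNIV (m b) (\<Delta> a)"
  let ?E3 = "\<lambda>a b. map_poly \<delta> (m a b) =
          op_left s UNIV (m a) (\<delta> b) + op_left_flip s UNIV (m b) (\<delta> a)
          + op_right s UNIV (br a) (\<Delta> b) + op_right_flip s UNIV (br b) (\<Delta> a)"
  let ?E4 = "\<lambda>a b. map_poly \<Delta> (br a b) =
          op_left s UNIV (br a) (\<Delta> b) + op_right s UNIV (br a) (\<Delta> b)
          - op_right_flip s UNIV (m b) (\<delta> a) + op_left_flip s UNIV (m b) (\<delta> a)"
  have "(\<forall>a b. ?E1 a b) \<longleftrightarrow> lie_compatible br \<delta>"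
    unfolding lie_compatible_def all_momenta_iff by (subst poly_S2_eq_iff; simp add: mems hats)
  moreover have "(\<forall>a b. ?E2 a b) \<longleftrightarrow> assoc_compatible m \<Delta>"
    unfolding assoc_compatible_def all_momenta_iff by (subst poly_S2_eq_iff; simp add: mems hats)
  moreover have "(\<forall>a b. ?E3 a b) \<longleftrightarrow> leibniz_compatible br m \<delta> \<Delta>"
    unfolding leibniz_compatible_def all_momenta_iff by (subst poly_S2_eq_iff; simp add: mems hats)
  moreover have "(\<forall>a b. ?E4 a b) \<longleftrightarrow> derivation_compatible br m \<delta> \<Delta>"
    unfolding derivation_compatible_def all_momenta_iff by (subst poly_S2_eq_iff; simp add: mems hats)
  ultimately show ?thesis
    unfolding poisson_conformal_bialgebra_def using alg coalg by blast
qed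

end

section \<open>Invariant forms and quartic identities\<close>

text \<open>
  The number \<open>\<kappa> \<nu> x y\<close> stands for \<open>\<langle>x,
  y\<rangle>\<^sub>\<nu>\<close>. The pairings with elements of \<open>R\<close> are linear and
  separating on the whole type, so that equations between elements can be tested before they are
  known to lie in \<open>R\<close>.
\<close>

locale conformal_pairing =
  fixes s :: "'k::field_char_0 poly \<Rightarrow> 'v::ab_group_add \<Rightarrow> 'v" and R :: "'v set"
    and \<kappa> :: "'k \<Rightarrow> 'v \<Rightarrow> 'v \<Rightarrow> 'k"
  assumes s: "module s" and R: "module.subspace s R"
    and form: "y \<in> R \<Longrightarrow> momentum_form s (- \<nu>) (\<lambda>x. \<kappa> \<nu> x y)"
    and sym: "x \<in> R \<Longrightarrow> y \<in> R \<Longrightarrow> \<kappa> \<nu> x y = \<kappa> (- \<nu>) y x"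
    and separates: "(\<And>y \<nu>. y \<in> R \<Longrightarrow> \<kappa> \<nu> x y = 0) \<Longrightarrow> x = 0"
begin

lemma kappa_linear:
  assumes "y \<in> R"
  shows "\<kappa> \<nu> (x + x') y = \<kappa> \<nu> x y + \<kappa> \<nu> x' y" "\<kappa> \<nu> (kscale s c x) y = c * \<kappa> \<nu> x y"
    "\<kappa> \<nu> (der s x) y = - \<nu> * \<kappa> \<nu> x y" "\<kappa> \<nu> (- x) y = - \<kappa> \<nu> x y" "\<kappa> \<nu> (x - x') y = \<kappa> \<nu> x y - \<kappa> \<nu> x' y"
  using form[OF assms] linear_form_simps[of "kscale s" "\<lambda>x. \<kappa> \<nu> x y"]
  by (auto simp: momentum_form_def)

lemma R_closed: "x \<in> R \<Longrightarrow> y \<in> R \<Longrightarrow> x + y \<in> R" "x \<in> R \<Longrightarrow> kscale s c x \<in> R" "x \<in> R \<Longrightarrow> der s x \<in> R"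
  using R s der_mem[OF s R] by (auto simp: module.subspace_def[OF s] kscale_def)

lemma kappa_right:
  assumes "x \<in> R" "y \<in> R" "y' \<in> R"
  shows "\<kappa> \<nu> x (y + y') = \<kappa> \<nu> x y + \<kappa> \<nu> x y'" "\<kappa> \<nu> x (kscale s c y) = c * \<kappa> \<nu> x y"
    "\<kappa> \<nu> x (der s y) = \<nu> * \<kappa> \<nu> x y"
  using assms by (simp_all add: sym[of x] R_closed kappa_linear)

lemma kappa_eqI: "(\<And>y \<nu>. y \<in> R \<Longrightarrow> \<kappa> \<nu> x y = \<kappa> \<nu> x' y) \<Longrightarrow> x = x'"
  using separates[of "x - x'"] by (simp add: kappa_linear)

text \<open>
  Invariance of the form for the product \<open>M\<close>, see \<open>invariant_form_iff\<close>:
  the element \<open>z\<close> has momentum \<open>\<gamma>\<close>, and \<open>x, y, z\<close>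
  are rotated.
\<close>

definition cyclic :: "('v \<Rightarrow> 'v \<Rightarrow> 'v poly) \<Rightarrow> bool" where
  "cyclic M \<longleftrightarrow> (\<forall>x\<in>R. \<forall>y\<in>R. \<forall>z\<in>R. \<forall>\<alpha> \<beta> \<gamma>. \<alpha> + \<beta> + \<gamma> = 0 \<longrightarrow>
     \<kappa> (\<alpha> + \<beta>) (evs s \<alpha> (M x y)) z = \<kappa> (\<beta> + \<gamma>) (evs s \<beta> (M y z)) x)"

lemma flip_symmetric_kappa:
  "flip_symmetric s R \<epsilon> M \<longleftrightarrow> (\<forall>x\<in>R. \<forall>y\<in>R. \<forall>z\<in>R. \<forall>\<alpha> \<beta>.
     \<kappa> (\<alpha> + \<beta>) (evs s \<alpha> (M x y)) z = \<epsilon> * \<kappa> (\<alpha> + \<beta>) (evs s \<beta> (M y x)) z)"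
proof -
  have "flip_symmetric s R \<epsilon> M \<longleftrightarrow> (\<forall>x\<in>R. \<forall>y\<in>R. \<forall>z\<in>R. \<forall>\<nu> \<alpha>.
     \<kappa> \<nu> (evs s \<alpha> (M x y)) z = \<epsilon> * \<kappa> \<nu> (evs s (- \<alpha> + \<nu>) (M y x)) z)"
    by (subst flip_symmetric_iff[OF s, where I = "UNIV \<times> R" and d = "\<lambda>(\<nu>, y). - \<nu>"
          and \<psi> = "\<lambda>(\<nu>, y) x. \<kappa> \<nu> x y"]) (auto simp: form intro: separates)
  moreover have "(\<forall>\<nu> \<alpha>. \<kappa> \<nu> (evs s \<alpha> (M x y)) z = \<epsilon> * \<kappa> \<nu> (evs s (- \<alpha> + \<nu>) (M y x)) z) \<longleftrightarrow>
    (\<forall>\<alpha> \<beta>. \<kappa> (\<alpha> + \<beta>) (evs s \<alpha> (M x y)) z = \<epsilon> * \<kappa> (\<alpha> + \<beta>) (evs s \<beta> (M y x)) z)" for x y z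
  proof (intro iffI allI)
    fix \<alpha> \<beta> assume "\<forall>\<nu> \<alpha>. \<kappa> \<nu> (evs s \<alpha> (M x y)) z = \<epsilon> * \<kappa> \<nu> (evs s (- \<alpha> + \<nu>) (M y x)) z"
    from this[rule_format, of "\<alpha> + \<beta>" \<alpha>]
    show "\<kappa> (\<alpha> + \<beta>) (evs s \<alpha> (M x y)) z = \<epsilon> * \<kappa> (\<alpha> + \<beta>) (evs s \<beta> (M y x)) z" by simp
  next
    fix \<nu> \<alpha> assume "\<forall>\<alpha> \<beta>. \<kappa> (\<alpha> + \<beta>) (evs s \<alpha> (M x y)) z = \<epsilon> * \<kappa> (\<alpha> + \<beta>) (evs s \<beta> (M y x)) z"
    from this[rule_format, of \<alpha> "- \<alpha> + \<nu>"]
    show "\<kappa> \<nu> (evs s \<alpha> (M x y)) z = \<epsilon> * \<kappa> \<nu> (evs s (- \<alpha> + \<nu>) (M y x)) z" by simp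
  qed
  ultimately show ?thesis by simp
qed

text \<open>
  \<open>\<langle>x\<^sub>\<alpha> y, z\<^sub>\<gamma> w\<rangle>\<close> at \<open>\<alpha> +
  \<beta>\<close>. The momentum \<open>\<delta>\<close> of \<open>w\<close> is determined by
  \<open>\<alpha> + \<beta> + \<gamma> + \<delta> = 0\<close>; it is an argument in order that
  permutations of the four elements can be written down.
\<close>

definition quartic :: "('v \<Rightarrow> 'v \<Rightarrow> 'v poly) \<Rightarrow> ('v \<Rightarrow> 'v \<Rightarrow> 'v poly) \<Rightarrow>
    'v \<Rightarrow> 'k \<Rightarrow> 'v \<Rightarrow> 'k \<Rightarrow> 'v \<Rightarrow> 'k \<Rightarrow> 'v \<Rightarrow> 'k \<Rightarrow> 'k" where
  "quartic M N x \<alpha> y \<beta> z \<gamma> w \<delta> = \<kappa> (\<alpha> + \<beta>) (evs s \<alpha> (M x y)) (evs s \<gamma> (N z w))"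

context
  fixes M N :: "'v \<Rightarrow> 'v \<Rightarrow> 'v poly" and \<epsilon> \<epsilon>' :: 'k
  assumes M: "gc_hom s R s R M" and N: "gc_hom s R s R N"
begin

lemma ev_closed: "x \<in> R \<Longrightarrow> y \<in> R \<Longrightarrow> evs s \<alpha> (M x y) \<in> R" "x \<in> R \<Longrightarrow> y \<in> R \<Longrightarrow> evs s \<alpha> (N x y) \<in> R"
  using gc_homD(2)[OF s R M] gc_homD(2)[OF s R N] by auto

lemma quartic_commute:
  assumes "x \<in> R" "y \<in> R" "z \<in> R" "w \<in> R" "\<alpha> + \<beta> + \<gamma> + \<delta> = 0"
  shows "quartic M N x \<alpha> y \<beta> z \<gamma> w \<delta> = quartic N M z \<gamma> w \<delta> x \<alpha> y \<beta>"
proof -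
  have "- (\<alpha> + \<beta>) = \<gamma> + \<delta>" using assms(5) by algebra
  then show ?thesis
    using assms sym[of "evs s \<alpha> (M x y)" "evs s \<gamma> (N z w)" "\<alpha> + \<beta>"] by (simp add: quartic_def ev_closed)
qed

lemma quartic_swap:
  assumes "flip_symmetric s R \<epsilon> M" "x \<in> R" "y \<in> R" "z \<in> R" "w \<in> R"
  shows "quartic M N x \<alpha> y \<beta> z \<gamma> w \<delta> = \<epsilon> * quartic M N y \<beta> x \<alpha> z \<gamma> w \<delta>"
proof -
  have "evs s \<gamma> (N z w) \<in> R" using assms by (simp add: ev_closed)
  then show ?thesis
    using assms unfolding flip_symmetric_kappa quartic_def add.commute[of \<beta>] by blast
qed

lemma quartic_add:
  assumes "x \<in> R" "x' \<in> R" "y \<in> R" "z \<in> R" "w \<in> R"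
  shows "quartic M N (x + x') \<alpha> y \<beta> z \<gamma> w \<delta> = quartic M N x \<alpha> y \<beta> z \<gamma> w \<delta> + quartic M N x' \<alpha> y \<beta> z \<gamma> w \<delta>"
    "quartic M N y \<beta> (x + x') \<alpha> z \<gamma> w \<delta> = quartic M N y \<beta> x \<alpha> z \<gamma> w \<delta> + quartic M N y \<beta> x' \<alpha> z \<gamma> w \<delta>"
    "quartic M N y \<beta> z \<gamma> (x + x') \<alpha> w \<delta> = quartic M N y \<beta> z \<gamma> x \<alpha> w \<delta> + quartic M N y \<beta> z \<gamma> x' \<alpha> w \<delta>"
    "quartic M N y \<beta> z \<gamma> w \<delta> (x + x') \<alpha> = quartic M N y \<beta> z \<gamma> w \<delta> x \<alpha> + quartic M N y \<beta> z \<gamma> w \<delta> x' \<alpha>"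
  using assms gc_homD[OF s R M] gc_homD[OF s R N] by (auto simp: quartic_def kappa_linear kappa_right)

text \<open>
  Rotating the outer product once, or twice in the next lemma, moves one of its factors to the
  other side of the form.
\<close>

lemma kappa_nest_left:
  assumes cyc: "cyclic N" and mem: "x \<in> R" "y \<in> R" "z \<in> R" "w \<in> R" and sum: "\<alpha> + \<beta> + \<gamma> + \<delta> = 0"
  shows "\<kappa> (- \<delta>) (evs s (\<alpha> + \<beta>) (N (evs s \<alpha> (M x y)) z)) w = quartic M N x \<alpha> y \<beta> z \<gamma> w \<delta>"
proof -
  have eq: "- \<delta> = \<alpha> + \<beta> + \<gamma>" "- (\<gamma> + \<delta>) = \<alpha> + \<beta>"
    using sum by algebra+
  have "\<kappa> (\<alpha> + \<beta> + \<gamma>) (evs s (\<alpha> + \<beta>) (N (evs s \<alpha> (M x y)) z)) w = \<kappa> (\<gamma> + \<delta>) (evs s \<gamma> (N z w)) (evs s \<alpha> (M x y))"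
    using cyc mem sum by (simp add: cyclic_def ev_closed)
  also have "\<dots> = \<kappa> (\<alpha> + \<beta>) (evs s \<alpha> (M x y)) (evs s \<gamma> (N z w))"
    using sym[of "evs s \<gamma> (N z w)" "evs s \<alpha> (M x y)" "\<gamma> + \<delta>"] mem by (simp only: ev_closed eq)
  finally show ?thesis by (simp only: quartic_def eq)
qed

lemma kappa_nest_right:
  assumes cyc: "cyclic M" and mem: "x \<in> R" "y \<in> R" "z \<in> R" "w \<in> R" and sum: "\<alpha> + \<beta> + \<gamma> + \<delta> = 0"
  shows "\<kappa> (- \<delta>) (evs s \<alpha> (M x (evs s \<beta> (N y z)))) w = quartic M N w \<delta> x \<alpha> y \<beta> z \<gamma>"
proof -
  let ?u = "evs s \<beta> (N y z)"
  have u: "?u \<in> R" using mem by (simp add: ev_closed)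
  have eq: "- \<delta> = \<alpha> + (\<beta> + \<gamma>)"
    using sum by algebra
  have sum': "\<alpha> + (\<beta> + \<gamma>) + \<delta> = 0" "\<beta> + \<gamma> + \<delta> + \<alpha> = 0" using sum by (simp add: add_ac)+
  have "\<kappa> (\<alpha> + (\<beta> + \<gamma>)) (evs s \<alpha> (M x ?u)) w = \<kappa> (\<beta> + \<gamma> + \<delta>) (evs s (\<beta> + \<gamma>) (M ?u w)) x"
    using cyc mem u sum' unfolding cyclic_def by blast
  also have "\<dots> = \<kappa> (\<delta> + \<alpha>) (evs s \<delta> (M w x)) ?u"
    using cyc mem u sum' unfolding cyclic_def by blast
  finally show ?thesis by (simp only: quartic_def eq)
qed

end

text \<open>
  Only momenta with sum zero are admitted: these are the quadruples on which the arguments of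
  \<open>quartic\<close> can be permuted.
\<close>

definition for_quadruples :: "('v \<Rightarrow> 'k \<Rightarrow> 'v \<Rightarrow> 'k \<Rightarrow> 'v \<Rightarrow> 'k \<Rightarrow> 'v \<Rightarrow> 'k \<Rightarrow> bool) \<Rightarrow>
    'v set \<Rightarrow> 'v set \<Rightarrow> 'v set \<Rightarrow> 'v set \<Rightarrow> bool" where
  "for_quadruples E X Y Z W \<longleftrightarrow> (\<forall>x\<in>X. \<forall>y\<in>Y. \<forall>z\<in>Z. \<forall>w\<in>W. \<forall>\<alpha> \<beta> \<gamma> \<delta>.
     \<alpha> + \<beta> + \<gamma> + \<delta> = 0 \<longrightarrow> E x \<alpha> y \<beta> z \<gamma> w \<delta>)"

text \<open>
  The Leibniz rule for \<open>x, y, z\<close> paired with \<open>w\<close>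
  (\<open>kappa_leibniz\<close>); it is cyclic in \<open>y, z, w\<close>. For \<open>m =
  br\<close> it is the Jacobi identity.
\<close>

definition leibniz4 :: "('v \<Rightarrow> 'v \<Rightarrow> 'v poly) \<Rightarrow> ('v \<Rightarrow> 'v \<Rightarrow> 'v poly) \<Rightarrow>
    'v \<Rightarrow> 'k \<Rightarrow> 'v \<Rightarrow> 'k \<Rightarrow> 'v \<Rightarrow> 'k \<Rightarrow> 'v \<Rightarrow> 'k \<Rightarrow> bool" where
  "leibniz4 br m x \<alpha> y \<beta> z \<gamma> w \<delta> \<longleftrightarrow>
     quartic br m x \<alpha> y \<beta> z \<gamma> w \<delta> + quartic br m x \<alpha> z \<gamma> w \<delta> y \<beta> + quartic br m x \<alpha> w \<delta> y \<beta> z \<gamma> = 0"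

text \<open>
  The second equation is associativity for \<open>x, y, z\<close> paired with \<open>w\<close>
  (\<open>kappa_assoc\<close>). Adding the first one makes the condition invariant under all
  permutations, because \<open>x, y, z, w\<close> can be split into two pairs in three ways.
\<close>

definition assoc4 :: "('v \<Rightarrow> 'v \<Rightarrow> 'v poly) \<Rightarrow>
    'v \<Rightarrow> 'k \<Rightarrow> 'v \<Rightarrow> 'k \<Rightarrow> 'v \<Rightarrow> 'k \<Rightarrow> 'v \<Rightarrow> 'k \<Rightarrow> bool" where
  "assoc4 m x \<alpha> y \<beta> z \<gamma> w \<delta> \<longleftrightarrow>
     quartic m m x \<alpha> y \<beta> z \<gamma> w \<delta> = quartic m m x \<alpha> z \<gamma> y \<beta> w \<delta> \<and>
     quartic m m x \<alpha> y \<beta> z \<gamma> w \<delta> = quartic m m x \<alpha> w \<delta> y \<beta> z \<gamma>"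

lemma quartic_swap_right:
  assumes M: "gc_hom s R s R M" and N: "gc_hom s R s R N" and sym: "flip_symmetric s R \<epsilon> N"
    and mem: "x \<in> R" "y \<in> R" "z \<in> R" "w \<in> R" and sum: "\<alpha> + \<beta> + \<gamma> + \<delta> = 0"
  shows "quartic M N x \<alpha> y \<beta> z \<gamma> w \<delta> = \<epsilon> * quartic M N x \<alpha> y \<beta> w \<delta> z \<gamma>"
proof -
  have sums: "\<gamma> + \<delta> + \<alpha> + \<beta> = 0" "\<delta> + \<gamma> + \<alpha> + \<beta> = 0" "\<alpha> + \<beta> + \<delta> + \<gamma> = 0" using sum by (simp_all add: add_ac)
  show ?thesis
    using quartic_commute[OF M N mem(1,2,3,4) sum] quartic_commute[OF M N mem(1,2,4,3) sums(3)]
      quartic_swap[OF N M sym mem(3,4,1,2), of \<gamma> \<delta> \<alpha> \<beta>] by simp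
qed

subsection \<open>The axioms as quartic identities\<close>

context
  fixes br m :: "'v \<Rightarrow> 'v \<Rightarrow> 'v poly" and \<epsilon> :: 'k
  assumes br: "gc_hom s R s R br" "cyclic br" "flip_symmetric s R (- 1) br"
    and m: "gc_hom s R s R m" "cyclic m" "flip_symmetric s R \<epsilon> m"
begin

lemma kappa_leibniz:
  assumes mem: "x \<in> R" "y \<in> R" "z \<in> R" "w \<in> R" and sum: "\<alpha> + \<beta> + \<gamma> + \<delta> = 0"
  shows "\<kappa> (- \<delta>) (evs s \<alpha> (br x (evs s \<beta> (m y z)))) w =
      \<kappa> (- \<delta>) (evs s (\<alpha> + \<beta>) (m (evs s \<alpha> (br x y)) z) + evs s \<beta> (m y (evs s \<alpha> (br x z)))) w \<longleftrightarrow>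
    leibniz4 br m x \<alpha> y \<beta> z \<gamma> w \<delta>"
proof -
  have sums: "\<beta> + \<alpha> + \<gamma> + \<delta> = 0" "\<delta> + \<beta> + \<alpha> + \<gamma> = 0" using sum by (simp_all add: add_ac)
  have 1: "\<kappa> (- \<delta>) (evs s \<alpha> (br x (evs s \<beta> (m y z)))) w = - quartic br m x \<alpha> w \<delta> y \<beta> z \<gamma>"
    unfolding kappa_nest_right[OF br(1) m(1) br(2) mem sum]
    using quartic_swap[OF br(1) m(1) br(3) mem(4,1,2,3)] by simp
  have 2: "\<kappa> (- \<delta>) (evs s (\<alpha> + \<beta>) (m (evs s \<alpha> (br x y)) z)) w = quartic br m x \<alpha> y \<beta> z \<gamma> w \<delta>"
    by (rule kappa_nest_left[OF br(1) m(1) m(2) mem sum])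
  have 3: "\<kappa> (- \<delta>) (evs s \<beta> (m y (evs s \<alpha> (br x z)))) w = quartic br m x \<alpha> z \<gamma> w \<delta> y \<beta>"
    unfolding kappa_nest_right[OF m(1) br(1) m(2) mem(2,1,3,4) sums(1)]
    by (rule quartic_commute[OF m(1) br(1) mem(4,2,1,3) sums(2)])
  show ?thesis
    unfolding kappa_linear[OF mem(4)] 1 2 3 leibniz4_def by algebra
qed

lemma leibniz4_sub:
  assumes "U \<subseteq> R" "leibniz_at s U br m"
  shows "for_quadruples (leibniz4 br m) U U U R"
  unfolding for_quadruples_def
proof (intro ballI allI impI)
  fix x y z w and \<alpha> \<beta> \<gamma> \<delta> :: 'k assume mem: "x \<in> U" "y \<in> U" "z \<in> U" "w \<in> R" and sum: "\<alpha> + \<beta> + \<gamma> + \<delta> = 0"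
  then have "evs s \<alpha> (br x (evs s \<beta> (m y z))) =
      evs s (\<alpha> + \<beta>) (m (evs s \<alpha> (br x y)) z) + evs s \<beta> (m y (evs s \<alpha> (br x z)))"
    using assms(2) unfolding leibniz_at_def by blast
  moreover have "x \<in> R" "y \<in> R" "z \<in> R" using assms(1) mem by auto
  ultimately show "leibniz4 br m x \<alpha> y \<beta> z \<gamma> w \<delta>"
    using kappa_leibniz[of x y z w \<alpha> \<beta> \<gamma> \<delta>] mem(4) sum by simp
qed

lemma leibniz4_iff: "leibniz_at s R br m \<longleftrightarrow> for_quadruples (leibniz4 br m) R R R R"
proof
  assume *: "for_quadruples (leibniz4 br m) R R R R"
  show "leibniz_at s R br m"
    unfolding leibniz_at_def
  proof (intro ballI allI kappa_eqI)
    fix x y z w and \<alpha> \<beta> \<nu> :: 'k assume mem: "x \<in> R" "y \<in> R" "z \<in> R" "w \<in> R"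
    have sum: "\<alpha> + \<beta> + (\<nu> - \<alpha> - \<beta>) + - \<nu> = 0" by simp
    then have "leibniz4 br m x \<alpha> y \<beta> z (\<nu> - \<alpha> - \<beta>) w (- \<nu>)"
      using * mem unfolding for_quadruples_def by blast
    then show "\<kappa> \<nu> (evs s \<alpha> (br x (evs s \<beta> (m y z)))) w =
      \<kappa> \<nu> (evs s (\<alpha> + \<beta>) (m (evs s \<alpha> (br x y)) z) + evs s \<beta> (m y (evs s \<alpha> (br x z)))) w"
      unfolding kappa_leibniz[OF mem sum, symmetric] by simp
  qed
qed (rule leibniz4_sub; simp)

lemma leibniz4_perm:
  assumes mem: "x \<in> R" "y \<in> R" "z \<in> R" "w \<in> R" and sum: "\<alpha> + \<beta> + \<gamma> + \<delta> = 0"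
    and E: "leibniz4 br m x \<alpha> y \<beta> z \<gamma> w \<delta>"
  shows "leibniz4 br m x \<alpha> z \<gamma> y \<beta> w \<delta>" "leibniz4 br m x \<alpha> y \<beta> w \<delta> z \<gamma>"
proof -
  have sums: "\<alpha> + \<gamma> + \<beta> + \<delta> = 0" "\<alpha> + \<beta> + \<delta> + \<gamma> = 0" "\<alpha> + \<delta> + \<gamma> + \<beta> = 0" using sum by (simp_all add: add_ac)
  note swap = quartic_swap_right[OF br(1) m(1) m(3)]
  note eqs = swap[OF mem(1,3,2,4) sums(1)] swap[OF mem(1,2,4,3) sums(2)] swap[OF mem(1,4,3,2) sums(3)]
  have sum0: "quartic br m x \<alpha> y \<beta> z \<gamma> w \<delta> + quartic br m x \<alpha> z \<gamma> w \<delta> y \<beta> + quartic br m x \<alpha> w \<delta> y \<beta> z \<gamma> = 0"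
    using E by (simp add: leibniz4_def)
  show "leibniz4 br m x \<alpha> z \<gamma> y \<beta> w \<delta>" unfolding leibniz4_def eqs using sum0 by algebra
  show "leibniz4 br m x \<alpha> y \<beta> w \<delta> z \<gamma>" unfolding leibniz4_def eqs using sum0 by algebra
qed

lemma leibniz4_add:
  assumes "x \<in> R" "x' \<in> R" "y \<in> R" "z \<in> R" "w \<in> R"
  shows "leibniz4 br m x \<alpha> y \<beta> z \<gamma> w \<delta> \<Longrightarrow> leibniz4 br m x' \<alpha> y \<beta> z \<gamma> w \<delta> \<Longrightarrow> leibniz4 br m (x + x') \<alpha> y \<beta> z \<gamma> w \<delta>"
    "leibniz4 br m y \<beta> x \<alpha> z \<gamma> w \<delta> \<Longrightarrow> leibniz4 br m y \<beta> x' \<alpha> z \<gamma> w \<delta> \<Longrightarrow> leibniz4 br m y \<beta> (x + x') \<alpha> z \<gamma> w \<delta>"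
  unfolding leibniz4_def using assms by (simp_all add: quartic_add[OF br(1) m(1)]) algebra+

end

text \<open>
  Add the Leibniz identities whose first arguments are \<open>y\<close>, \<open>z\<close> and
  \<open>w\<close>. The terms in which the bracket contains two of \<open>y, z, w\<close> cancel
  in pairs by skew-symmetry, and the others form the identity for \<open>x\<close>.
\<close>

lemma leibniz4_rotate:
  assumes br: "gc_hom s R s R br" "flip_symmetric s R (- 1) br"
    and m: "gc_hom s R s R m" "flip_symmetric s R 1 m"
    and mem: "x \<in> R" "y \<in> R" "z \<in> R" "w \<in> R" and sum: "\<alpha> + \<beta> + \<gamma> + \<delta> = 0"
    and E: "leibniz4 br m y \<beta> z \<gamma> w \<delta> x \<alpha>" "leibniz4 br m z \<gamma> w \<delta> y \<beta> x \<alpha>" "leibniz4 br m w \<delta> y \<beta> z \<gamma> x \<alpha>"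
  shows "leibniz4 br m x \<alpha> y \<beta> z \<gamma> w \<delta>"
proof -
  have sums: "\<gamma> + \<delta> + \<beta> + \<alpha> = 0" "\<delta> + \<beta> + \<alpha> + \<gamma> = 0" "\<gamma> + \<beta> + \<alpha> + \<delta> = 0" "\<alpha> + \<gamma> + \<beta> + \<delta> = 0"
    "\<beta> + \<delta> + \<alpha> + \<gamma> = 0" "\<delta> + \<gamma> + \<alpha> + \<beta> = 0"
    using sum by (simp_all add: add_ac)
  note r = quartic_swap_right[OF br(1) m] and l = quartic_swap[OF br(1) m(1) br(2)]
  have "quartic br m y \<beta> x \<alpha> z \<gamma> w \<delta> = - quartic br m x \<alpha> y \<beta> z \<gamma> w \<delta>"
    "quartic br m z \<gamma> x \<alpha> w \<delta> y \<beta> = - quartic br m x \<alpha> z \<gamma> w \<delta> y \<beta>"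
    "quartic br m w \<delta> x \<alpha> y \<beta> z \<gamma> = - quartic br m x \<alpha> w \<delta> y \<beta> z \<gamma>"
    "quartic br m y \<beta> w \<delta> x \<alpha> z \<gamma> = - quartic br m w \<delta> y \<beta> x \<alpha> z \<gamma>"
    "quartic br m z \<gamma> y \<beta> x \<alpha> w \<delta> = - quartic br m y \<beta> z \<gamma> x \<alpha> w \<delta>"
    "quartic br m w \<delta> z \<gamma> x \<alpha> y \<beta> = - quartic br m z \<gamma> w \<delta> x \<alpha> y \<beta>"
    using l[OF mem(2,1,3,4)] l[OF mem(3,1,4,2)] l[OF mem(4,1,2,3)] l[OF mem(2,4,1,3)]
      l[OF mem(3,2,1,4)] l[OF mem(4,3,1,2)] by simp_all
  moreover have "quartic br m w \<delta> y \<beta> z \<gamma> x \<alpha> = quartic br m w \<delta> y \<beta> x \<alpha> z \<gamma>"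
    "quartic br m y \<beta> z \<gamma> w \<delta> x \<alpha> = quartic br m y \<beta> z \<gamma> x \<alpha> w \<delta>"
    "quartic br m z \<gamma> w \<delta> y \<beta> x \<alpha> = quartic br m z \<gamma> w \<delta> x \<alpha> y \<beta>"
    using r[OF mem(4,2,3,1), of \<delta> \<beta> \<gamma> \<alpha>] r[OF mem(2,3,4,1), of \<beta> \<gamma> \<delta> \<alpha>] r[OF mem(3,4,2,1), of \<gamma> \<delta> \<beta> \<alpha>] sum
    by (simp_all add: add_ac)
  moreover have "quartic br m x \<alpha> z \<gamma> w \<delta> y \<beta> = quartic br m x \<alpha> z \<gamma> w \<delta> y \<beta>" ..
  ultimately show ?thesis using E unfolding leibniz4_def by algebra
qed

text \<open>
  If both products are the bracket, the two halves of \<open>quartic\<close> can be exchanged, so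
  the identity is invariant under cyclic rotations of all four arguments.
\<close>

lemma jacobi4_swap:
  assumes br: "gc_hom s R s R br" "flip_symmetric s R (- 1) br"
    and mem: "x \<in> R" "y \<in> R" "z \<in> R" "w \<in> R" and sum: "\<alpha> + \<beta> + \<gamma> + \<delta> = 0"
    and E: "leibniz4 br br y \<beta> z \<gamma> w \<delta> x \<alpha>"
  shows "leibniz4 br br x \<alpha> y \<beta> z \<gamma> w \<delta>"
proof -
  note l = quartic_swap[OF br(1) br(1) br(2)]
  have "quartic br br y \<beta> x \<alpha> z \<gamma> w \<delta> = - quartic br br x \<alpha> y \<beta> z \<gamma> w \<delta>"
    using l[OF mem(2,1,3,4)] by simp
  moreover have "quartic br br y \<beta> z \<gamma> w \<delta> x \<alpha> = - quartic br br x \<alpha> w \<delta> y \<beta> z \<gamma>"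
    using quartic_commute[OF br(1) br(1) mem(2,3,4,1), of \<beta> \<gamma> \<delta> \<alpha>] l[OF mem(4,1,2,3)] sum by (simp add: add_ac)
  moreover have "quartic br br y \<beta> w \<delta> x \<alpha> z \<gamma> = - quartic br br x \<alpha> z \<gamma> w \<delta> y \<beta>"
    using quartic_commute[OF br(1) br(1) mem(2,4,1,3), of \<beta> \<delta> \<alpha> \<gamma>]
      quartic_swap_right[OF br(1) br(1) br(2) mem(1,3,2,4), of \<alpha> \<gamma> \<beta> \<delta>] sum by (simp add: add_ac)
  ultimately show ?thesis using E unfolding leibniz4_def by algebra
qed

context
  fixes m :: "'v \<Rightarrow> 'v \<Rightarrow> 'v poly"
  assumes m: "gc_hom s R s R m" "cyclic m" "flip_symmetric s R 1 m"
begin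

lemma kappa_assoc:
  assumes mem: "x \<in> R" "y \<in> R" "z \<in> R" "w \<in> R" and sum: "\<alpha> + \<beta> + \<gamma> + \<delta> = 0"
  shows "\<kappa> (- \<delta>) (evs s (\<alpha> + \<beta>) (m (evs s \<alpha> (m x y)) z)) w =
      \<kappa> (- \<delta>) (evs s \<alpha> (m x (evs s \<beta> (m y z)))) w \<longleftrightarrow>
    quartic m m x \<alpha> y \<beta> z \<gamma> w \<delta> = quartic m m x \<alpha> w \<delta> y \<beta> z \<gamma>"
  unfolding kappa_nest_right[OF m(1,1,2) mem sum] kappa_nest_left[OF m(1,1,2) mem sum]
  using quartic_swap[OF m(1,1,3) mem(4,1,2,3)] by simp

lemma assoc4_sub:
  assumes "U \<subseteq> R" "assoc_at s U m"
  shows "for_quadruples (assoc4 m) U U U R"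
  unfolding for_quadruples_def
proof (intro ballI allI impI)
  have *: "quartic m m x \<alpha> y \<beta> z \<gamma> w \<delta> = quartic m m x \<alpha> w \<delta> y \<beta> z \<gamma>"
    if mem: "x \<in> U" "y \<in> U" "z \<in> U" "w \<in> R" and sum: "\<alpha> + \<beta> + \<gamma> + \<delta> = 0" for x y z w \<alpha> \<beta> \<gamma> \<delta>
  proof -
    have "evs s (\<alpha> + \<beta>) (m (evs s \<alpha> (m x y)) z) = evs s \<alpha> (m x (evs s \<beta> (m y z)))"
      using assms(2) mem unfolding assoc_at_def by blast
    moreover have "x \<in> R" "y \<in> R" "z \<in> R" using assms(1) mem by auto
    ultimately show ?thesis using kappa_assoc[of x y z w \<alpha> \<beta> \<gamma> \<delta>] mem(4) sum by simp
  qed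
  fix x y z w and \<alpha> \<beta> \<gamma> \<delta> :: 'k assume mem: "x \<in> U" "y \<in> U" "z \<in> U" "w \<in> R" and sum: "\<alpha> + \<beta> + \<gamma> + \<delta> = 0"
  then have R: "x \<in> R" "y \<in> R" "z \<in> R" "w \<in> R" using assms(1) by auto
  have sums: "\<beta> + \<alpha> + \<gamma> + \<delta> = 0" "\<beta> + \<delta> + \<alpha> + \<gamma> = 0" using sum by (simp_all add: add_ac)
  have "quartic m m x \<alpha> y \<beta> z \<gamma> w \<delta> = quartic m m x \<alpha> z \<gamma> y \<beta> w \<delta>"
    using *[OF mem(2,1,3,4) sums(1)] quartic_swap[OF m(1,1,3) R(1,2,3,4), of \<alpha> \<beta> \<gamma> \<delta>]
      quartic_commute[OF m(1,1) R(2,4,1,3) sums(2)] by simp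
  then show "assoc4 m x \<alpha> y \<beta> z \<gamma> w \<delta>" using *[OF mem sum] by (simp add: assoc4_def)
qed

lemma assoc4_iff: "assoc_at s R m \<longleftrightarrow> for_quadruples (assoc4 m) R R R R"
proof
  assume *: "for_quadruples (assoc4 m) R R R R"
  show "assoc_at s R m"
    unfolding assoc_at_def
  proof (intro ballI allI kappa_eqI)
    fix x y z w and \<alpha> \<beta> \<nu> :: 'k assume mem: "x \<in> R" "y \<in> R" "z \<in> R" "w \<in> R"
    have sum: "\<alpha> + \<beta> + (\<nu> - \<alpha> - \<beta>) + - \<nu> = 0" by simp
    then have "assoc4 m x \<alpha> y \<beta> z (\<nu> - \<alpha> - \<beta>) w (- \<nu>)"
      using * mem unfolding for_quadruples_def by blast
    then have "quartic m m x \<alpha> y \<beta> z (\<nu> - \<alpha> - \<beta>) w (- \<nu>) = quartic m m x \<alpha> w (- \<nu>) y \<beta> z (\<nu> - \<alpha> - \<beta>)"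
      unfolding assoc4_def by blast
    from iffD2[OF kappa_assoc[OF mem sum] this]
    show "\<kappa> \<nu> (evs s (\<alpha> + \<beta>) (m (evs s \<alpha> (m x y)) z)) w = \<kappa> \<nu> (evs s \<alpha> (m x (evs s \<beta> (m y z)))) w"
      by simp
  qed
qed (rule assoc4_sub; simp)

lemma assoc4_perm:
  assumes mem: "x \<in> R" "y \<in> R" "z \<in> R" "w \<in> R" and sum: "\<alpha> + \<beta> + \<gamma> + \<delta> = 0"
    and E: "assoc4 m x \<alpha> y \<beta> z \<gamma> w \<delta>"
  shows "assoc4 m y \<beta> x \<alpha> z \<gamma> w \<delta>" "assoc4 m x \<alpha> z \<gamma> y \<beta> w \<delta>" "assoc4 m x \<alpha> y \<beta> w \<delta> z \<gamma>"
proof -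
  have sums: "\<beta> + \<gamma> + \<alpha> + \<delta> = 0" "\<beta> + \<delta> + \<alpha> + \<gamma> = 0" "\<alpha> + \<beta> + \<delta> + \<gamma> = 0"
    "\<alpha> + \<delta> + \<beta> + \<gamma> = 0" "\<alpha> + \<gamma> + \<delta> + \<beta> = 0" using sum by (simp_all add: add_ac)
  note c = quartic_commute[OF m(1,1)] and l = quartic_swap[OF m(1,1,3)] and r = quartic_swap_right[OF m(1,1,3)]
  have "quartic m m y \<beta> x \<alpha> z \<gamma> w \<delta> = quartic m m x \<alpha> y \<beta> z \<gamma> w \<delta>"
    "quartic m m y \<beta> z \<gamma> x \<alpha> w \<delta> = quartic m m x \<alpha> w \<delta> y \<beta> z \<gamma>"
    "quartic m m y \<beta> w \<delta> x \<alpha> z \<gamma> = quartic m m x \<alpha> z \<gamma> y \<beta> w \<delta>"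
    "quartic m m x \<alpha> w \<delta> z \<gamma> y \<beta> = quartic m m x \<alpha> w \<delta> y \<beta> z \<gamma>"
    "quartic m m x \<alpha> z \<gamma> w \<delta> y \<beta> = quartic m m x \<alpha> z \<gamma> y \<beta> w \<delta>"
    "quartic m m x \<alpha> y \<beta> w \<delta> z \<gamma> = quartic m m x \<alpha> y \<beta> z \<gamma> w \<delta>"
    using l[OF mem(2,1,3,4)] c[OF mem(2,3,1,4) sums(1)] c[OF mem(2,4,1,3) sums(2)]
      r[OF mem(1,2,4,3) sums(3)] r[OF mem(1,4,2,3) sums(4)] r[OF mem(1,3,4,2) sums(5)] by simp_all
  then show "assoc4 m y \<beta> x \<alpha> z \<gamma> w \<delta>" "assoc4 m x \<alpha> z \<gamma> y \<beta> w \<delta>" "assoc4 m x \<alpha> y \<beta> w \<delta> z \<gamma>"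
    using E unfolding assoc4_def by metis+
qed

lemma assoc4_add:
  assumes "x \<in> R" "x' \<in> R" "y \<in> R" "z \<in> R" "w \<in> R"
  shows "assoc4 m x \<alpha> y \<beta> z \<gamma> w \<delta> \<Longrightarrow> assoc4 m x' \<alpha> y \<beta> z \<gamma> w \<delta> \<Longrightarrow> assoc4 m (x + x') \<alpha> y \<beta> z \<gamma> w \<delta>"
    "assoc4 m y \<beta> x \<alpha> z \<gamma> w \<delta> \<Longrightarrow> assoc4 m y \<beta> x' \<alpha> z \<gamma> w \<delta> \<Longrightarrow> assoc4 m y \<beta> (x + x') \<alpha> z \<gamma> w \<delta>"
  unfolding assoc4_def using assms by (auto simp: quartic_add[OF m(1,1)])

end

subsection \<open>Reduction to homogeneous quadruples\<close>

context
  fixes U V :: "'v set"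
  assumes U: "U \<subseteq> R" and V: "V \<subseteq> R" and UV: "\<And>x. x \<in> R \<Longrightarrow> \<exists>u\<in>U. \<exists>v\<in>V. x = u + v"
begin

text \<open>
  Additivity leaves the sixteen cases in which every argument lies in \<open>U\<close> or
  \<open>V\<close>, and permuting the last three arguments reduces them to the six assumptions.
\<close>

lemma for_quadruples_split:
  assumes perm: "\<And>x y z w \<alpha> \<beta> \<gamma> \<delta>. x \<in> R \<Longrightarrow> y \<in> R \<Longrightarrow> z \<in> R \<Longrightarrow> w \<in> R \<Longrightarrow> \<alpha> + \<beta> + \<gamma> + \<delta> = 0 \<Longrightarrow>
        E x \<alpha> y \<beta> z \<gamma> w \<delta> \<Longrightarrow> E x \<alpha> z \<gamma> y \<beta> w \<delta>"
      "\<And>x y z w \<alpha> \<beta> \<gamma> \<delta>. x \<in> R \<Longrightarrow> y \<in> R \<Longrightarrow> z \<in> R \<Longrightarrow> w \<in> R \<Longrightarrow> \<alpha> + \<beta> + \<gamma> + \<delta> = 0 \<Longrightarrow>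
        E x \<alpha> y \<beta> z \<gamma> w \<delta> \<Longrightarrow> E x \<alpha> y \<beta> w \<delta> z \<gamma>"
    and add: "\<And>x x' y z w \<alpha> \<beta> \<gamma> \<delta>. x \<in> R \<Longrightarrow> x' \<in> R \<Longrightarrow> y \<in> R \<Longrightarrow> z \<in> R \<Longrightarrow> w \<in> R \<Longrightarrow>
        E x \<alpha> y \<beta> z \<gamma> w \<delta> \<Longrightarrow> E x' \<alpha> y \<beta> z \<gamma> w \<delta> \<Longrightarrow> E (x + x') \<alpha> y \<beta> z \<gamma> w \<delta>"
      "\<And>x x' y z w \<alpha> \<beta> \<gamma> \<delta>. x \<in> R \<Longrightarrow> x' \<in> R \<Longrightarrow> y \<in> R \<Longrightarrow> z \<in> R \<Longrightarrow> w \<in> R \<Longrightarrow>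
        E y \<beta> x \<alpha> z \<gamma> w \<delta> \<Longrightarrow> E y \<beta> x' \<alpha> z \<gamma> w \<delta> \<Longrightarrow> E y \<beta> (x + x') \<alpha> z \<gamma> w \<delta>"
    and base: "for_quadruples E U U U R" "for_quadruples E V V V R" "for_quadruples E U U V V"
      "for_quadruples E V V U U" "for_quadruples E U V V V" "for_quadruples E V U U U"
  shows "for_quadruples E R R R R"
proof -
  note base' = base[unfolded for_quadruples_def, rule_format]
  have hom: "E x \<alpha> y \<beta> z \<gamma> w \<delta>"
    if hom: "x \<in> U \<union> V" "y \<in> U \<union> V" "z \<in> U \<union> V" "w \<in> U \<union> V" and sum: "\<alpha> + \<beta> + \<gamma> + \<delta> = 0" for x y z w \<alpha> \<beta> \<gamma> \<delta>
  proof -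
    have R: "x \<in> R" "y \<in> R" "z \<in> R" "w \<in> R" using hom U V by auto
    have sums: "\<alpha> + \<gamma> + \<beta> + \<delta> = 0" "\<alpha> + \<beta> + \<delta> + \<gamma> = 0" "\<alpha> + \<gamma> + \<delta> + \<beta> = 0"
      "\<alpha> + \<delta> + \<beta> + \<gamma> = 0" "\<alpha> + \<delta> + \<gamma> + \<beta> = 0" using sum by (simp_all add: add_ac)
    have p1: "E x \<alpha> y \<beta> z \<gamma> w \<delta>" if "E x \<alpha> z \<gamma> y \<beta> w \<delta>"
      by (rule perm(1)[OF R(1,3,2,4) sums(1) that])
    have p2: "E x \<alpha> y \<beta> z \<gamma> w \<delta>" if "E x \<alpha> y \<beta> w \<delta> z \<gamma>"
      by (rule perm(2)[OF R(1,2,4,3) sums(2) that])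
    have p3: "E x \<alpha> y \<beta> z \<gamma> w \<delta>" if "E x \<alpha> z \<gamma> w \<delta> y \<beta>"
      by (rule p1, rule perm(2)[OF R(1,3,4,2) sums(3) that])
    have p4: "E x \<alpha> y \<beta> z \<gamma> w \<delta>" if "E x \<alpha> w \<delta> y \<beta> z \<gamma>"
      by (rule p2, rule perm(1)[OF R(1,4,2,3) sums(4) that])
    have c1: "E x \<alpha> y \<beta> z \<gamma> w \<delta>" if "x \<in> U" "y \<in> U" "z \<in> U"
      using that base'(1) R sum by blast
    have c2: "E x \<alpha> y \<beta> z \<gamma> w \<delta>" if "x \<in> U" "y \<in> U" "z \<in> V" "w \<in> U"
      using that base'(1) R sums by (intro p2) blast
    have c3: "E x \<alpha> y \<beta> z \<gamma> w \<delta>" if "x \<in> U" "y \<in> U" "z \<in> V" "w \<in> V"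
      using that base'(3) sum by blast
    have c4: "E x \<alpha> y \<beta> z \<gamma> w \<delta>" if "x \<in> U" "y \<in> V" "z \<in> U" "w \<in> U"
      using that base'(1) R sums by (intro p3) blast
    have c5: "E x \<alpha> y \<beta> z \<gamma> w \<delta>" if "x \<in> U" "y \<in> V" "z \<in> U" "w \<in> V"
      using that base'(3) sums by (intro p1) blast
    have c6: "E x \<alpha> y \<beta> z \<gamma> w \<delta>" if "x \<in> U" "y \<in> V" "z \<in> V" "w \<in> U"
      using that base'(3) sums by (intro p4) blast
    have c7: "E x \<alpha> y \<beta> z \<gamma> w \<delta>" if "x \<in> U" "y \<in> V" "z \<in> V" "w \<in> V"
      using that base'(5) sum by blast
    have c8: "E x \<alpha> y \<beta> z \<gamma> w \<delta>" if "x \<in> V" "y \<in> V" "z \<in> V"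
      using that base'(2) R sum by blast
    have c9: "E x \<alpha> y \<beta> z \<gamma> w \<delta>" if "x \<in> V" "y \<in> V" "z \<in> U" "w \<in> V"
      using that base'(2) R sums by (intro p2) blast
    have c10: "E x \<alpha> y \<beta> z \<gamma> w \<delta>" if "x \<in> V" "y \<in> V" "z \<in> U" "w \<in> U"
      using that base'(4) sum by blast
    have c11: "E x \<alpha> y \<beta> z \<gamma> w \<delta>" if "x \<in> V" "y \<in> U" "z \<in> V" "w \<in> V"
      using that base'(2) R sums by (intro p3) blast
    have c12: "E x \<alpha> y \<beta> z \<gamma> w \<delta>" if "x \<in> V" "y \<in> U" "z \<in> V" "w \<in> U"
      using that base'(4) sums by (intro p1) blast
    have c13: "E x \<alpha> y \<beta> z \<gamma> w \<delta>" if "x \<in> V" "y \<in> U" "z \<in> U" "w \<in> V"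
      using that base'(4) sums by (intro p4) blast
    have c14: "E x \<alpha> y \<beta> z \<gamma> w \<delta>" if "x \<in> V" "y \<in> U" "z \<in> U" "w \<in> U"
      using that base'(6) sum by blast
    show ?thesis
      by (insert hom, elim UnE)
        ((rule c1; assumption) | (rule c2; assumption) | (rule c3; assumption) | (rule c4; assumption) | (rule c5; assumption) | (rule c6; assumption) | (rule c7; assumption) | (rule c8; assumption) | (rule c9; assumption) | (rule c10; assumption) | (rule c11; assumption) | (rule c12; assumption) | (rule c13; assumption) | (rule c14; assumption))+
  qed
  have UV_R: "x \<in> R" if "x \<in> U \<union> V" for x using that U V by auto
  show ?thesis
    unfolding for_quadruples_def
  proof (intro ballI allI impI)
    fix x y z w and \<alpha> \<beta> \<gamma> \<delta> :: 'k assume R: "x \<in> R" "y \<in> R" "z \<in> R" "w \<in> R" and sum: "\<alpha> + \<beta> + \<gamma> + \<delta> = 0"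
    have sums: "\<alpha> + \<gamma> + \<beta> + \<delta> = 0" "\<alpha> + \<beta> + \<delta> + \<gamma> = 0" "\<alpha> + \<gamma> + \<delta> + \<beta> = 0"
      "\<alpha> + \<delta> + \<beta> + \<gamma> = 0" "\<alpha> + \<delta> + \<gamma> + \<beta> = 0" using sum by (simp_all add: add_ac)
    have 1: "E x' \<alpha> y' \<beta> z' \<gamma> w \<delta>" if hx: "x' \<in> U \<union> V" "y' \<in> U \<union> V" "z' \<in> U \<union> V" for x' y' z'
    proof -
      obtain u v where w: "u \<in> U" "v \<in> V" "w = u + v" using UV[OF R(4)] by blast
      have "E x' \<alpha> w \<delta> y' \<beta> z' \<gamma>"
        unfolding w(3) by (rule add(2)) (use hom[of x' _ y' z'] hx w sums UV_R in auto)
      then have "E x' \<alpha> y' \<beta> w \<delta> z' \<gamma>" by (rule perm(1)[rotated -1]) (use UV_R hx R sums in auto)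
      then show ?thesis by (rule perm(2)[rotated -1]) (use UV_R hx R sums in auto)
    qed
    have 2: "E x' \<alpha> y' \<beta> z \<gamma> w \<delta>" if hx: "x' \<in> U \<union> V" "y' \<in> U \<union> V" for x' y'
    proof -
      obtain u v where z: "u \<in> U" "v \<in> V" "z = u + v" using UV[OF R(3)] by blast
      have "E x' \<alpha> u \<gamma> y' \<beta> w \<delta>" "E x' \<alpha> v \<gamma> y' \<beta> w \<delta>"
        by (rule perm(1)[OF _ _ _ _ sum]; use 1 hx z R UV_R in auto)+
      then have "E x' \<alpha> z \<gamma> y' \<beta> w \<delta>"
        unfolding z(3) by (intro add(2)) (use hx z R UV_R in auto)
      then show ?thesis by (rule perm(1)[rotated -1]) (use UV_R hx R sums in auto)
    qed
    have 3: "E x' \<alpha> y \<beta> z \<gamma> w \<delta>" if hx: "x' \<in> U \<union> V" for x'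
    proof -
      obtain u v where y: "u \<in> U" "v \<in> V" "y = u + v" using UV[OF R(2)] by blast
      show ?thesis unfolding y(3) by (rule add(2)) (use hx 2 R UV_R y in auto)
    qed
    obtain u v where x: "u \<in> U" "v \<in> V" "x = u + v" using UV[OF R(1)] by blast
    show "E x \<alpha> y \<beta> z \<gamma> w \<delta>" unfolding x(3) by (rule add(1)) (use 3 R UV_R x in auto)
  qed
qed

text \<open>
  A quadruple with three elements in the same summand satisfies the identities because the axioms
  hold there; if the odd element comes first, this uses \<open>jacobi4_swap\<close>,
  \<open>assoc4_perm\<close> and \<open>leibniz4_rotate\<close>. The quadruples with two elements
  in each summand remain. The Leibniz rule singles out its first argument, which may lie in either
  summand, and so contributes two conditions.
\<close>

theorem poisson_conformal_split_iff:
  assumes fg: "fg_module s R"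
    and br: "gc_hom s R s R br" "cyclic br" "flip_symmetric s R (- 1) br"
    and m: "gc_hom s R s R m" "cyclic m" "flip_symmetric s R 1 m"
    and at: "leibniz_at s U br br" "assoc_at s U m" "leibniz_at s U br m"
      "leibniz_at s V br br" "assoc_at s V m" "leibniz_at s V br m"
  shows "poisson_conformal s R br m \<longleftrightarrow>
    for_quadruples (leibniz4 br br) U U V V \<and> for_quadruples (assoc4 m) U U V V \<and>
    for_quadruples (leibniz4 br m) U U V V \<and> for_quadruples (leibniz4 br m) V V U U"
proof -
  have mono: "for_quadruples E X Y Z W"
    if "for_quadruples E R R R R" "X \<subseteq> R" "Y \<subseteq> R" "Z \<subseteq> R" "W \<subseteq> R" for E X Y Z W
    using that unfolding for_quadruples_def by blast
  note iffs = leibniz4_iff[OF br br] assoc4_iff[OF m] leibniz4_iff[OF br m]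
  note jac = leibniz4_sub[OF br br U at(1)] leibniz4_sub[OF br br V at(4)]
  note ass = assoc4_sub[OF m U at(2)] assoc4_sub[OF m V at(5)]
  note lei = leibniz4_sub[OF br m U at(3)] leibniz4_sub[OF br m V at(6)]
  have UR: "u \<in> R" if "u \<in> U" for u using U that by auto
  have VR: "v \<in> R" if "v \<in> V" for v using V that by auto
  have J: "for_quadruples (leibniz4 br br) R R R R" if UV: "for_quadruples (leibniz4 br br) U U V V"
  proof (rule for_quadruples_split)
    have swap: "for_quadruples (leibniz4 br br) X Y Z W" if "for_quadruples (leibniz4 br br) Y Z W X"
      "X \<subseteq> R" "Y \<subseteq> R" "Z \<subseteq> R" "W \<subseteq> R" for X Y Z W
      unfolding for_quadruples_def
    proof (intro ballI allI impI)
      fix x y z w and \<alpha> \<beta> \<gamma> \<delta> :: 'k assume mem: "x \<in> X" "y \<in> Y" "z \<in> Z" "w \<in> W" and sum: "\<alpha> + \<beta> + \<gamma> + \<delta> = 0"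
      have "\<beta> + \<gamma> + \<delta> + \<alpha> = 0" using sum by (simp add: add_ac)
      then have "leibniz4 br br y \<beta> z \<gamma> w \<delta> x \<alpha>"
        using that(1) mem unfolding for_quadruples_def by blast
      moreover have R: "x \<in> R" "y \<in> R" "z \<in> R" "w \<in> R" using mem that by auto
      ultimately show "leibniz4 br br x \<alpha> y \<beta> z \<gamma> w \<delta>"
        using jacobi4_swap[OF br(1,3) R sum] by simp
    qed
    have mono': "for_quadruples (leibniz4 br br) X Y Z W'" if "for_quadruples (leibniz4 br br) X Y Z W" "W' \<subseteq> W" for X Y Z W W'
      using that unfolding for_quadruples_def by blast
    show "for_quadruples (leibniz4 br br) V U U U" by (rule swap[OF mono'[OF jac(1) V]]) (use U V in auto)
    show "for_quadruples (leibniz4 br br) U V V V" by (rule swap[OF mono'[OF jac(2) U]]) (use U V in auto)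
    show "for_quadruples (leibniz4 br br) V V U U" by (rule swap[OF swap[OF UV]]) (use U V in auto)
  qed (fact UV jac | rule leibniz4_perm[OF br br] leibniz4_add[OF br br]; assumption)+
  have A: "for_quadruples (assoc4 m) R R R R" if UV: "for_quadruples (assoc4 m) U U V V"
  proof (rule for_quadruples_split)
    have swap: "for_quadruples (assoc4 m) W X Y Z" if "for_quadruples (assoc4 m) X Y Z W"
      "X \<subseteq> R" "Y \<subseteq> R" "Z \<subseteq> R" "W \<subseteq> R" for X Y Z W
      unfolding for_quadruples_def
    proof (intro ballI allI impI)
      fix w x y z and \<alpha> \<beta> \<gamma> \<delta> :: 'k assume mem: "w \<in> W" "x \<in> X" "y \<in> Y" "z \<in> Z" and sum: "\<delta> + \<alpha> + \<beta> + \<gamma> = 0"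
      have sums: "\<alpha> + \<beta> + \<gamma> + \<delta> = 0" "\<alpha> + \<beta> + \<delta> + \<gamma> = 0" "\<alpha> + \<delta> + \<beta> + \<gamma> = 0" using sum by (simp_all add: add_ac)
      have R: "x \<in> R" "y \<in> R" "z \<in> R" "w \<in> R" using mem that by auto
      have "assoc4 m x \<alpha> y \<beta> z \<gamma> w \<delta>"
        using that(1) mem sums unfolding for_quadruples_def by blast
      then have "assoc4 m x \<alpha> y \<beta> w \<delta> z \<gamma>" by (rule assoc4_perm(3)[OF m R sums(1)])
      then have "assoc4 m x \<alpha> w \<delta> y \<beta> z \<gamma>" by (rule assoc4_perm(2)[OF m R(1,2,4,3) sums(2)])
      then show "assoc4 m w \<delta> x \<alpha> y \<beta> z \<gamma>" by (rule assoc4_perm(1)[OF m R(1,4,2,3) sums(3)])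
    qed
    have mono': "for_quadruples (assoc4 m) X Y Z W'" if "for_quadruples (assoc4 m) X Y Z W" "W' \<subseteq> W" for X Y Z W W'
      using that unfolding for_quadruples_def by blast
    show "for_quadruples (assoc4 m) V U U U" by (rule swap[OF mono'[OF ass(1) V]]) (use U V in auto)
    show "for_quadruples (assoc4 m) U V V V" by (rule swap[OF mono'[OF ass(2) U]]) (use U V in auto)
    show "for_quadruples (assoc4 m) V V U U" by (rule swap[OF swap[OF UV]]) (use U V in auto)
  qed (fact UV ass | rule assoc4_perm(2,3)[OF m] assoc4_add[OF m]; assumption)+
  have L: "for_quadruples (leibniz4 br m) R R R R"
    if UV: "for_quadruples (leibniz4 br m) U U V V" "for_quadruples (leibniz4 br m) V V U U"
  proof (rule for_quadruples_split)
    have rot: "for_quadruples (leibniz4 br m) X Y Y Y" if "for_quadruples (leibniz4 br m) Y Y Y R" "X \<subseteq> R" "Y \<subseteq> R" for X Y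
      unfolding for_quadruples_def
    proof (intro ballI allI impI)
      fix x y z w and \<alpha> \<beta> \<gamma> \<delta> :: 'k assume mem: "x \<in> X" "y \<in> Y" "z \<in> Y" "w \<in> Y" and sum: "\<alpha> + \<beta> + \<gamma> + \<delta> = 0"
      have sums: "\<beta> + \<gamma> + \<delta> + \<alpha> = 0" "\<gamma> + \<delta> + \<beta> + \<alpha> = 0" "\<delta> + \<beta> + \<gamma> + \<alpha> = 0" using sum by (simp_all add: add_ac)
      have R: "x \<in> R" "y \<in> R" "z \<in> R" "w \<in> R" using mem that by auto
      show "leibniz4 br m x \<alpha> y \<beta> z \<gamma> w \<delta>"
        by (rule leibniz4_rotate[OF br(1,3) m(1,3) R sum])
          (use that(1) mem sums R(1) in \<open>auto simp: for_quadruples_def\<close>)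
    qed
    show "for_quadruples (leibniz4 br m) V U U U" by (rule rot[OF lei(1) V U])
    show "for_quadruples (leibniz4 br m) U V V V" by (rule rot[OF lei(2) U V])
  qed (fact UV lei | rule leibniz4_perm[OF br m] leibniz4_add[OF br m]; assumption)+
  show ?thesis
    unfolding poisson_conformal_at_iff iffs
    using fg br m J A L mono[OF _ U U V V] mono[OF _ V V U U] by blast
qed

end

end

section \<open>Invariance of a form at scalar spectral parameters\<close>

text \<open>
  At \<open>\<lambda> = l\<close> the derivation \<open>\<partial>\<close> in the second argument
  of the form acts as \<open>l\<close>, so at \<open>\<mu> = r\<close> the product
  \<open>b\<^bsub>\<mu>-\<partial>\<^esub> c\<close> becomes the product at \<open>r - l\<close>.
\<close>

lemma (in conformal_pairing) invariant_form_iff: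
  assumes B: "\<And>\<nu> x y. \<kappa> \<nu> x y = poly (B x y) \<nu>" and M: "gc_hom s R s R M"
  shows "invariant_form s R M B \<longleftrightarrow> cyclic M"
proof -
  interpret vector_space "kscale s" using s by (rule vector_space_kscale)
  have K: "linear_form (*) (\<lambda>x :: 'k. x)" by (simp add: linear_form_def)
  have ev: "hat2 l r (subst lam (\<lambda>v. subst mu const2 (B v c)) (M a b)) = \<kappa> r (evs s l (M a b)) c"
      "hat2 l r (subst mu (\<lambda>v. subst lam const2 (B a v))
          (subst (\<lambda>q. pCons 0 q - map_poly (der s) q) (\<lambda>v. [:v:]) (M b c))) =
        \<kappa> (- l) (evs s (r - l) (M b c)) a"
    if mem: "a \<in> R" "b \<in> R" "c \<in> R" for a b c l r
  proof -
    have B0: "B 0 y = 0" if "y \<in> R" for y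
      using kappa_linear(2)[OF that, of _ 0 0] by (simp add: B poly_all_0_iff_0[symmetric] s)
    have R0: "0 \<in> R" using R s by (simp add: module.subspace_def)
    have B0': "B y 0 = 0" if "y \<in> R" for y
      using kappa_right(2)[OF that R0 R0, of _ 0] by (simp add: B poly_all_0_iff_0[symmetric] s)
    have form': "linear_form (kscale s) (\<lambda>v. \<kappa> \<nu> v y)" if "y \<in> R" for \<nu> y
      using form[OF that] by (simp add: momentum_form_def)
    have "hat2 l r (subst lam (\<lambda>v. subst mu const2 (B v c)) (M a b)) = hat (\<lambda>v. \<kappa> r v c) l (M a b)"
      by (subst hat2_subst[where sc = "(*)" and t = l]) (auto simp: K hat2_subst_mu hat2_lam B B0 mem)
    then show "hat2 l r (subst lam (\<lambda>v. subst mu const2 (B v c)) (M a b)) = \<kappa> r (evs s l (M a b)) c"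
      by (simp add: linear_form_ev[OF form'] mem)
    let ?T = "\<lambda>q. pCons 0 q - map_poly (der s) q" and ?W = "{q. \<forall>n. coeff q n \<in> R}"
    let ?p = "subst ?T (\<lambda>v. [:v:]) (M b c)" and ?\<psi> = "\<lambda>x. \<kappa> (- l) x a"
    have Mbc: "coeff (M b c) n \<in> R" for n
      using gc_homD(1)[OF s R M] mem by blast
    have minus: "x - y \<in> R" if "x \<in> R" "y \<in> R" for x y
      using kspace_diff[OF vector_space_axioms kspace_kscale[OF s R] that] .
    have p: "?p \<in> ?W"
      by (rule subst_mem) (auto simp: coeff_pCons coeff_map_poly s R0 R_closed minus Mbc split: nat.split)
    have psi: "linear_form (kscale s) ?\<psi>" "?\<psi> 0 = 0" "?\<psi> (der s x) = l * ?\<psi> x" for x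
      using form'[OF mem(1)] linear_form_0[OF form'[OF mem(1)]] form[OF mem(1), of "- l"]
      by (auto simp: momentum_form_def)
    have eigen: "hat ?\<psi> r (map_poly (der s) q) = l * hat ?\<psi> r q" for q
      by (rule hat_eigen) (simp_all add: s psi)
    have "hat2 l r (subst mu (\<lambda>v. subst lam const2 (B a v)) ?p) = hat (\<lambda>v. poly (B a v) l) r ?p"
      by (subst hat2_subst[where sc = "(*)" and t = r]) (auto simp: K hat2_subst_lam hat2_mu B0' mem)
    also have "\<dots> = hat ?\<psi> r ?p"
      by (rule hat_cong) (use p sym[OF mem(1), of _ l] in \<open>auto simp: B0 B0' mem psi B\<close>)
    also have "\<dots> = hat (\<lambda>v. hat ?\<psi> r [:v:]) (r - l) (M b c)"
      by (rule subst_form[OF linear_form_hat[OF psi(1)], where W = UNIV])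
        (auto simp: s linear_form_diff[OF linear_form_hat[OF psi(1)]] hat_pCons psi eigen algebra_simps)
    also have "\<dots> = ?\<psi> (evs s (r - l) (M b c))"
      by (simp add: hat_const psi linear_form_ev[OF psi(1)])
    finally show "hat2 l r (subst mu (\<lambda>v. subst lam const2 (B a v)) ?p) = \<kappa> (- l) (evs s (r - l) (M b c)) a" .
  qed
  have "invariant_form s R M B \<longleftrightarrow> (\<forall>a\<in>R. \<forall>b\<in>R. \<forall>c\<in>R. \<forall>l r.
      \<kappa> r (evs s l (M a b)) c = \<kappa> (- l) (evs s (r - l) (M b c)) a)"
    unfolding invariant_form_def
  proof (intro ball_cong refl iffI allI)
    fix a b c l r assume mem: "a \<in> R" "b \<in> R" "c \<in> R" and eq: "subst lam (\<lambda>v. subst mu const2 (B v c)) (M a b) =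
        subst mu (\<lambda>v. subst lam const2 (B a v))
          (subst (\<lambda>q. pCons 0 q - map_poly (der s) q) (\<lambda>v. [:v:]) (M b c))"
    show "\<kappa> r (evs s l (M a b)) c = \<kappa> (- l) (evs s (r - l) (M b c)) a"
      unfolding ev[OF mem, symmetric] eq ..
  next
    fix a b c assume mem: "a \<in> R" "b \<in> R" "c \<in> R"
      and eq: "\<forall>l r. \<kappa> r (evs s l (M a b)) c = \<kappa> (- l) (evs s (r - l) (M b c)) a"
    show "subst lam (\<lambda>v. subst mu const2 (B v c)) (M a b) =
        subst mu (\<lambda>v. subst lam const2 (B a v))
          (subst (\<lambda>q. pCons 0 q - map_poly (der s) q) (\<lambda>v. [:v:]) (M b c))"
      by (rule hat2_eqI) (simp only: ev[OF mem] eq[rule_format])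
  qed
  also have "\<dots> \<longleftrightarrow> cyclic M"
    unfolding cyclic_def
  proof (intro ball_cong refl iffI allI impI)
    fix a b c and \<alpha> \<beta> \<gamma> :: 'k assume "\<forall>l r. \<kappa> r (evs s l (M a b)) c = \<kappa> (- l) (evs s (r - l) (M b c)) a"
      and sum: "\<alpha> + \<beta> + \<gamma> = 0"
    moreover have "\<beta> + \<gamma> = - \<alpha>" using sum by algebra
    moreover have "\<alpha> + \<beta> - \<alpha> = \<beta>" by simp
    ultimately show "\<kappa> (\<alpha> + \<beta>) (evs s \<alpha> (M a b)) c = \<kappa> (\<beta> + \<gamma>) (evs s \<beta> (M b c)) a"
      by (metis (no_types))
  next
    fix a b c l r assume "\<forall>\<alpha> \<beta> \<gamma>. \<alpha> + \<beta> + \<gamma> = 0 \<longrightarrow>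
      \<kappa> (\<alpha> + \<beta>) (evs s \<alpha> (M a b)) c = \<kappa> (\<beta> + \<gamma>) (evs s \<beta> (M b c)) a"
    from this[rule_format, of l "r - l" "- r"]
    show "\<kappa> r (evs s l (M a b)) c = \<kappa> (- l) (evs s (r - l) (M b c)) a" by simp
  qed
  finally show ?thesis .
qed

section \<open>The double of a module\<close>

lemma module_prod_scale: "module s \<Longrightarrow> module t \<Longrightarrow> module (prod_scale s t)"
  by (simp add: module_def prod_scale_def plus_prod_def)

lemma prod_scale_simps:
  "kscale (prod_scale s t) c (a, x) = (kscale s c a, kscale t c x)"
  "der (prod_scale s t) (a, x) = (der s a, der t x)"
  by (simp_all add: kscale_def der_def prod_scale_def)

lemma coeff_pair_poly: "coeff (pair_poly p q) n = (coeff p n, coeff q n)"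
  unfolding pair_poly_def
  by (subst coeff_Abs_poly[of "max (degree p) (degree q)"]) (auto simp: coeff_eq_0 zero_prod_def)

lemma evs_pair_poly:
  assumes "module s" "module t"
  shows "evs (prod_scale s t) c (pair_poly p q) = (evs s c p, evs t c q)"
proof -
  note mods = assms module_prod_scale[OF assms]
  have "map_poly fst (pair_poly p q) = p" "map_poly snd (pair_poly p q) = q"
    by (auto intro!: poly_eqI simp: coeff_map_poly coeff_pair_poly)
  moreover have "evs s c (map_poly fst r) = fst (evs (prod_scale s t) c r)" for r
    by (rule ev_map_poly) (auto simp: vector_space_kscale mods kscale_def prod_scale_def)
  moreover have "evs t c (map_poly snd r) = snd (evs (prod_scale s t) c r)" for r
    by (rule ev_map_poly) (auto simp: vector_space_kscale mods kscale_def prod_scale_def)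
  ultimately show ?thesis by (metis prod.collapse)
qed

context finite_free_module
begin

abbreviation "sR \<equiv> prod_scale s (dual_scale :: 'k poly \<Rightarrow> ('p \<Rightarrow> 'k poly) \<Rightarrow> _)"
abbreviation "R \<equiv> (UNIV :: 'p set) \<times> Pd"
abbreviation "P1 \<equiv> (UNIV :: 'p set) \<times> {0 :: 'p \<Rightarrow> 'k poly}"
abbreviation "P2 \<equiv> {0 :: 'p} \<times> Pd"

definition dform :: "'k \<Rightarrow> 'p \<times> ('p \<Rightarrow> 'k poly) \<Rightarrow> 'p \<times> ('p \<Rightarrow> 'k poly) \<Rightarrow> 'k" where
  "dform \<nu> x y = poly (double_form x y) \<nu>"

lemma dform_simp: "dform \<nu> (a, f) (b, g) = pv f \<nu> b + pv g (- \<nu>) a"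
  by (simp add: dform_def double_form_def neg_var_simps)

lemma module_sR: "module sR"
  by (rule module_prod_scale) (rule module_axioms module_dual_scale)+

lemma subspaces: "module.subspace sR R" "module.subspace sR P1" "module.subspace sR P2"
  using subspace_Pd
  unfolding module.subspace_def[OF module_sR] module.subspace_def[OF module_dual_scale]
  by (auto simp: prod_scale_def zero_prod_def dual_scale_def fun_eq_iff)

sublocale D: conformal_pairing sR R dform
proof (rule conformal_pairing.intro)
  show "module sR" by (rule module_sR)
  show "module.subspace sR R" by (rule subspaces)
  show "momentum_form sR (- \<nu>) (\<lambda>x. dform \<nu> x y)" if "y \<in> R" for y \<nu>
    using that by (auto simp: momentum_form_def linear_form_def dform_simp prod_scale_simps dual_scale_simps
        pv_simps algebra_simps)
  show "dform \<nu> x y = dform (- \<nu>) y x" if "x \<in> R" "y \<in> R" for x y \<nu>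
    by (cases x; cases y) (simp add: dform_simp)
  show "x = 0" if 0: "\<And>y \<nu>. y \<in> R \<Longrightarrow> dform \<nu> x y = 0" for x
  proof (cases x)
    case (Pair a f)
    have "pv g \<nu> a = 0" if "g \<in> Pd" for g \<nu>
      using 0[of "(0, g)" "- \<nu>"] 0[of "(0, 0)" "- \<nu>"] that Pd_closed(1) by (simp add: Pair dform_simp)
    then have "a = 0" by (rule dual_separates)
    moreover have "f = 0"
      by (rule dual_fun_eqI) (use 0[of "(_, 0)"] Pd_closed(1) in \<open>simp add: Pair dform_simp\<close>)
    ultimately show ?thesis by (simp add: Pair zero_prod_def)
  qed
qed

lemma symmetric_double_form: "symmetric_form R double_form"
  by (auto simp: symmetric_form_def double_form_def neg_var_simps)

lemma conformal_form_double: "conformal_form sR R double_form"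
  by (auto simp: conformal_form_def double_form_def prod_scale_simps dual_scale_simps neg_var_simps
      mem_conf_dual_iff smult_add_right)

text \<open>
  For surjectivity, restrict a functional \<open>F\<close> on the double to the two summands. On
  \<open>P\<close> it is an element of the dual; on the dual it is evaluation at the element of
  \<open>P\<close> whose coordinates are the values of \<open>F\<close> at the dual basis, up to
  the sign of the variable.
\<close>

lemma nondegenerate_double_form: "nondegenerate_form sR R double_form"
  unfolding nondegenerate_form_def bij_betw_def
proof
  let ?\<Phi> = "\<lambda>x y. if y \<in> R then double_form x y else 0"
  show "inj_on ?\<Phi> R"
  proof (rule inj_onI, rule D.kappa_eqI)
    fix x x' y \<nu> assume eq: "?\<Phi> x = ?\<Phi> x'" and y: "y \<in> R"
    then show "dform \<nu> x y = dform \<nu> x' y" using fun_cong[OF eq, of y] by (simp add: dform_def)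
  qed
  show "?\<Phi> ` R = conf_dual sR R"
  proof
    show "?\<Phi> ` R \<subseteq> conf_dual sR R"
      using conformal_form_double D.R_closed by (auto simp: mem_conf_dual_iff conformal_form_def)
    show "conf_dual sR R \<subseteq> ?\<Phi> ` R"
    proof
      fix F assume F: "F \<in> conf_dual sR R"
      define f where "f = (\<lambda>b. F (b, 0))"
      define a where "a = (\<Sum>b\<in>B. s (neg_var (F (0, coord b))) b)"
      have F_add: "F (x + y) = F x + F y" if "x \<in> R" "y \<in> R" for x y
        using F that unfolding mem_conf_dual_iff by blast
      have F_scale: "F (sR r x) = r * F x" if "x \<in> R" for r x
        by (rule conf_dual_scale[OF module_sR subspaces(1) F that])
      have mem0: "(b, 0) \<in> R" for b using Pd_closed(1) by simp
      have f: "f \<in> Pd"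
        unfolding mem_conf_dual_iff
      proof (intro conjI ballI allI impI)
        show "f (u + v) = f u + f v" for u v using F_add[OF mem0 mem0, of u v] by (simp add: f_def)
        show "f (kscale s c u) = smult c (f u)" for c u
          using F_scale[OF mem0, of "[:c:]" u] by (simp add: f_def kscale_def prod_scale_def dual_scale_def zero_fun_def)
        show "f (der s u) = pCons 0 (f u)" for u
          using F_scale[OF mem0, of "[:0, 1:]" u] by (simp add: f_def der_def prod_scale_def dual_scale_def zero_fun_def)
      qed auto
      have F0: "F (0, 0) = 0" using F_add[OF mem0 mem0, of 0 0] by simp
      have F_sum: "F (0, \<Sum>i\<in>A. g i) = (\<Sum>i\<in>A. F (0, g i))" if "\<And>i. i \<in> A \<Longrightarrow> g i \<in> Pd" for A and g :: "'p \<Rightarrow> 'p \<Rightarrow> 'k poly"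
        using that
      proof (induction A rule: infinite_finite_induct)
        case (insert i A)
        have "(\<Sum>i\<in>A. g i) \<in> Pd"
          by (rule kspace_sum[OF kspace_kscale[OF module_dual_scale subspace_Pd]]) (use insert in auto)
        then show ?case using insert F_add[of "(0, g i)" "(0, \<Sum>i\<in>A. g i)"] by (simp add: plus_fun_def)
      qed (simp_all add: F0)
      have "F (b, g) = double_form (a, f) (b, g)" if g: "g \<in> Pd" for b g
      proof -
        have sc: "dual_scale r (coord i) \<in> Pd" for r i
          using subspace_Pd coord_mem by (simp add: module.subspace_def[OF module_dual_scale])
        have "F (0, g) = (\<Sum>i\<in>B. F (0, dual_scale (neg_var (g i)) (coord i)))"
          by (subst dual_span[OF g]) (rule F_sum, rule sc)
        also have "\<dots> = (\<Sum>i\<in>B. neg_var (g i) * F (0, coord i))"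
          using F_scale[of "(0, coord _)"] coord_mem by (simp add: prod_scale_def)
        also have "\<dots> = neg_var (g a)"
        proof -
          have "neg_var (sum h A) = (\<Sum>i\<in>A. neg_var (h i))" for h :: "'p \<Rightarrow> 'k poly" and A
            by (induction A rule: infinite_finite_induct) (auto simp: neg_var_simps)
          then show ?thesis
            by (simp add: a_def dual_sum[OF g] dual_scale_apply[OF g] neg_var_simps mult.commute)
        qed
        finally show ?thesis
          using F_add[OF mem0, of "(0, g)" b] g by (simp add: double_form_def f_def)
      qed
      then have "F = ?\<Phi> (a, f)"
        using F by (auto simp: fun_eq_iff mem_conf_dual_iff)
      then show "F \<in> ?\<Phi> ` R" using f by auto
    qed
  qed
qed

lemma pair_0: "t \<in> S2 \<Longrightarrow> f \<in> Pd \<Longrightarrow> pair 0 \<alpha> f \<beta> t = 0" "t \<in> S2 \<Longrightarrow> f \<in> Pd \<Longrightarrow> pair f \<alpha> 0 \<beta> t = 0"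
  using S2_arg_scale[OF _ bil_pair, of t f f 0 \<alpha> \<beta>] by simp_all

lemma pv_0: "f \<in> Pd \<Longrightarrow> pv f \<nu> 0 = 0"
  using linear_form_0[OF dual_form_linear] .

text \<open>
  The number \<open>\<langle>(a+f)\<^sub>\<alpha> (b+g), c+h\<rangle>\<close> for an invariant
  product on the double that extends \<open>n\<close> and the product dual to \<open>D\<close>:
  its homogeneous parts are \<open>h(a\<^sub>\<alpha> b)\<close>, \<open>(f \<otimes> g)(D
  c)\<close> and their rotations.
\<close>

definition trilinear :: "('p \<Rightarrow> 'p \<Rightarrow> 'p poly) \<Rightarrow> ('p \<Rightarrow> ('p, 'k) tensor2) \<Rightarrow>
    'p \<Rightarrow> ('p \<Rightarrow> 'k poly) \<Rightarrow> 'k \<Rightarrow> 'p \<Rightarrow> ('p \<Rightarrow> 'k poly) \<Rightarrow> 'k \<Rightarrow> 'p \<Rightarrow> ('p \<Rightarrow> 'k poly) \<Rightarrow> 'k \<Rightarrow> 'k" where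
  "trilinear n D a f \<alpha> b g \<beta> c h \<gamma> =
     pv h \<gamma> (evs s \<alpha> (n a b)) + pv f \<alpha> (evs s \<beta> (n b c)) + pv g \<beta> (evs s \<gamma> (n c a)) +
     pair f \<alpha> g \<beta> (D c) + pair g \<beta> h \<gamma> (D a) + pair h \<gamma> f \<alpha> (D b)"

definition doubles :: "('p \<times> ('p \<Rightarrow> 'k poly) \<Rightarrow> 'p \<times> ('p \<Rightarrow> 'k poly) \<Rightarrow> ('p \<times> ('p \<Rightarrow> 'k poly)) poly) \<Rightarrow>
    ('p \<Rightarrow> 'p \<Rightarrow> 'p poly) \<Rightarrow> ('p \<Rightarrow> ('p, 'k) tensor2) \<Rightarrow> bool" where
  "doubles M n D \<longleftrightarrow> (\<forall>x\<in>R. \<forall>y\<in>R. \<forall>k. coeff (M x y) k \<in> R) \<and>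
     (\<forall>a b c. \<forall>f\<in>Pd. \<forall>g\<in>Pd. \<forall>h\<in>Pd. \<forall>\<alpha> \<beta> \<gamma>. \<alpha> + \<beta> + \<gamma> = 0 \<longrightarrow>
       dform (\<alpha> + \<beta>) (evs sR \<alpha> (M (a, f) (b, g))) (c, h) = trilinear n D a f \<alpha> b g \<beta> c h \<gamma>)"

text \<open>
  With \<open>\<epsilon> = -1\<close> these are a bracket and a cobracket, with \<open>\<epsilon>
  = 1\<close> a commutative product and a cocommutative coproduct, so that both can be treated at
  once.
\<close>

definition product_pair :: "'k \<Rightarrow> ('p \<Rightarrow> 'p \<Rightarrow> 'p poly) \<Rightarrow> ('p \<Rightarrow> ('p, 'k) tensor2) \<Rightarrow> bool" where
  "product_pair \<epsilon> n D \<longleftrightarrow> gc_hom s UNIV s UNIV n \<and> flip_symmetric s UNIV \<epsilon> n \<and>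
     coproduct s UNIV D \<and> (\<forall>v. D v = tensor_scale \<epsilon> (flip_tensor s UNIV (D v)))"

lemma product_flip:
  assumes "product_pair \<epsilon> n D" "f \<in> Pd" "\<alpha> + \<beta> + \<gamma> = 0"
  shows "pv f \<gamma> (evs s \<alpha> (n a b)) = \<epsilon> * pv f \<gamma> (evs s \<beta> (n b a))"
proof -
  have iff: "flip_symmetric s UNIV \<epsilon> n \<longleftrightarrow> (\<forall>a\<in>UNIV. \<forall>b\<in>UNIV. \<forall>i\<in>UNIV \<times> Pd. \<forall>\<alpha>.
      (\<lambda>(\<nu>, f). pv f \<nu>) i (evs s \<alpha> (n a b)) = \<epsilon> * (\<lambda>(\<nu>, f). pv f \<nu>) i (evs s (- \<alpha> - (\<lambda>(\<nu>, f). \<nu>) i) (n b a)))"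
    by (rule flip_symmetric_iff[OF module_axioms]) (auto simp: dual_form intro: dual_separates)
  have "flip_symmetric s UNIV \<epsilon> n" using assms by (simp add: product_pair_def)
  note iffD1[OF iff this]
  from this[rule_format, of a b "(\<gamma>, f)" \<alpha>]
  have "pv f \<gamma> (evs s \<alpha> (n a b)) = \<epsilon> * pv f \<gamma> (evs s (- \<alpha> - \<gamma>) (n b a))" using assms(2) by simp
  moreover have "- \<alpha> - \<gamma> = \<beta>" using assms(3) by algebra
  ultimately show ?thesis by (simp only:)
qed

lemma coproduct_flip:
  assumes "product_pair \<epsilon> n D" "bil (*) C"
  shows "D v C = \<epsilon> * D v (\<lambda>x y. C y x)"
proof -
  have "D v = tensor_scale \<epsilon> (flip_tensor s UNIV (D v))" "D v \<in> S2"
    using assms(1) coproduct_mem by (auto simp: product_pair_def)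
  then have "D v C = tensor_scale \<epsilon> (flip_tensor s UNIV (D v)) C" by metis
  then show ?thesis using assms(2) \<open>D v \<in> S2\<close> by (simp add: tensor_scale_def flip_tensor_apply)
qed

lemma pair_flip:
  "product_pair \<epsilon> n D \<Longrightarrow> f \<in> Pd \<Longrightarrow> g \<in> Pd \<Longrightarrow> pair f \<alpha> g \<beta> (D v) = \<epsilon> * pair g \<beta> f \<alpha> (D v)"
  using coproduct_flip[OF _ bil_pair, of \<epsilon> n D f g v \<alpha> \<beta>] by (simp add: mult.commute)

context
  fixes M n D \<epsilon>
  assumes M: "doubles M n D" and nD: "product_pair \<epsilon> n D"
begin

lemma double_product: "gc_hom s UNIV s UNIV n" and double_coproduct: "coproduct s UNIV D"
  using nD by (auto simp: product_pair_def)

lemma double_at: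
  "f \<in> Pd \<Longrightarrow> g \<in> Pd \<Longrightarrow> h \<in> Pd \<Longrightarrow> \<alpha> + \<beta> + \<gamma> = 0 \<Longrightarrow>
    dform (\<alpha> + \<beta>) (evs sR \<alpha> (M (a, f) (b, g))) (c, h) = trilinear n D a f \<alpha> b g \<beta> c h \<gamma>"
  using M by (simp add: doubles_def)

lemma double_cyclic: "D.cyclic M"
  unfolding D.cyclic_def
proof (clarify, goal_cases)
  case (1 a f b g c h \<alpha> \<beta> \<gamma>)
  have "\<beta> + \<gamma> + \<alpha> = 0" using 1 by (simp add: add_ac)
  then have "dform (\<beta> + \<gamma>) (evs sR \<beta> (M (b, g) (c, h))) (a, f) = trilinear n D b g \<beta> c h \<gamma> a f \<alpha>"
    using 1 by (intro double_at)
  moreover have "dform (\<alpha> + \<beta>) (evs sR \<alpha> (M (a, f) (b, g))) (c, h) = trilinear n D a f \<alpha> b g \<beta> c h \<gamma>"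
    using 1 by (intro double_at)
  ultimately show ?case by (simp only:) (simp add: trilinear_def add_ac)
qed

lemma double_flip_symmetric: "flip_symmetric sR R \<epsilon> M"
  unfolding D.flip_symmetric_kappa
proof (clarify, goal_cases)
  case (1 a f b g c h \<alpha> \<beta>)
  define \<gamma> where "\<gamma> = - (\<alpha> + \<beta>)"
  have sum: "\<alpha> + \<beta> + \<gamma> = 0" "\<beta> + \<alpha> + \<gamma> = 0" "\<beta> + \<gamma> + \<alpha> = 0" "\<gamma> + \<alpha> + \<beta> = 0" by (auto simp: \<gamma>_def)
  have "trilinear n D a f \<alpha> b g \<beta> c h \<gamma> = \<epsilon> * trilinear n D b g \<beta> a f \<alpha> c h \<gamma>"
    unfolding trilinear_def product_flip[OF nD \<open>h \<in> Pd\<close> sum(1), of a b]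
      product_flip[OF nD \<open>f \<in> Pd\<close> sum(3), of b c] product_flip[OF nD \<open>g \<in> Pd\<close> sum(4), of c a]
      pair_flip[OF nD \<open>f \<in> Pd\<close> \<open>g \<in> Pd\<close>, of c \<alpha> \<beta>] pair_flip[OF nD \<open>g \<in> Pd\<close> \<open>h \<in> Pd\<close>, of a \<beta> \<gamma>]
      pair_flip[OF nD \<open>h \<in> Pd\<close> \<open>f \<in> Pd\<close>, of b \<gamma> \<alpha>]
    by (simp add: algebra_simps)
  then show ?case
    using double_at[of f g h \<alpha> \<beta> \<gamma> a b c] double_at[of g f h \<beta> \<alpha> \<gamma> b a c] 1 sum
    by (simp add: add.commute[of \<beta>])
qed

lemma double_gc_hom: "gc_hom sR R sR R M"
proof (rule gc_homI[OF module_sR])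
  show "coeff (M x y) k \<in> R" if "x \<in> R" "y \<in> R" for x y k
    using M that unfolding doubles_def by blast
  note gc = gc_homD[OF mods double_product UNIV_I UNIV_I UNIV_I UNIV_I]
  note pc = pair_coproduct[OF double_coproduct] and S = coproduct_mem[OF double_coproduct]
  have at: "dform \<nu> (evs sR \<alpha> (M (a, f) (b, g))) (c, h) = trilinear n D a f \<alpha> b g (\<nu> - \<alpha>) c h (- \<nu>)"
    if "f \<in> Pd" "g \<in> Pd" "h \<in> Pd" for \<nu> \<alpha> a b c f g h
    using double_at[of f g h \<alpha> "\<nu> - \<alpha>" "- \<nu>"] that by simp
  have tri: "trilinear n D (a + a') (f + f') \<alpha> b g \<beta> c h \<gamma> = trilinear n D a f \<alpha> b g \<beta> c h \<gamma> + trilinear n D a' f' \<alpha> b g \<beta> c h \<gamma>"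
    "trilinear n D (kscale s r a) (kscale dual_scale r f) \<alpha> b g \<beta> c h \<gamma> = r * trilinear n D a f \<alpha> b g \<beta> c h \<gamma>"
    "\<alpha> + \<beta> + \<gamma> = 0 \<Longrightarrow> trilinear n D (der s a) (der dual_scale f) \<alpha> b g \<beta> c h \<gamma> = - \<alpha> * trilinear n D a f \<alpha> b g \<beta> c h \<gamma>"
    if "f \<in> Pd" "f' \<in> Pd" "g \<in> Pd" "h \<in> Pd" for a a' f f' b g c h \<alpha> \<beta> \<gamma> r
  proof -
    show "trilinear n D (a + a') (f + f') \<alpha> b g \<beta> c h \<gamma> = trilinear n D a f \<alpha> b g \<beta> c h \<gamma> + trilinear n D a' f' \<alpha> b g \<beta> c h \<gamma>"
      unfolding trilinear_def by (simp only: pair_add that S pc) (simp add: gc pv_simps that)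
    show "trilinear n D (kscale s r a) (kscale dual_scale r f) \<alpha> b g \<beta> c h \<gamma> = r * trilinear n D a f \<alpha> b g \<beta> c h \<gamma>"
      unfolding trilinear_def by (simp only: pair_scale that S pc) (simp add: gc pv_simps that dual_scale_simps algebra_simps)
    show "trilinear n D (der s a) (der dual_scale f) \<alpha> b g \<beta> c h \<gamma> = - \<alpha> * trilinear n D a f \<alpha> b g \<beta> c h \<gamma>"
      if sum: "\<alpha> + \<beta> + \<gamma> = 0"
    proof -
      have "\<gamma> = - \<alpha> - \<beta>" using sum by algebra
      then show ?thesis
        unfolding trilinear_def
        by (simp only: pair_scale \<open>f \<in> Pd\<close> \<open>g \<in> Pd\<close> \<open>h \<in> Pd\<close> S pc)
          (simp add: gc pv_simps \<open>f \<in> Pd\<close> \<open>g \<in> Pd\<close> \<open>h \<in> Pd\<close> dual_scale_simps algebra_simps)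
    qed
  qed
  have rot: "trilinear n D a f \<alpha> b g \<beta> c h \<gamma> = trilinear n D b g \<beta> c h \<gamma> a f \<alpha>" for a f \<alpha> b g \<beta> c h \<gamma>
    by (simp add: trilinear_def add_ac)
  note dsimps = D.kappa_linear prod_scale_simps at Pd_closed tri
  fix x x' y y' :: "'p \<times> ('p \<Rightarrow> 'k poly)" and \<alpha> r :: 'k assume mem: "x \<in> R" "x' \<in> R" "y \<in> R" "y' \<in> R"
  obtain a f a' f' b g b' g' where eqs: "x = (a, f)" "x' = (a', f')" "y = (b, g)" "y' = (b', g')"
    and fg: "f \<in> Pd" "f' \<in> Pd" "g \<in> Pd" "g' \<in> Pd"
    using mem by (cases x; cases x'; cases y; cases y') auto
  show "evs sR \<alpha> (M (x + x') y) = evs sR \<alpha> (M x y) + evs sR \<alpha> (M x' y)"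
    by (rule D.kappa_eqI) (use fg in \<open>auto simp: dsimps eqs\<close>)
  show "evs sR \<alpha> (M (kscale sR r x) y) = kscale sR r (evs sR \<alpha> (M x y))"
    by (rule D.kappa_eqI) (use fg in \<open>auto simp: dsimps eqs\<close>)
  show "evs sR \<alpha> (M (der sR x) y) = - kscale sR \<alpha> (evs sR \<alpha> (M x y))"
    by (rule D.kappa_eqI) (use fg in \<open>auto simp: dsimps eqs\<close>)
  show "evs sR \<alpha> (M x (y + y')) = evs sR \<alpha> (M x y) + evs sR \<alpha> (M x y')"
    by (rule D.kappa_eqI) (use fg in \<open>auto simp: dsimps eqs rot[of a f]\<close>)
  show "evs sR \<alpha> (M x (kscale sR r y)) = kscale sR r (evs sR \<alpha> (M x y))"
    by (rule D.kappa_eqI) (use fg in \<open>auto simp: dsimps eqs rot[of a f]\<close>)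
  show "evs sR \<alpha> (M x (der sR y)) = der sR (evs sR \<alpha> (M x y)) + kscale sR \<alpha> (evs sR \<alpha> (M x y))"
    by (rule D.kappa_eqI) (use fg in \<open>auto simp: dsimps eqs rot[of a f] algebra_simps\<close>)
qed

lemma double_left: "evs sR \<alpha> (M (a, 0) (b, 0)) = (evs s \<alpha> (n a b), 0)"
proof (rule D.kappa_eqI)
  fix y \<nu> assume "y \<in> R"
  then obtain c h where y: "y = (c, h)" "h \<in> Pd" by auto
  have sum: "\<alpha> + (\<nu> - \<alpha>) + - \<nu> = 0" by simp
  have "dform \<nu> (evs sR \<alpha> (M (a, 0) (b, 0))) (c, h) = trilinear n D a 0 \<alpha> b 0 (\<nu> - \<alpha>) c h (- \<nu>)"
    using double_at[OF Pd_closed(1) Pd_closed(1) y(2) sum] by simp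
  also have "\<dots> = pv h (- \<nu>) (evs s \<alpha> (n a b))"
    unfolding trilinear_def by (simp only: pair_0 coproduct_mem[OF double_coproduct] y Pd_closed) simp
  finally show "dform \<nu> (evs sR \<alpha> (M (a, 0) (b, 0))) y = dform \<nu> (evs s \<alpha> (n a b), 0) y"
    by (simp add: y dform_simp)
qed

lemma product_0: "n 0 a = 0" "n a 0 = 0"
  using gc_hom_0[OF mods double_product UNIV_I] gc_hom_0_left[OF mods double_product UNIV_I] by auto

lemma coproduct_0: "D 0 = 0"
  using double_coproduct unfolding coproduct_def by (metis UNIV_I add_cancel_left_left)

lemma double_right:
  assumes fg: "f \<in> Pd" "g \<in> Pd"
  shows "evs sR \<alpha> (M (0, f) (0, g)) = (0, evs dual_scale \<alpha> (dp D f g))"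
proof (rule D.kappa_eqI)
  fix y \<nu> assume "y \<in> R"
  then obtain c h where y: "y = (c, h)" "h \<in> Pd" by auto
  have sum: "\<alpha> + (\<nu> - \<alpha>) + - \<nu> = 0" by simp
  have "dform \<nu> (evs sR \<alpha> (M (0, f) (0, g))) (c, h) = trilinear n D 0 f \<alpha> 0 g (\<nu> - \<alpha>) c h (- \<nu>)"
    using double_at[OF fg y(2) sum] by simp
  also have "\<dots> = pair f \<alpha> g (\<nu> - \<alpha>) (D c)"
    by (simp add: trilinear_def product_0 coproduct_0 pv_0 fg y)
  finally show "dform \<nu> (evs sR \<alpha> (M (0, f) (0, g))) y = dform \<nu> (0, evs dual_scale \<alpha> (dp D f g)) y"
    by (simp add: y dform_simp pv_0 dual_product_at[OF double_coproduct fg])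
qed

lemma double_extends: "extends_products UNIV n Pd (dp D) M"
  unfolding extends_products_def
proof (intro conjI ballI)
  note eqI = poly_eqI_ev[OF vector_space_kscale[OF module_sR]]
  interpret DS: vector_space "kscale (dual_scale :: 'k poly \<Rightarrow> ('p \<Rightarrow> 'k poly) \<Rightarrow> _)"
    by (rule vector_space_kscale) (rule module_dual_scale)
  show "M (a, 0) (b, 0) = pair_poly (n a b) 0" for a b
    by (rule eqI) (simp only: double_left evs_pair_poly[OF module_axioms module_dual_scale] DS.ev_0)
  show "M (0, f) (0, g) = pair_poly 0 (dp D f g)" if "f \<in> Pd" "g \<in> Pd" for f g
    by (rule eqI) (simp only: double_right[OF that] evs_pair_poly[OF module_axioms module_dual_scale] K.ev_0)
qed

text \<open>
  The components of \<open>a\<^sub>\<alpha> f\<close>: in \<open>P\<close> the contraction of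
  \<open>D a\<close> with \<open>f\<close>, in the dual \<open>\<epsilon>\<close> times the
  transpose of the multiplication by \<open>a\<close>.
\<close>

lemma double_mixed:
  assumes f: "f \<in> Pd" and Z: "evs sR \<alpha> (M (a, 0) (0, f)) = (u, k)" and sum: "\<alpha> + \<gamma> + \<nu> = 0"
  shows "k \<in> Pd" "pv k (\<alpha> + \<gamma>) y = \<epsilon> * pv f \<gamma> (evs s \<alpha> (n a y))"
    "h \<in> Pd \<Longrightarrow> pv h \<nu> u = pair f \<gamma> h \<nu> (D a)"
proof -
  have "evs sR \<alpha> (M (a, 0) (0, f)) \<in> R"
    by (rule gc_homD(2)[OF module_sR subspaces(1) double_gc_hom]) (use f Pd_closed in auto)
  then show k: "k \<in> Pd" using Z by simp
  note at = double_at[OF Pd_closed(1) f _ sum, of _ a 0, unfolded Z dform_simp]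
  have sums: "\<alpha> + \<nu> + \<gamma> = 0" "- (\<alpha> + \<gamma>) = \<nu>" "\<nu> + \<alpha> + \<gamma> = 0" using sum by algebra+
  have "pv k (\<alpha> + \<gamma>) y = pv f \<gamma> (evs s \<nu> (n y a))"
    using at[OF Pd_closed(1), of y] unfolding trilinear_def
    by (simp only: pair_0 coproduct_mem[OF double_coproduct] f Pd_closed) (simp add: product_0 coproduct_0 pv_0 f)
  then show "pv k (\<alpha> + \<gamma>) y = \<epsilon> * pv f \<gamma> (evs s \<alpha> (n a y))"
    using product_flip[OF nD f sums(3), of y a] by simp
  show "pv h \<nu> u = pair f \<gamma> h \<nu> (D a)" if h: "h \<in> Pd"
    using at[OF h, of 0, unfolded sums(2)] unfolding trilinear_def
    by (simp add: product_0 coproduct_0 pv_0 f h k)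
qed

end

context
  fixes M n D \<epsilon> M' n' D' \<epsilon>'
  assumes M: "doubles M n D" and nD: "product_pair \<epsilon> n D"
    and M': "doubles M' n' D'" and nD': "product_pair \<epsilon>' n' D'"
begin

lemma quartic_pure:
  assumes fg: "f \<in> Pd" "g \<in> Pd" and sum: "\<alpha> + \<beta> + \<gamma> + \<kappa> = 0"
  shows "D.quartic M M' (a, 0) \<alpha> (b, 0) \<beta> (0, f) \<gamma> (0, g) \<kappa> = pair f \<gamma> g \<kappa> (D' (evs s \<alpha> (n a b)))"
proof -
  have "- (\<alpha> + \<beta>) - \<gamma> = \<kappa>" using sum by algebra
  moreover have "coproduct s UNIV D'" using nD' by (simp add: product_pair_def)
  ultimately show ?thesis
    by (simp only: D.quartic_def double_left[OF M nD] double_right[OF M' nD' fg] dform_simp dual_product_at fg)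
      simp
qed

text \<open>
  The \<open>P\<close>-component of each of the two products is paired with the dual component of
  the other one, and \<open>double_mixed\<close> describes all four.
\<close>

lemma quartic_mixed:
  assumes fg: "f \<in> Pd" "g \<in> Pd" and sum: "\<alpha> + \<gamma> + \<beta> + \<kappa> = 0"
  shows "D.quartic M M' (a, 0) \<alpha> (0, f) \<gamma> (b, 0) \<beta> (0, g) \<kappa> =
    \<epsilon> * \<epsilon>' * D' b (\<lambda>x y. pv f \<gamma> (evs s \<alpha> (n a x)) * pv g \<kappa> y) +
    \<epsilon>' * D a (\<lambda>x y. pv f \<gamma> x * pv g \<kappa> (evs s \<beta> (n' b y)))"
proof -
  obtain u k where Z: "evs sR \<alpha> (M (a, 0) (0, f)) = (u, k)" by fastforce
  obtain u' k' where Z': "evs sR \<beta> (M' (b, 0) (0, g)) = (u', k')" by fastforce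
  have sums: "\<alpha> + \<gamma> + (\<beta> + \<kappa>) = 0" "\<beta> + \<kappa> + (\<alpha> + \<gamma>) = 0" "- (\<alpha> + \<gamma>) = \<beta> + \<kappa>" using sum by algebra+
  note Zs = double_mixed[OF M nD fg(1) Z sums(1)] and Zs' = double_mixed[OF M' nD' fg(2) Z' sums(2)]
  have gc: "gc_hom s UNIV s UNIV n" "gc_hom s UNIV s UNIV n'"
    and cop: "coproduct s UNIV D" "coproduct s UNIV D'"
    using nD nD' by (auto simp: product_pair_def)
  have lin: "k_linear (n x)" "k_linear (n' x)" for x
    using gc by (auto simp: gc_hom_def conformal_map_def)
  have bils: "bil (*) (\<lambda>x y. pv g \<kappa> x * pv f \<gamma> (evs s \<alpha> (n a y)))"
    "bil (*) (\<lambda>x y. pv f \<gamma> x * pv g \<kappa> (evs s \<beta> (n' b y)))"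
    by (rule bil_prod dual_form_linear form_at fg lin)+
  have "D.quartic M M' (a, 0) \<alpha> (0, f) \<gamma> (b, 0) \<beta> (0, g) \<kappa> = pv k (\<alpha> + \<gamma>) u' + pv k' (\<beta> + \<kappa>) u"
    by (simp only: D.quartic_def Z Z' dform_simp sums(3))
  also have "pv k (\<alpha> + \<gamma>) u' = pair g \<kappa> k (\<alpha> + \<gamma>) (D' b)"
    by (rule Zs'(3)[OF Zs(1)])
  also have "\<dots> = D' b (\<lambda>x y. pv g \<kappa> x * (\<epsilon> * pv f \<gamma> (evs s \<alpha> (n a y))))"
    by (simp only: Zs(2))
  also have "\<dots> = \<epsilon> * D' b (\<lambda>x y. pv g \<kappa> x * pv f \<gamma> (evs s \<alpha> (n a y)))"
    using S2_arg_scale[OF coproduct_mem[OF cop(2)] bils(1), of b \<epsilon>] by (simp add: mult.left_commute)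
  also have "\<dots> = \<epsilon> * (\<epsilon>' * D' b (\<lambda>x y. pv f \<gamma> (evs s \<alpha> (n a x)) * pv g \<kappa> y))"
    by (subst coproduct_flip[OF nD' bils(1)]) (simp add: mult.commute)
  also have "pv k' (\<beta> + \<kappa>) u = pair f \<gamma> k' (\<beta> + \<kappa>) (D a)"
    by (rule Zs(3)[OF Zs'(1)])
  also have "\<dots> = D a (\<lambda>x y. pv f \<gamma> x * (\<epsilon>' * pv g \<kappa> (evs s \<beta> (n' b y))))"
    by (simp only: Zs'(2))
  also have "\<dots> = \<epsilon>' * D a (\<lambda>x y. pv f \<gamma> x * pv g \<kappa> (evs s \<beta> (n' b y)))"
    using S2_arg_scale[OF coproduct_mem[OF cop(1)] bils(2), of a \<epsilon>'] by (simp add: mult.left_commute)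
  finally show ?thesis by (simp only: mult.assoc)
qed

lemma quartic_mixed_swapped:
  assumes fg: "f \<in> Pd" "g \<in> Pd" and sum: "\<alpha> + \<beta> + \<gamma> + \<kappa> = 0"
  shows "D.quartic M M' (a, 0) \<alpha> (0, g) \<kappa> (b, 0) \<beta> (0, f) \<gamma> =
    \<epsilon> * \<epsilon>' * \<epsilon>' * D' b (\<lambda>x y. pv f \<gamma> x * pv g \<kappa> (evs s \<alpha> (n a y))) +
    \<epsilon> * \<epsilon>' * D a (\<lambda>x y. pv f \<gamma> (evs s \<beta> (n' b x)) * pv g \<kappa> y)"
proof -
  have "k_linear (n x)" "k_linear (n' x)" for x
    using nD nD' by (auto simp: product_pair_def gc_hom_def conformal_map_def)
  note lin = this
  have bils: "bil (*) (\<lambda>x y. pv g \<kappa> (evs s \<alpha> (n a x)) * pv f \<gamma> y)"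
    "bil (*) (\<lambda>x y. pv g \<kappa> x * pv f \<gamma> (evs s \<beta> (n' b y)))"
    by (rule bil_prod dual_form_linear form_at fg lin)+
  have sum': "\<alpha> + \<kappa> + \<beta> + \<gamma> = 0" using sum by (simp add: add_ac)
  show ?thesis
    unfolding quartic_mixed[OF fg(2,1) sum'] coproduct_flip[OF nD' bils(1)] coproduct_flip[OF nD bils(2)]
    by (simp add: mult_ac)
qed

end

end

lemma fg_module_image:
  assumes V: "fg_module s V" and t: "module t"
    and \<iota>: "\<And>x y. \<iota> (x + y) = \<iota> x + \<iota> y" "\<And>r x. \<iota> (s r x) = t r (\<iota> x)"
  shows "fg_module t (\<iota> ` V)"
proof -
  have s: "module s" using V by (simp add: fg_module_def)
  interpret t: module t by (rule t)
  interpret h: module_hom s t \<iota>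
    by (intro module_hom.intro module_hom_axioms.intro s t \<iota>)
  obtain S where "finite S" "module.span s S = V" using V by (auto simp: fg_module_def)
  then have "finite (\<iota> ` S)" "t.span (\<iota> ` S) = \<iota> ` V" by (simp_all add: h.span_image)
  then show ?thesis unfolding fg_module_def using t t.subspace_span by metis
qed

lemma fg_module_sum:
  assumes "fg_module s U" "fg_module s V"
  shows "fg_module s {x + y |x y. x \<in> U \<and> y \<in> V}"
proof -
  interpret module s using assms by (simp add: fg_module_def)
  obtain S T where S: "finite S" "span S = U" and T: "finite T" "span T = V"
    using assms by (auto simp: fg_module_def)
  have "span (S \<union> T) = {x + y |x y. x \<in> U \<and> y \<in> V}"
    unfolding span_Un S T ..
  moreover have "finite (S \<union> T)" using S T by simp
  ultimately show ?thesis unfolding fg_module_def using module_axioms subspace_span by metis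
qed

lemma poisson_conformal_sub:
  assumes R: "poisson_conformal s R br m" and V: "fg_module s V" "V \<subseteq> R"
    and closed: "\<And>x y n. x \<in> V \<Longrightarrow> y \<in> V \<Longrightarrow> coeff (br x y) n \<in> V \<and> coeff (m x y) n \<in> V"
  shows "poisson_conformal s V br m"
proof -
  have gc: "gc_hom s V s V n" if "gc_hom s R s R n" "\<And>x y k. x \<in> V \<Longrightarrow> y \<in> V \<Longrightarrow> coeff (n x y) k \<in> V" for n
  proof -
    have "x \<in> R" if "x \<in> V" for x using that V(2) by blast
    then show ?thesis
      using that unfolding gc_hom_def conformal_map_def by simp
  qed
  have "gc_hom s R s R br" "gc_hom s R s R m" using R by (simp_all add: poisson_conformal_at_iff)
  then have "gc_hom s V s V br" "gc_hom s V s V m"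
    using closed by (blast intro: gc)+
  then show ?thesis
    using R V unfolding poisson_conformal_at_iff flip_symmetric_def leibniz_at_def assoc_at_def
    by (intro conjI ballI allI) blast+
qed

lemma flip_mem:
  assumes s: "module s" and W: "module.subspace s W" and p: "\<And>k. coeff p k \<in> W"
  shows "coeff (flip s p) n \<in> W"
proof -
  interpret vector_space "kscale s" using s by (rule vector_space_kscale)
  have W0: "0 \<in> W" using s W by (simp add: module.subspace_def)
  have minus: "x - y \<in> W" if "x \<in> W" "y \<in> W" for x y
    using kspace_diff[OF vector_space_axioms kspace_kscale[OF s W] that] .
  have "linear_form (kscale s) (\<lambda>_. 0)" by (simp add: linear_form_def)
  then show ?thesis
    unfolding flip_def
    by (rule hat_flip_by(2)[where W = W and d = 0]) (simp_all add: s W0 minus der_mem[OF s W] p)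
qed

context finite_free_module
begin

lemma double_carriers: "P1 \<subseteq> R" "P2 \<subseteq> R" "R = {x + y |x y. x \<in> P1 \<and> y \<in> P2}" "P1 \<inter> P2 = {0}"
proof -
  show "P1 \<subseteq> R" "P2 \<subseteq> R" using Pd_closed(1) by auto
  show "R = {x + y |x y. x \<in> P1 \<and> y \<in> P2}"
  proof (intro equalityI subsetI)
    fix z assume "z \<in> R"
    then obtain a f where "z = (a, 0) + (0, f)" "f \<in> Pd" by (cases z) auto
    then show "z \<in> {x + y |x y. x \<in> P1 \<and> y \<in> P2}" by blast
  qed auto
  show "P1 \<inter> P2 = {0}" using Pd_closed(1) by (auto simp: zero_prod_def)
qed

lemma fg_modules: "fg_module sR P1" "fg_module sR P2" "fg_module sR R"
proof -
  have "fg_module sR ((\<lambda>a. (a, 0 :: 'p \<Rightarrow> 'k poly)) ` (UNIV :: 'p set))"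
    by (rule fg_module_image[OF fg_module_self module_sR])
      (auto simp: prod_scale_def dual_scale_def zero_fun_def)
  moreover have "(\<lambda>a. (a, 0 :: 'p \<Rightarrow> 'k poly)) ` (UNIV :: 'p set) = P1" by auto
  ultimately show P1: "fg_module sR P1" by simp
  have "fg_module sR ((\<lambda>f. (0 :: 'p, f)) ` Pd)"
    by (rule fg_module_image[OF fg_module_dual module_sR]) (auto simp: prod_scale_def)
  moreover have "(\<lambda>f. (0 :: 'p, f)) ` Pd = P2" by auto
  ultimately show P2: "fg_module sR P2" by simp
  show "fg_module sR R"
    by (subst double_carriers(3)) (rule fg_module_sum[OF P1 P2])
qed

lemma for_quadruples_double:
  "D.for_quadruples E P1 P1 P2 P2 \<longleftrightarrow> (\<forall>a b. \<forall>f\<in>Pd. \<forall>g\<in>Pd. \<forall>\<alpha> \<beta> \<gamma> \<kappa>.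
    \<alpha> + \<beta> + \<gamma> + \<kappa> = 0 \<longrightarrow> E (a, 0) \<alpha> (b, 0) \<beta> (0, f) \<gamma> (0, g) \<kappa>)"
  "D.for_quadruples E P2 P2 P1 P1 \<longleftrightarrow> (\<forall>a b. \<forall>f\<in>Pd. \<forall>g\<in>Pd. \<forall>\<alpha> \<beta> \<gamma> \<kappa>.
    \<alpha> + \<beta> + \<gamma> + \<kappa> = 0 \<longrightarrow> E (0, f) \<gamma> (0, g) \<kappa> (a, 0) \<alpha> (b, 0) \<beta>)"
proof -
  show "D.for_quadruples E P1 P1 P2 P2 \<longleftrightarrow> (\<forall>a b. \<forall>f\<in>Pd. \<forall>g\<in>Pd. \<forall>\<alpha> \<beta> \<gamma> \<kappa>.
    \<alpha> + \<beta> + \<gamma> + \<kappa> = 0 \<longrightarrow> E (a, 0) \<alpha> (b, 0) \<beta> (0, f) \<gamma> (0, g) \<kappa>)"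
    by (simp add: D.for_quadruples_def)
  show "D.for_quadruples E P2 P2 P1 P1 \<longleftrightarrow> (\<forall>a b. \<forall>f\<in>Pd. \<forall>g\<in>Pd. \<forall>\<alpha> \<beta> \<gamma> \<kappa>.
    \<alpha> + \<beta> + \<gamma> + \<kappa> = 0 \<longrightarrow> E (0, f) \<gamma> (0, g) \<kappa> (a, 0) \<alpha> (b, 0) \<beta>)" (is "?L \<longleftrightarrow> ?R")
  proof
    assume L: ?L
    show ?R
    proof (intro allI ballI impI)
      fix a b f g and \<alpha> \<beta> \<gamma> \<kappa> :: 'k
      assume "f \<in> Pd" "g \<in> Pd" "\<alpha> + \<beta> + \<gamma> + \<kappa> = 0"
      moreover from this(3) have "\<gamma> + \<kappa> + \<alpha> + \<beta> = 0" by (simp add: add_ac)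
      ultimately show "E (0, f) \<gamma> (0, g) \<kappa> (a, 0) \<alpha> (b, 0) \<beta>"
        using L unfolding D.for_quadruples_def by blast
    qed
  next
    assume R: ?R
    show ?L
      unfolding D.for_quadruples_def
    proof (clarify, goal_cases)
      case (1 _ f _ g a _ b _ \<gamma> \<kappa> \<alpha> \<beta>)
      then have "\<alpha> + \<beta> + \<gamma> + \<kappa> = 0" by (simp add: add_ac)
      then show ?case using R 1 by blast
    qed
  qed
qed

section \<open>Poisson structures on the double and bialgebras\<close>

context
  fixes br m :: "'p \<Rightarrow> 'p \<Rightarrow> 'p poly" and \<delta> \<Delta> :: "'p \<Rightarrow> ('p, 'k) tensor2"
  assumes alg: "poisson_conformal s UNIV br m" and coalg: "poisson_conformal_coalgebra s UNIV \<delta> \<Delta>"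
begin

lemma product_pairs: "product_pair (- 1) br \<delta>" "product_pair 1 m \<Delta>"
proof -
  have "tensor_scale (- 1) t = - t" "tensor_scale 1 t = t" for t :: "('p, 'k) tensor2"
    by (auto simp: tensor_scale_def)
  then show "product_pair (- 1) br \<delta>" "product_pair 1 m \<Delta>"
    using alg coalg by (auto simp: product_pair_def poisson_conformal_at_iff poisson_conformal_coalgebra_def
        lie_conformal_coalgebra_def cocomm_coassoc_conformal_def)
qed

context
  fixes Br Mu :: "'p \<times> ('p \<Rightarrow> 'k poly) \<Rightarrow> 'p \<times> ('p \<Rightarrow> 'k poly) \<Rightarrow> ('p \<times> ('p \<Rightarrow> 'k poly)) poly"
  assumes Br: "doubles Br br \<delta>" and Mu: "doubles Mu m \<Delta>"
begin

lemma double_at_P1_P2: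
  "leibniz_at sR P1 Br Br" "assoc_at sR P1 Mu" "leibniz_at sR P1 Br Mu"
  "leibniz_at sR P2 Br Br" "assoc_at sR P2 Mu" "leibniz_at sR P2 Br Mu"
proof -
  have P: "leibniz_at s UNIV br br" "assoc_at s UNIV m" "leibniz_at s UNIV br m"
    using alg by (auto simp: poisson_conformal_at_iff)
  have Pd: "leibniz_at dual_scale Pd (dp \<delta>) (dp \<delta>)" "assoc_at dual_scale Pd (dp \<Delta>)" "leibniz_at dual_scale Pd (dp \<delta>) (dp \<Delta>)"
    using poisson_conformal_dual[OF coalg] by (auto simp: poisson_conformal_at_iff)
  note left = double_left[OF Br product_pairs(1)] double_left[OF Mu product_pairs(2)]
  note right = double_right[OF Br product_pairs(1)] double_right[OF Mu product_pairs(2)]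
  have cop: "coproduct s UNIV \<delta>" "coproduct s UNIV \<Delta>"
    using product_pairs by (auto simp: product_pair_def)
  note mem = dual_product_ev_mem[OF cop(1)] dual_product_ev_mem[OF cop(2)]
  note P' = P[unfolded leibniz_at_def assoc_at_def, rule_format, OF UNIV_I UNIV_I UNIV_I]
  show "leibniz_at sR P1 Br Br" "assoc_at sR P1 Mu" "leibniz_at sR P1 Br Mu"
    unfolding leibniz_at_def assoc_at_def
    by (clarify, simp only: left add_Pair prod.inject add_0, intro conjI P' refl)+
  note Pd' = Pd[unfolded leibniz_at_def assoc_at_def, rule_format]
  show "leibniz_at sR P2 Br Br" "assoc_at sR P2 Mu" "leibniz_at sR P2 Br Mu"
    unfolding leibniz_at_def assoc_at_def
    by (clarify, simp only: right mem add_Pair prod.inject add_0, intro conjI Pd' refl; assumption)+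
qed

context
  fixes a b :: 'p and f g :: "'p \<Rightarrow> 'k poly" and \<alpha> \<beta> \<gamma> \<kappa> :: 'k
  assumes fg: "f \<in> Pd" "g \<in> Pd" and sum: "\<alpha> + \<beta> + \<gamma> + \<kappa> = 0"
begin

lemma summands_mem: "(a, 0) \<in> R" "(b, 0) \<in> R" "(0, f) \<in> R" "(0, g) \<in> R"
  using Pd_closed(1) fg by auto

lemma permuted_momenta:
  "\<alpha> + \<gamma> + \<beta> + \<kappa> = 0" "\<alpha> + \<gamma> + \<kappa> + \<beta> = 0" "\<beta> + \<gamma> + \<alpha> + \<kappa> = 0" "\<beta> + \<alpha> + \<gamma> + \<kappa> = 0" "\<gamma> + \<kappa> + \<alpha> + \<beta> = 0"
  "\<beta> + \<gamma> + \<kappa> + \<alpha> = 0"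
  using sum by (simp_all add: add_ac)

text \<open>
  In this lemma and the next three, \<open>quartic_pure\<close> supplies the coproduct of a
  product and \<open>quartic_mixed\<close> the terms in which a multiplication acts on a factor of
  a coproduct.
\<close>

lemma lie_quartic:
  "D.leibniz4 Br Br (a, 0) \<alpha> (b, 0) \<beta> (0, f) \<gamma> (0, g) \<kappa> \<longleftrightarrow>
   pair f \<gamma> g \<kappa> (\<delta> (evs s \<alpha> (br a b))) =
        \<delta> b (\<lambda>x y. pv f \<gamma> (evs s \<alpha> (br a x)) * pv g \<kappa> y)
        + \<delta> b (\<lambda>x y. pv f \<gamma> x * pv g \<kappa> (evs s \<alpha> (br a y)))
        - (\<delta> a (\<lambda>x y. pv f \<gamma> (evs s \<beta> (br b x)) * pv g \<kappa> y)
          + \<delta> a (\<lambda>x y. pv f \<gamma> x * pv g \<kappa> (evs s \<beta> (br b y))))"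
proof -
  note B = Br product_pairs(1)
  have e: "D.quartic Br Br (a, 0) \<alpha> (0, f) \<gamma> (0, g) \<kappa> (b, 0) \<beta> = - 1 * D.quartic Br Br (a, 0) \<alpha> (0, f) \<gamma> (b, 0) \<beta> (0, g) \<kappa>"
    by (rule D.quartic_swap_right[OF double_gc_hom[OF B] double_gc_hom[OF B] double_flip_symmetric[OF B] summands_mem(1,3,4,2) permuted_momenta(2)])
  show ?thesis
    unfolding D.leibniz4_def e quartic_pure[OF B B fg sum] quartic_mixed[OF B B fg permuted_momenta(1)] quartic_mixed_swapped[OF B B fg sum]
    by (rule iffI; algebra)
qed

lemma assoc_quartic:
  "D.assoc4 Mu (a, 0) \<alpha> (b, 0) \<beta> (0, f) \<gamma> (0, g) \<kappa> \<longleftrightarrow>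
   pair f \<gamma> g \<kappa> (\<Delta> (evs s \<alpha> (m a b))) =
        \<Delta> b (\<lambda>x y. pv f \<gamma> (evs s \<alpha> (m a x)) * pv g \<kappa> y)
        + \<Delta> a (\<lambda>x y. pv f \<gamma> x * pv g \<kappa> (evs s \<beta> (m b y))) \<and>
   pair f \<gamma> g \<kappa> (\<Delta> (evs s \<alpha> (m a b))) =
        \<Delta> b (\<lambda>x y. pv f \<gamma> x * pv g \<kappa> (evs s \<alpha> (m a y)))
        + \<Delta> a (\<lambda>x y. pv f \<gamma> (evs s \<beta> (m b x)) * pv g \<kappa> y)"
proof -
  note B = Mu product_pairs(2)
  show ?thesis
    unfolding D.assoc4_def quartic_pure[OF B B fg sum] quartic_mixed[OF B B fg permuted_momenta(1)] quartic_mixed_swapped[OF B B fg sum]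
    by simp
qed

lemma derivation_quartic:
  "D.leibniz4 Br Mu (a, 0) \<alpha> (b, 0) \<beta> (0, f) \<gamma> (0, g) \<kappa> \<longleftrightarrow>
   pair f \<gamma> g \<kappa> (\<Delta> (evs s \<alpha> (br a b))) =
        \<Delta> b (\<lambda>x y. pv f \<gamma> (evs s \<alpha> (br a x)) * pv g \<kappa> y)
        + \<Delta> b (\<lambda>x y. pv f \<gamma> x * pv g \<kappa> (evs s \<alpha> (br a y)))
        - \<delta> a (\<lambda>x y. pv f \<gamma> x * pv g \<kappa> (evs s \<beta> (m b y)))
        + \<delta> a (\<lambda>x y. pv f \<gamma> (evs s \<beta> (m b x)) * pv g \<kappa> y)"
proof -
  note B = Br product_pairs(1) and C = Mu product_pairs(2)
  have e: "D.quartic Br Mu (a, 0) \<alpha> (0, f) \<gamma> (0, g) \<kappa> (b, 0) \<beta> = 1 * D.quartic Br Mu (a, 0) \<alpha> (0, f) \<gamma> (b, 0) \<beta> (0, g) \<kappa>"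
    by (rule D.quartic_swap_right[OF double_gc_hom[OF B] double_gc_hom[OF C] double_flip_symmetric[OF C] summands_mem(1,3,4,2) permuted_momenta(2)])
  show ?thesis
    unfolding D.leibniz4_def e quartic_pure[OF B C fg sum] quartic_mixed[OF B C fg permuted_momenta(1)] quartic_mixed_swapped[OF B C fg sum]
    by (rule iffI; algebra)
qed

lemma leibniz_quartic:
  "D.leibniz4 Br Mu (0, f) \<gamma> (0, g) \<kappa> (a, 0) \<alpha> (b, 0) \<beta> \<longleftrightarrow>
   pair f \<gamma> g \<kappa> (\<delta> (evs s \<alpha> (m a b))) =
        \<delta> b (\<lambda>x y. pv f \<gamma> x * pv g \<kappa> (evs s \<alpha> (m a y)))
        + \<delta> a (\<lambda>x y. pv f \<gamma> x * pv g \<kappa> (evs s \<beta> (m b y)))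
        - \<Delta> b (\<lambda>x y. pv f \<gamma> (evs s \<alpha> (br a x)) * pv g \<kappa> y)
        - \<Delta> a (\<lambda>x y. pv f \<gamma> (evs s \<beta> (br b x)) * pv g \<kappa> y)"
proof -
  note B = Br product_pairs(1) and C = Mu product_pairs(2)
  note gc = double_gc_hom[OF B] double_gc_hom[OF C]
  have e1: "D.quartic Br Mu (0, f) \<gamma> (0, g) \<kappa> (a, 0) \<alpha> (b, 0) \<beta> = D.quartic Mu Br (a, 0) \<alpha> (b, 0) \<beta> (0, f) \<gamma> (0, g) \<kappa>"
    by (rule D.quartic_commute[OF gc summands_mem(3,4,1,2) permuted_momenta(5)])
  have e2: "D.quartic Br Mu (0, f) \<gamma> (a, 0) \<alpha> (b, 0) \<beta> (0, g) \<kappa> = - 1 * D.quartic Br Mu (a, 0) \<alpha> (0, f) \<gamma> (b, 0) \<beta> (0, g) \<kappa>"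
    by (rule D.quartic_swap[OF gc double_flip_symmetric[OF B] summands_mem(3,1,2,4)])
  have e3: "D.quartic Br Mu (0, f) \<gamma> (b, 0) \<beta> (0, g) \<kappa> (a, 0) \<alpha> =
      - 1 * D.quartic Br Mu (b, 0) \<beta> (0, f) \<gamma> (a, 0) \<alpha> (0, g) \<kappa>"
    using D.quartic_swap[OF gc double_flip_symmetric[OF B] summands_mem(3,2,4,1), of \<gamma> \<beta> \<kappa> \<alpha>]
      D.quartic_swap_right[OF gc double_flip_symmetric[OF C] summands_mem(2,3,4,1) permuted_momenta(6)] by simp
  show ?thesis
    unfolding D.leibniz4_def e1 e2 e3 quartic_pure[OF C B fg sum] quartic_mixed[OF B C fg permuted_momenta(1)] quartic_mixed[OF B C fg permuted_momenta(3)]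
    by (rule iffI; algebra)
qed

end

lemma lie_compatible_iff:
  "D.for_quadruples (D.leibniz4 Br Br) P1 P1 P2 P2 \<longleftrightarrow> lie_compatible br \<delta>"
  unfolding for_quadruples_double lie_compatible_def
  by (intro all_cong1 ball_cong imp_cong refl) (rule lie_quartic)

lemma derivation_compatible_iff:
  "D.for_quadruples (D.leibniz4 Br Mu) P1 P1 P2 P2 \<longleftrightarrow> derivation_compatible br m \<delta> \<Delta>"
  unfolding for_quadruples_double derivation_compatible_def
  by (intro all_cong1 ball_cong imp_cong refl) (rule derivation_quartic)

lemma coproduct_swap:
  assumes "linear_form (kscale s) \<phi>" "linear_form (kscale s) \<chi>"
  shows "\<delta> v (\<lambda>x y. \<chi> x * \<phi> y) = - \<delta> v (\<lambda>x y. \<phi> x * \<chi> y)"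
    "\<Delta> v (\<lambda>x y. \<chi> x * \<phi> y) = \<Delta> v (\<lambda>x y. \<phi> x * \<chi> y)"
  using coproduct_flip[OF product_pairs(1) bil_prod[OF assms(2,1)], of v]
    coproduct_flip[OF product_pairs(2) bil_prod[OF assms(2,1)], of v]
  by (simp_all add: mult.commute)

lemma products_k_linear: "k_linear (br x)" "k_linear (m x)"
  using product_pairs by (auto simp: product_pair_def gc_hom_def conformal_map_def)

lemma cop_swap:
  assumes fg: "f \<in> Pd" "g \<in> Pd"
  shows "pair g \<kappa> f \<gamma> (\<delta> v) = - pair f \<gamma> g \<kappa> (\<delta> v)" "pair g \<kappa> f \<gamma> (\<Delta> v) = pair f \<gamma> g \<kappa> (\<Delta> v)"
    "\<delta> v (\<lambda>x y. pv g \<kappa> (evs s \<alpha> (br a x)) * pv f \<gamma> y) = - \<delta> v (\<lambda>x y. pv f \<gamma> x * pv g \<kappa> (evs s \<alpha> (br a y)))"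
    "\<delta> v (\<lambda>x y. pv g \<kappa> (evs s \<alpha> (m a x)) * pv f \<gamma> y) = - \<delta> v (\<lambda>x y. pv f \<gamma> x * pv g \<kappa> (evs s \<alpha> (m a y)))"
    "\<Delta> v (\<lambda>x y. pv g \<kappa> (evs s \<alpha> (m a x)) * pv f \<gamma> y) = \<Delta> v (\<lambda>x y. pv f \<gamma> x * pv g \<kappa> (evs s \<alpha> (m a y)))"
    "\<Delta> v (\<lambda>x y. pv g \<kappa> x * pv f \<gamma> (evs s \<alpha> (m a y))) = \<Delta> v (\<lambda>x y. pv f \<gamma> (evs s \<alpha> (m a x)) * pv g \<kappa> y)"
    "\<Delta> v (\<lambda>x y. pv g \<kappa> x * pv f \<gamma> (evs s \<alpha> (br a y))) = \<Delta> v (\<lambda>x y. pv f \<gamma> (evs s \<alpha> (br a x)) * pv g \<kappa> y)"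
  by (rule coproduct_swap dual_form_linear form_at fg products_k_linear)+

text \<open>
  The quartic condition consists of the compatibility condition at \<open>f \<otimes> g\<close>
  and the one at \<open>g \<otimes> f\<close>, rewritten by cocommutativity.
\<close>

lemma assoc_compatible_iff:
  "D.for_quadruples (D.assoc4 Mu) P1 P1 P2 P2 \<longleftrightarrow> assoc_compatible m \<Delta>"
proof
  assume L: "D.for_quadruples (D.assoc4 Mu) P1 P1 P2 P2"
  show "assoc_compatible m \<Delta>"
    unfolding assoc_compatible_def
  proof (intro allI ballI impI)
    fix a b f g and \<alpha> \<beta> \<gamma> \<kappa> :: 'k assume fg: "f \<in> Pd" "g \<in> Pd" and sum: "\<alpha> + \<beta> + \<gamma> + \<kappa> = 0"
    then have "D.assoc4 Mu (a, 0) \<alpha> (b, 0) \<beta> (0, f) \<gamma> (0, g) \<kappa>"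
      using L unfolding for_quadruples_double by blast
    then show "pair f \<gamma> g \<kappa> (\<Delta> (evs s \<alpha> (m a b))) =
        \<Delta> b (\<lambda>x y. pv f \<gamma> x * pv g \<kappa> (evs s \<alpha> (m a y)))
        + \<Delta> a (\<lambda>x y. pv f \<gamma> (evs s \<beta> (m b x)) * pv g \<kappa> y)"
      unfolding assoc_quartic[OF fg sum] by blast
  qed
next
  assume R: "assoc_compatible m \<Delta>"
  show "D.for_quadruples (D.assoc4 Mu) P1 P1 P2 P2"
    unfolding for_quadruples_double
  proof (intro allI ballI impI)
    fix a b f g and \<alpha> \<beta> \<gamma> \<kappa> :: 'k assume fg: "f \<in> Pd" "g \<in> Pd" and sum: "\<alpha> + \<beta> + \<gamma> + \<kappa> = 0"
    have sum': "\<alpha> + \<beta> + \<kappa> + \<gamma> = 0" using sum by (simp add: add_ac)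
    note R' = R[unfolded assoc_compatible_def, rule_format]
    show "D.assoc4 Mu (a, 0) \<alpha> (b, 0) \<beta> (0, f) \<gamma> (0, g) \<kappa>"
      unfolding assoc_quartic[OF fg sum]
      using R'[OF fg sum] R'[OF fg(2,1) sum', unfolded cop_swap[OF fg]] by blast
  qed
qed

text \<open>
  By the symmetries of the coproducts, the quartic condition at \<open>f \<otimes> g\<close> is
  the compatibility condition at \<open>g \<otimes> f\<close>.
\<close>

lemma leibniz_compatible_iff:
  "D.for_quadruples (D.leibniz4 Br Mu) P2 P2 P1 P1 \<longleftrightarrow> leibniz_compatible br m \<delta> \<Delta>"
proof
  assume L: "D.for_quadruples (D.leibniz4 Br Mu) P2 P2 P1 P1"
  show "leibniz_compatible br m \<delta> \<Delta>"
    unfolding leibniz_compatible_def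
  proof (intro allI ballI impI)
    fix a b g f and \<alpha> \<beta> \<kappa> \<gamma> :: 'k assume fg: "g \<in> Pd" "f \<in> Pd" and "\<alpha> + \<beta> + \<kappa> + \<gamma> = 0"
    then have sum: "\<alpha> + \<beta> + \<gamma> + \<kappa> = 0" by (simp add: add_ac)
    then have "D.leibniz4 Br Mu (0, f) \<gamma> (0, g) \<kappa> (a, 0) \<alpha> (b, 0) \<beta>"
      using L fg unfolding for_quadruples_double by blast
    then show "pair g \<kappa> f \<gamma> (\<delta> (evs s \<alpha> (m a b))) =
        \<delta> b (\<lambda>x y. pv g \<kappa> (evs s \<alpha> (m a x)) * pv f \<gamma> y)
        + \<delta> a (\<lambda>x y. pv g \<kappa> (evs s \<beta> (m b x)) * pv f \<gamma> y)
        + \<Delta> b (\<lambda>x y. pv g \<kappa> x * pv f \<gamma> (evs s \<alpha> (br a y)))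
        + \<Delta> a (\<lambda>x y. pv g \<kappa> x * pv f \<gamma> (evs s \<beta> (br b y)))"
      unfolding leibniz_quartic[OF fg(2,1) sum] cop_swap[OF fg(2,1)] by algebra
  qed
next
  assume R: "leibniz_compatible br m \<delta> \<Delta>"
  show "D.for_quadruples (D.leibniz4 Br Mu) P2 P2 P1 P1"
    unfolding for_quadruples_double
  proof (intro allI ballI impI)
    fix a b f g and \<alpha> \<beta> \<gamma> \<kappa> :: 'k assume fg: "f \<in> Pd" "g \<in> Pd" and sum: "\<alpha> + \<beta> + \<gamma> + \<kappa> = 0"
    have sum': "\<alpha> + \<beta> + \<kappa> + \<gamma> = 0" using sum by (simp add: add_ac)
    show "D.leibniz4 Br Mu (0, f) \<gamma> (0, g) \<kappa> (a, 0) \<alpha> (b, 0) \<beta>"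
      using R[unfolded leibniz_compatible_def, rule_format, OF fg(2,1) sum', of a b, unfolded cop_swap[OF fg]]
      unfolding leibniz_quartic[OF fg sum] by algebra
  qed
qed

text \<open>
  Only the identities with two arguments in each summand are left by
  \<open>poisson_conformal_split_iff\<close>, and they are the four compatibility conditions.
\<close>

theorem double_poisson_iff:
  "poisson_conformal sR R Br Mu \<longleftrightarrow> poisson_conformal_bialgebra s UNIV br m \<delta> \<Delta>"
proof -
  note B = Br product_pairs(1) and C = Mu product_pairs(2)
  have UV: "\<exists>u\<in>P1. \<exists>v\<in>P2. x = u + v" if "x \<in> R" for x
    using that double_carriers(3) by blast
  have "poisson_conformal sR R Br Mu \<longleftrightarrow>
    D.for_quadruples (D.leibniz4 Br Br) P1 P1 P2 P2 \<and> D.for_quadruples (D.assoc4 Mu) P1 P1 P2 P2 \<and>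
    D.for_quadruples (D.leibniz4 Br Mu) P1 P1 P2 P2 \<and> D.for_quadruples (D.leibniz4 Br Mu) P2 P2 P1 P1"
    by (rule D.poisson_conformal_split_iff[OF double_carriers(1,2) UV fg_modules(3)
          double_gc_hom[OF B] double_cyclic[OF B] double_flip_symmetric[OF B]
          double_gc_hom[OF C] double_cyclic[OF C] double_flip_symmetric[OF C]
          double_at_P1_P2])
  then show ?thesis
    unfolding lie_compatible_iff assoc_compatible_iff derivation_compatible_iff leibniz_compatible_iff
      poisson_conformal_bialgebra_at_iff[OF alg coalg] by blast
qed

end

end

section \<open>The matched pair products\<close>

lemma dual_flip_at:
  "pv (evs dual_scale \<alpha> (flip dual_scale p)) \<nu> c = pv (evs dual_scale (\<nu> - \<alpha>) p) \<nu> c"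
  using momentum_form_flip[OF module_dual_scale dual_momentum_form, where \<nu>1 = \<nu> and v1 = c and c = \<alpha> and p = p] by simp

lemma flip_at: "f \<in> Pd \<Longrightarrow> pv f \<nu> (evs s \<alpha> (flip s p)) = pv f \<nu> (evs s (- \<alpha> - \<nu>) p)"
  by (rule momentum_form_flip[OF module_axioms dual_form])

lemma Pd_diff: "f \<in> Pd \<Longrightarrow> g \<in> Pd \<Longrightarrow> f - g \<in> Pd"
  using Pd_closed(2)[of f "- g"] Pd_closed(5)[of g] by simp

lemma doubles_pairI:
  assumes mem: "\<And>a b f g k. f \<in> Pd \<Longrightarrow> g \<in> Pd \<Longrightarrow> coeff (Y a f b g) k \<in> Pd"
    and eq: "\<And>a b c f g h \<alpha> \<beta> \<gamma>. f \<in> Pd \<Longrightarrow> g \<in> Pd \<Longrightarrow> h \<in> Pd \<Longrightarrow> \<alpha> + \<beta> + \<gamma> = 0 \<Longrightarrow>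
      pv (evs dual_scale \<alpha> (Y a f b g)) (\<alpha> + \<beta>) c + pv h \<gamma> (evs s \<alpha> (X a f b g)) = trilinear n D a f \<alpha> b g \<beta> c h \<gamma>"
  shows "doubles (\<lambda>(a, f) (b, g). pair_poly (X a f b g) (Y a f b g)) n D"
  unfolding doubles_def
proof (intro conjI ballI allI impI)
  show "coeff ((\<lambda>(a, f) (b, g). pair_poly (X a f b g) (Y a f b g)) x y) k \<in> R" if "x \<in> R" "y \<in> R" for x y k
    using that mem by (auto simp: coeff_pair_poly)
  show "dform (\<alpha> + \<beta>) (evs sR \<alpha> ((\<lambda>(a, f) (b, g). pair_poly (X a f b g) (Y a f b g)) (a, f) (b, g))) (c, h) =
      trilinear n D a f \<alpha> b g \<beta> c h \<gamma>"
    if "f \<in> Pd" "g \<in> Pd" "h \<in> Pd" and sum: "\<alpha> + \<beta> + \<gamma> = 0" for a b c f g h \<alpha> \<beta> \<gamma>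
  proof -
    have "- (\<alpha> + \<beta>) = \<gamma>" using sum by algebra
    then show ?thesis
      using eq[OF that(1,2,3) sum, of a b c]
      by (simp only: prod.case evs_pair_poly[OF module_axioms module_dual_scale] dform_simp)
  qed
qed

text \<open>
  Paired with \<open>c + h\<close>, each of the six terms of the matched bracket is one of the six
  terms of \<open>trilinear\<close>; skew-symmetry of \<open>br\<close> and
  \<open>\<delta>\<close> is used once each to match the orders of arguments.
\<close>

lemma matched_bracket_doubles:
  assumes pp: "product_pair (- 1) br \<delta>"
  shows "doubles (matched_bracket s br dual_scale (dp \<delta>) (dual_rep UNIV br) (codual_rep s UNIV (dp \<delta>))) br \<delta>"
  unfolding matched_bracket_def
proof (rule doubles_pairI)
  have br: "gc_hom s UNIV s UNIV br" and \<delta>: "coproduct s UNIV \<delta>" using pp by (auto simp: product_pair_def)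
  interpret DS: vector_space "kscale (dual_scale :: 'k poly \<Rightarrow> ('p \<Rightarrow> 'k poly) \<Rightarrow> _)"
    by (rule vector_space_kscale) (rule module_dual_scale)
  show "coeff (dp \<delta> f g + dual_rep UNIV br a g - flip dual_scale (dual_rep UNIV br b f)) k \<in> Pd"
    if "f \<in> Pd" "g \<in> Pd" for a b f g k
    by (simp only: coeff_add coeff_diff)
      (intro Pd_diff Pd_closed(2) dual_product_mem[OF \<delta>] dual_rep_at(1)[OF br] that
        flip_mem[OF module_dual_scale subspace_Pd])
  show "pv (evs dual_scale \<alpha> (dp \<delta> f g + dual_rep UNIV br a g - flip dual_scale (dual_rep UNIV br b f))) (\<alpha> + \<beta>) c +
       pv h \<gamma> (evs s \<alpha> (br a b + codual_rep s UNIV (dp \<delta>) f b - flip s (codual_rep s UNIV (dp \<delta>) g a))) =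
       trilinear br \<delta> a f \<alpha> b g \<beta> c h \<gamma>"
    if fgh: "f \<in> Pd" "g \<in> Pd" "h \<in> Pd" and sum: "\<alpha> + \<beta> + \<gamma> = 0" for a b c f g h \<alpha> \<beta> \<gamma>
  proof -
    have momenta: "\<alpha> + \<beta> - \<alpha> = \<beta>" "\<alpha> + \<beta> - \<beta> = \<alpha>" by simp_all
    have momenta': "- \<alpha> - \<gamma> = \<beta>" "\<gamma> + \<alpha> + \<beta> = 0" using sum by algebra+
    show ?thesis
      by (simp only: DS.ev_add DS.ev_diff K.ev_add K.ev_diff pv_simps[OF fgh(3)] plus_fun_apply fun_diff_def poly_add poly_diff
          dual_product_at[OF \<delta> fgh(1,2)] dual_rep_at(2)[OF br fgh(1)] dual_rep_at(2)[OF br fgh(2)] dual_flip_at flip_at[OF fgh(3)]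
          codual_rep_at[OF \<delta> fgh(1,3)] codual_rep_at[OF \<delta> fgh(2,3)] momenta momenta' trilinear_def
          product_flip[OF pp fgh(2) momenta'(2), of c a] pair_flip[OF pp fgh(3,1), of b \<gamma> \<alpha>]) simp
  qed
qed

lemma matched_mult_doubles:
  assumes pp: "product_pair 1 m \<Delta>"
  shows "doubles (matched_mult s m dual_scale (dp \<Delta>) (\<lambda>a f. - dual_rep UNIV m a f) (\<lambda>f a. - codual_rep s UNIV (dp \<Delta>) f a)) m \<Delta>"
  unfolding matched_mult_def
proof (rule doubles_pairI)
  have m: "gc_hom s UNIV s UNIV m" and \<Delta>: "coproduct s UNIV \<Delta>" using pp by (auto simp: product_pair_def)
  interpret DS: vector_space "kscale (dual_scale :: 'k poly \<Rightarrow> ('p \<Rightarrow> 'k poly) \<Rightarrow> _)"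
    by (rule vector_space_kscale) (rule module_dual_scale)
  show "coeff (dp \<Delta> f g + - dual_rep UNIV m a g + flip dual_scale (- dual_rep UNIV m b f)) k \<in> Pd"
    if "f \<in> Pd" "g \<in> Pd" for a b f g k
    by (simp only: coeff_add coeff_minus)
      (intro Pd_closed(2) dual_product_mem[OF \<Delta>] dual_rep_at(1)[OF m] that Pd_closed(5)
        flip_mem[OF module_dual_scale subspace_Pd] | simp only: coeff_minus)+
  show "pv (evs dual_scale \<alpha> (dp \<Delta> f g + - dual_rep UNIV m a g + flip dual_scale (- dual_rep UNIV m b f))) (\<alpha> + \<beta>) c +
       pv h \<gamma> (evs s \<alpha> (m a b + - codual_rep s UNIV (dp \<Delta>) f b + flip s (- codual_rep s UNIV (dp \<Delta>) g a))) =
       trilinear m \<Delta> a f \<alpha> b g \<beta> c h \<gamma>"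
    if fgh: "f \<in> Pd" "g \<in> Pd" "h \<in> Pd" and sum: "\<alpha> + \<beta> + \<gamma> = 0" for a b c f g h \<alpha> \<beta> \<gamma>
  proof -
    have momenta: "\<alpha> + \<beta> - \<alpha> = \<beta>" "\<alpha> + \<beta> - \<beta> = \<alpha>" by simp_all
    have momenta': "- \<alpha> - \<gamma> = \<beta>" "\<gamma> + \<alpha> + \<beta> = 0" using sum by algebra+
    show ?thesis
      by (simp only: DS.ev_add DS.ev_minus K.ev_add K.ev_minus pv_simps[OF fgh(3)] plus_fun_apply uminus_apply poly_add poly_minus
          dual_product_at[OF \<Delta> fgh(1,2)] dual_rep_at(2)[OF m fgh(1)] dual_rep_at(2)[OF m fgh(2)] dual_flip_at flip_at[OF fgh(3)]
          codual_rep_at[OF \<Delta> fgh(1,3)] codual_rep_at[OF \<Delta> fgh(2,3)] momenta momenta' trilinear_def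
          product_flip[OF pp fgh(2) momenta'(2), of c a] pair_flip[OF pp fgh(3,1), of b \<gamma> \<alpha>]) simp
  qed
qed

section \<open>Invariant products that extend those of the summands\<close>

text \<open>
  Expand \<open>\<langle>(a+f)\<^sub>\<alpha> (b+g), c+h\<rangle>\<close> into eight homogeneous
  parts. The two parts with all arguments in the same summand vanish, as the summands are
  subalgebras and isotropic. A rotation brings each other part to the product of two elements of
  one summand, paired with an element of the other.
\<close>

lemma cyclic_extension_doubles:
  assumes M: "gc_hom sR R sR R M" and cyc: "D.cyclic M" and ext: "extends_products UNIV n Pd (dp D) M"
    and D: "coproduct s UNIV D"
  shows "doubles M n D"
  unfolding doubles_def
proof (intro conjI ballI allI impI)
  note gc = gc_homD[OF module_sR subspaces(1) M]
  show "coeff (M x y) k \<in> R" if "x \<in> R" "y \<in> R" for x y k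
    by (rule gc(1)) (use that in auto)
  fix a b c f g h and \<alpha> \<beta> \<gamma> :: 'k assume fgh: "f \<in> Pd" "g \<in> Pd" "h \<in> Pd" and sum: "\<alpha> + \<beta> + \<gamma> = 0"
  interpret DS: vector_space "kscale (dual_scale :: 'k poly \<Rightarrow> ('p \<Rightarrow> 'k poly) \<Rightarrow> _)"
    by (rule vector_space_kscale) (rule module_dual_scale)
  note evp = evs_pair_poly[OF module_axioms module_dual_scale]
  have left: "evs sR \<nu> (M (u, 0) (v, 0)) = (evs s \<nu> (n u v), 0)" for \<nu> u v
    using ext by (simp add: extends_products_def evp)
  have right: "evs sR \<nu> (M (0, k) (0, l)) = (0, evs dual_scale \<nu> (dp D k l))" if "k \<in> Pd" "l \<in> Pd" for \<nu> k l
    using ext that by (simp add: extends_products_def evp)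
  have mem: "(u, 0) \<in> R" "k \<in> Pd \<Longrightarrow> (0, k) \<in> R" for u k using Pd_closed(1) by auto
  have cyc1: "dform (\<alpha> + \<beta>) (evs sR \<alpha> (M x y)) z = dform (\<beta> + \<gamma>) (evs sR \<beta> (M y z)) x"
    if "x \<in> R" "y \<in> R" "z \<in> R" for x y z
    using cyc that sum unfolding D.cyclic_def by blast
  have cyc2: "dform (\<alpha> + \<beta>) (evs sR \<alpha> (M x y)) z = dform (\<gamma> + \<alpha>) (evs sR \<gamma> (M z x)) y"
    if "x \<in> R" "y \<in> R" "z \<in> R" for x y z
  proof -
    have "\<beta> + \<gamma> + \<alpha> = 0" using sum by (simp add: add_ac)
    then show ?thesis using cyc1[OF that] cyc that unfolding D.cyclic_def by metis
  qed
  have momenta: "- (\<alpha> + \<beta>) = \<gamma>" "- (\<gamma> + \<alpha>) = \<beta>" "- (\<beta> + \<gamma>) = \<alpha>" using sum by algebra+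
  have momenta': "\<alpha> + \<beta> - \<alpha> = \<beta>" "\<beta> + \<gamma> - \<beta> = \<gamma>" "\<gamma> + \<alpha> - \<gamma> = \<alpha>" by simp_all
  have zero: "pv k \<nu> 0 = 0" if "k \<in> Pd" for k \<nu> using pv_0[OF that] .
  have zero': "pv (0 :: 'p \<Rightarrow> 'k poly) \<nu> v = 0" for \<nu> v by simp
  note dpm = dual_product_ev_mem[OF D]
  note at = dform_simp zero zero' fgh dpm dual_product_at[OF D] momenta momenta' add_0_left add_0_right
  let ?t = "\<lambda>x y z. dform (\<alpha> + \<beta>) (evs sR \<alpha> (M x y)) z"
  have t: "?t (a, 0) (b, 0) (c, 0) = 0" "?t (a, 0) (b, 0) (0, h) = pv h \<gamma> (evs s \<alpha> (n a b))"
    "?t (a, 0) (0, g) (c, 0) = pv g \<beta> (evs s \<gamma> (n c a))" "?t (a, 0) (0, g) (0, h) = pair g \<beta> h \<gamma> (D a)"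
    "?t (0, f) (b, 0) (c, 0) = pv f \<alpha> (evs s \<beta> (n b c))" "?t (0, f) (b, 0) (0, h) = pair h \<gamma> f \<alpha> (D b)"
    "?t (0, f) (0, g) (c, 0) = pair f \<alpha> g \<beta> (D c)" "?t (0, f) (0, g) (0, h) = 0"
    by (simp_all only: left right fgh at cyc2[OF mem(1) mem(2)[OF fgh(2)] mem(1)] cyc1[OF mem(1) mem(2)[OF fgh(2)] mem(2)[OF fgh(3)]]
        cyc1[OF mem(2)[OF fgh(1)] mem(1) mem(1)] cyc2[OF mem(2)[OF fgh(1)] mem(1) mem(2)[OF fgh(3)]])
  have split: "(a, f) = (a, 0) + (0, f)" "(b, g) = (b, 0) + (0, g)" "(c, h) = (c, 0) + (0, h)" by simp_all
  have mems: "(a, 0) \<in> R" "(0, f) \<in> R" "(b, 0) \<in> R" "(0, g) \<in> R" "(c, 0) \<in> R" "(0, h) \<in> R"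
    by (simp_all only: mem fgh)
  have "?t ((a, 0) + (0, f)) ((b, 0) + (0, g)) ((c, 0) + (0, h)) =
    ?t (a, 0) (b, 0) (c, 0) + ?t (a, 0) (b, 0) (0, h) + ?t (a, 0) (0, g) (c, 0) + ?t (a, 0) (0, g) (0, h) +
    ?t (0, f) (b, 0) (c, 0) + ?t (0, f) (b, 0) (0, h) + ?t (0, f) (0, g) (c, 0) + ?t (0, f) (0, g) (0, h)"
  proof -
    have cl: "evs sR \<alpha> (M x y) \<in> R" if "x \<in> R" "y \<in> R" for x y by (rule gc(2)) (use that in auto)
    have add: "evs sR \<alpha> (M (x + x') y) = evs sR \<alpha> (M x y) + evs sR \<alpha> (M x' y)"
      "evs sR \<alpha> (M y (x + x')) = evs sR \<alpha> (M y x) + evs sR \<alpha> (M y x')" if "x \<in> R" "x' \<in> R" "y \<in> R" for x x' y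
      using gc(3)[of x x' y y] gc(6)[of y y x x'] that by auto
    have "?t ((a, 0) + (0, f)) ((b, 0) + (0, g)) z =
      ?t (a, 0) (b, 0) z + ?t (a, 0) (0, g) z + ?t (0, f) (b, 0) z + ?t (0, f) (0, g) z" if "z \<in> R" for z
      by (simp only: add mems that D.kappa_linear D.R_closed add_ac)
    moreover have "?t x y ((c, 0) + (0, h)) = ?t x y (c, 0) + ?t x y (0, h)" if "x \<in> R" "y \<in> R" for x y
      by (rule D.kappa_right(1)[OF cl[OF that] mems(5,6)])
    ultimately show ?thesis using mems D.R_closed by (simp only: mems D.R_closed add_ac)
  qed
  then show "dform (\<alpha> + \<beta>) (evs sR \<alpha> (M (a, f) (b, g))) (c, h) = trilinear n D a f \<alpha> b g \<beta> c h \<gamma>"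
    unfolding split[symmetric] t trilinear_def by simp
qed

end

theorem theorem3p8:
  fixes s :: "'k::field_char_0 poly \<Rightarrow> 'p::ab_group_add \<Rightarrow> 'p"
    and br m :: "'p \<Rightarrow> 'p \<Rightarrow> 'p poly"
    and \<delta> \<Delta> :: "'p \<Rightarrow> ('p, 'k) tensor2"
  defines "P \<equiv> (UNIV :: 'p set)"
    and "Pd \<equiv> conf_dual s (UNIV :: 'p set)"
    and "brd \<equiv> dual_product s (UNIV :: 'p set) \<delta>"
    and "md \<equiv> dual_product s (UNIV :: 'p set) \<Delta>"
  assumes "poisson_conformal s P br m"
    and "poisson_conformal_coalgebra s P \<delta> \<Delta>"
    and "free_module s P"
  shows "(poisson_conformal_bialgebra s P br m \<delta> \<Delta> \<longleftrightarrow>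
            matched_pair s P br m dual_scale Pd brd md
              (dual_rep P br) (\<lambda>a f. - dual_rep P m a f)
              (codual_rep s P brd) (\<lambda>f a. - codual_rep s P md f a)) \<and>
         (matched_pair s P br m dual_scale Pd brd md
              (dual_rep P br) (\<lambda>a f. - dual_rep P m a f)
              (codual_rep s P brd) (\<lambda>f a. - codual_rep s P md f a) \<longleftrightarrow>
            (\<exists>brR mR. extends_products P br Pd brd brR \<and> extends_products P m Pd md mR \<and>
               manin_triple (prod_scale s dual_scale) (P \<times> Pd) brR mR double_form
                 (P \<times> {0}) ({0} \<times> Pd)))"
proof -
  have alg: "poisson_conformal s UNIV br m" and coalg: "poisson_conformal_coalgebra s UNIV \<delta> \<Delta>"
    and free: "free_module s (UNIV :: 'p set)"
    using assms by auto
  have "fg_module s (UNIV :: 'p set)" using alg by (simp add: poisson_conformal_at_iff)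
  then obtain B where "finite_free_module s B"
    using finite_free_moduleI free by blast
  then interpret F: finite_free_module s B .
  note pp = F.product_pairs[OF alg coalg]
  have gc: "gc_hom s UNIV s UNIV br" "gc_hom s UNIV s UNIV m"
    and cop: "coproduct s UNIV \<delta>" "coproduct s UNIV \<Delta>"
    using pp by (auto simp: F.product_pair_def)
  let ?R = "UNIV \<times> Pd" and ?sR = "prod_scale s dual_scale"
  let ?Br = "matched_bracket s br dual_scale brd (dual_rep P br) (codual_rep s P brd)"
  let ?Mu = "matched_mult s m dual_scale md (\<lambda>a f. - dual_rep P m a f) (\<lambda>f a. - codual_rep s P md f a)"
  have Br: "F.doubles ?Br br \<delta>" and Mu: "F.doubles ?Mu m \<Delta>"
    unfolding P_def brd_def md_def
    by (rule F.matched_bracket_doubles[OF pp(1)] F.matched_mult_doubles[OF pp(2)])+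
  have matched: "matched_pair s P br m dual_scale Pd brd md
      (dual_rep P br) (\<lambda>a f. - dual_rep P m a f)
      (codual_rep s P brd) (\<lambda>f a. - codual_rep s P md f a) \<longleftrightarrow> poisson_conformal ?sR ?R ?Br ?Mu"
    using F.poisson_conformal_dual[OF coalg] F.gc_hom_dual_rep[OF gc(1)] F.gc_hom_codual[OF cop(1)]
      gc_hom_uminus[OF module_dual_scale F.subspace_Pd F.gc_hom_dual_rep[OF gc(2)]]
      gc_hom_uminus[OF F.mods F.gc_hom_codual[OF cop(2)]] alg
    unfolding matched_pair_def P_def Pd_def brd_def md_def by simp
  have ab: "poisson_conformal_bialgebra s P br m \<delta> \<Delta> \<longleftrightarrow> poisson_conformal ?sR ?R ?Br ?Mu"
    using F.double_poisson_iff[OF alg coalg Br Mu] by (simp add: P_def Pd_def)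
  have dform: "F.dform \<nu> x y = poly (double_form x y) \<nu>" for \<nu> x y by (rule F.dform_def)
  have bc: "manin_triple ?sR ?R ?Br ?Mu double_form (UNIV \<times> {0}) ({0} \<times> Pd)"
    if R: "poisson_conformal ?sR ?R ?Br ?Mu"
  proof -
    note B = Br pp(1) and C = Mu pp(2)
    have "invariant_form ?sR ?R ?Br double_form" "invariant_form ?sR ?R ?Mu double_form"
      using F.D.invariant_form_iff[OF dform F.double_gc_hom[OF B]] F.double_cyclic[OF B]
        F.D.invariant_form_iff[OF dform F.double_gc_hom[OF C]] F.double_cyclic[OF C]
      by (simp_all add: Pd_def)
    moreover have "poisson_conformal ?sR (UNIV \<times> {0}) ?Br ?Mu"
    proof (rule poisson_conformal_sub[OF R])
      show "coeff (?Br x y) n \<in> UNIV \<times> {0} \<and> coeff (?Mu x y) n \<in> UNIV \<times> {0}"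
        if "x \<in> UNIV \<times> {0}" "y \<in> UNIV \<times> {0}" for x y n
        using that F.double_extends[OF B] F.double_extends[OF C]
        by (auto simp: extends_products_def coeff_pair_poly)
    qed (use F.fg_modules F.double_carriers in \<open>auto simp: Pd_def\<close>)
    moreover have "poisson_conformal ?sR ({0} \<times> Pd) ?Br ?Mu"
    proof (rule poisson_conformal_sub[OF R])
      show "coeff (?Br x y) n \<in> {0} \<times> Pd \<and> coeff (?Mu x y) n \<in> {0} \<times> Pd"
        if "x \<in> {0} \<times> Pd" "y \<in> {0} \<times> Pd" for x y n
        using that F.double_extends[OF B] F.double_extends[OF C] F.dual_product_mem[OF cop(1)] F.dual_product_mem[OF cop(2)]
        by (auto simp: extends_products_def coeff_pair_poly Pd_def)
    qed (use F.fg_modules F.double_carriers in \<open>auto simp: Pd_def\<close>)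
    moreover have "\<forall>x\<in>UNIV \<times> {0}. \<forall>y\<in>UNIV \<times> {0}. double_form x y = (0 :: 'k poly)"
      by (auto simp: double_form_def neg_var_simps)
    moreover have "\<forall>x\<in>{0} \<times> Pd. \<forall>y\<in>{0} \<times> Pd. double_form x y = 0"
    proof -
      have 0: "f 0 = 0" if "f \<in> Pd" for f using F.dual_scale_apply[of f 0 0] that by (simp add: Pd_def)
      show ?thesis
      proof (intro ballI)
        fix x y assume "x \<in> {0 :: 'p} \<times> Pd" "y \<in> {0 :: 'p} \<times> Pd"
        then obtain f g where "x = (0, f)" "y = (0, g)" "f \<in> Pd" "g \<in> Pd" by blast
        then show "double_form x y = 0" by (simp add: double_form_def 0 neg_var_simps)
      qed
    qed
    ultimately show ?thesis
      using R F.conformal_form_double F.nondegenerate_double_form F.symmetric_double_form F.double_carriers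
      unfolding manin_triple_def Pd_def by blast
  qed
  have cb: "poisson_conformal_bialgebra s P br m \<delta> \<Delta>"
    if ext: "extends_products UNIV br Pd brd brR" "extends_products UNIV m Pd md mR"
      and manin: "manin_triple ?sR ?R brR mR double_form (UNIV \<times> {0}) ({0} \<times> Pd)" for brR mR
  proof -
    have R: "poisson_conformal ?sR ?R brR mR" and inv: "invariant_form ?sR ?R brR double_form" "invariant_form ?sR ?R mR double_form"
      using manin by (auto simp: manin_triple_def)
    then have gcR: "gc_hom ?sR ?R ?sR ?R brR" "gc_hom ?sR ?R ?sR ?R mR"
      by (auto simp: poisson_conformal_at_iff)
    then have cyc: "F.D.cyclic brR" "F.D.cyclic mR"
      using inv F.D.invariant_form_iff[OF dform] unfolding Pd_def by blast+
    have "F.doubles brR br \<delta>"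
      using F.cyclic_extension_doubles[OF _ cyc(1) _ cop(1)] gcR(1) ext(1) unfolding Pd_def brd_def by blast
    moreover have "F.doubles mR m \<Delta>"
      using F.cyclic_extension_doubles[OF _ cyc(2) _ cop(2)] gcR(2) ext(2) unfolding Pd_def md_def by blast
    ultimately show ?thesis
      using F.double_poisson_iff[OF alg coalg] R unfolding P_def Pd_def by blast
  qed
  have ext: "extends_products UNIV br Pd brd ?Br" "extends_products UNIV m Pd md ?Mu"
    using F.double_extends[OF Br pp(1)] F.double_extends[OF Mu pp(2)] unfolding Pd_def brd_def md_def by blast+
  have "poisson_conformal ?sR ?R ?Br ?Mu \<longleftrightarrow>
    (\<exists>brR mR. extends_products P br Pd brd brR \<and> extends_products P m Pd md mR \<and>
       manin_triple ?sR (P \<times> Pd) brR mR double_form (P \<times> {0}) ({0} \<times> Pd))" (is "?R' \<longleftrightarrow> ?M")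
  proof
    assume R: ?R'
    show ?M
      by (rule exI[of _ ?Br], rule exI[of _ ?Mu]) (use ext bc[OF R] in \<open>unfold P_def, intro conjI\<close>)
  next
    assume ?M
    then obtain brR mR where "extends_products UNIV br Pd brd brR" "extends_products UNIV m Pd md mR"
      "manin_triple ?sR ?R brR mR double_form (UNIV \<times> {0}) ({0} \<times> Pd)"
      unfolding P_def by (elim exE conjE)
    from cb[OF this] show ?R' unfolding ab .
  qed
  then show ?thesis unfolding matched ab by simp
qed

end
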